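(* Let $G$ be a finite group, let $x\in K_{\mathrm{Dev},G}(\mathrm{pt})$, and view $x(g,h)$, for a pair of commuting elements $g,h\in G$, as the $q$-expansion of a function $x(g,h;z)$, $q=e^{2\pi iz}$. Then the $n$-th Hecke operator $T_n$ associated to the stringy power operations $P_n^{\mathrm{str}}$ is given by $$(T_n(x))(g,h;z)=\frac1n\sum_{\substack{Nk=n\\0\le m<k}}x\Big(g^k,\;g^{-m}h^N;\;\frac{Nz+m}k\Big).$$
   Context: Devoto $K$-theory of a point. $G$ finite, $C_g$ the centralizer, $|g|$ the order, $\zeta_l=e^{2\pi i/l}$. $K_{\mathrm{Dev},G}(\mathrm{pt})$ is the subring of $\bigoplus_{[g]}R(C_g)[[q^{1/|g|}]]$ of series in which $g$ acts on the coefficient of $q^{j/|g|}$ in the $[g]$-summand by $\zeta_{|g|}^j$. For $x$ with $x_{[g]}=\sum_jV_jq^{j/|g|}$ and $h\in C_g$, $x(g,h)=\sum_j\mathrm{Trace}(h|V_j)q^{j/|g|}$ and $x(g,h;z)=\sum_j\mathrm{Trace}(h|V_j)e^{2\pi ijz/|g|}$; substitutions for $z$ are understood termwise (formally). $K_{\mathrm{Dev},G,k}(\mathrm{pt})$ is the analogous ring with $R(C_g)$ replaced by $R(C_g^k)$, $C_g^k:=(C_g\times\mathbb Z/k|g|\mathbb Z)/\langle(g^{-1},k)\rangle$, $q^{1/|g|}$ by $q^{1/(k|g|)}$, and $1\in\mathbb Z/k|g|$ acting on the coefficient of $q^{j/(k|g|)}$ by $\zeta_{k|g|}^j$; ${}_k(-)\colon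 K_{\mathrm{Dev},G}\to K_{\mathrm{Dev},G,k}$ sends $\sum V_jq^{j/|g|}$ to $\sum V_jq^{j/(k|g|)}$ with unchanged $C_g$-action. Wreath products. $G\wr\Sigma_n$ has elements $(\underline g,\sigma)$, $(\underline g,\sigma)(\underline h,\tau)=(g_ih_{\sigma^{-1}(i)},\sigma\tau)$. Stringy power operations (for a point). Let $(\underline g,\sigma)\in G\wr\Sigma_n$, with each cycle of $\sigma$ written $(i_1,\dots,i_k)$, and let $P_{(i)}=g_{i_k}\cdots g_{i_1}$. $(P_n^{\mathrm{str}}(x))_{(\underline g,\sigma)}$ is the external tensor product, over all $k$ and all $k$-cycles of $\sigma$, of the series ${}_k(x)_{[P_{(i)}]}$ in powers of $q$ (with $q^a\boxtimes q^b=q^{a+b}$), with the following action of $C(\underline g,\sigma)$: $(\underline h,\tau)$ with $\tau(i_r)=j_{r+m}$ ($r\in\mathbb Z/k$, $0\le m<k$) permutes the tensor factors as $\tau$ permutes the cycles (with the usual sign convention for virtual representations), acting between the factors by the element $h_{j_k}g_{i_{1-m}}^{-1}\cdots g_{i_k}^{-1}\in G$ ($m$ factors $g^{-1}$) together with $m\in\mathbb Z/k|P_{(i)}|$. This is an element of $K_{\mathrm{Dev},G\wr\Sigma_n}(\mathrm{pt})$. Hecke operators. $T_n(x):=\frac1n\sum_{\alpha\in A}\psi_\alpha(x)$, where $A$ is a system of representatives of the conjugacy classes (under simultaneous conjugation) of pairs of commuting elements $(\sigma,\tau)$ of $\Sigma_n$ such that the subgroup generated by $\sigma,\tau$ acts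 transitively on $\{1,\dots,n\}$, and for $\alpha=(\sigma,\tau)$, $\psi_\alpha(x)$ is the restriction of $P_n^{\mathrm{str}}(x)$ along the diagonal inclusion $G\times\Sigma_n\to G\wr\Sigma_n$, evaluated at $(\sigma,\tau)$ in the $\Sigma_n$-variable: $\psi_{(\sigma,\tau)}(x)(g,h)=\mathrm{Trace}\big(((h,\dots,h),\tau)\,|\,(P_n^{\mathrm{str}}(x))_{((g,\dots,g),\sigma)}\big)$. *)

theory Defs
  imports
    "Jordan_Normal_Form.Matrix"
    "HOL-Algebra.Elementary_Groups"
    "HOL-Algebra.Multiplicative_Group"
    "HOL-Algebra.Sym_Groups"
    "HOL-Combinatorics.Orbits"
begin

section \<open>Representations and representation rings\<close>

text \<open>
  A (finite-dimensional, complex) representation is a dimension together with a matrix for every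
  group element.  Values off the carrier of the group are irrelevant everywhere below.
\<close>

type_synonym 'h rep = "nat \<times> ('h \<Rightarrow> complex mat)"

definition reps :: "('h, 'm) monoid_scheme \<Rightarrow> 'h rep set" where
  "reps H = {(d, \<rho>). (\<forall>h\<in>carrier H. \<rho> h \<in> carrier_mat d d) \<and> \<rho> \<one>\<^bsub>H\<^esub> = 1\<^sub>m d \<and>
     (\<forall>h\<in>carrier H. \<forall>h'\<in>carrier H. \<rho> (h \<otimes>\<^bsub>H\<^esub> h') = \<rho> h * \<rho> h')}"

definition rep_iso :: "('h, 'm) monoid_scheme \<Rightarrow> 'h rep \<Rightarrow> 'h rep \<Rightarrow> bool" where
  "rep_iso H V W \<longleftrightarrow> fst V = fst W \<and>
     (\<exists>S\<in>carrier_mat (fst V) (fst V). invertible_mat S \<and>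
        (\<forall>h\<in>carrier H. S * snd V h = snd W h * S))"

definition rep_sum :: "'h rep \<Rightarrow> 'h rep \<Rightarrow> 'h rep" where
  "rep_sum V W = (fst V + fst W,
     \<lambda>h. four_block_mat (snd V h) (0\<^sub>m (fst V) (fst W)) (0\<^sub>m (fst W) (fst V)) (snd W h))"

text \<open>
  The representation ring \<open>R(H)\<close> is the Grothendieck group of representations: the pair \<open>(V, W)\<close>
  stands for the formal difference \<open>V - W\<close>.  Only its underlying set is needed.
\<close>

definition groth_rel :: "('h, 'm) monoid_scheme \<Rightarrow> (('h rep \<times> 'h rep) \<times> ('h rep \<times> 'h rep)) set" where
  "groth_rel H = {((V, W), (V', W')). V \<in> reps H \<and> W \<in> reps H \<and> V' \<in> reps H \<and> W' \<in> reps H \<and>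
     (\<exists>U\<in>reps H. rep_iso H (rep_sum (rep_sum V W') U) (rep_sum (rep_sum V' W) U))}"

type_synonym 'h vrep = "('h rep \<times> 'h rep) set"

definition rep_ring :: "('h, 'm) monoid_scheme \<Rightarrow> 'h vrep set" where
  "rep_ring H = (reps H \<times> reps H) // groth_rel H"

definition vrep_class :: "('h, 'm) monoid_scheme \<Rightarrow> 'h rep \<times> 'h rep \<Rightarrow> 'h vrep" where
  "vrep_class H V = groth_rel H `` {V}"

definition mat_trace :: "complex mat \<Rightarrow> complex" where
  "mat_trace M = (\<Sum>i<dim_row M. M $$ (i, i))"

definition vrep_trace :: "'h \<Rightarrow> 'h vrep \<Rightarrow> complex" where
  "vrep_trace h v = (let (V, W) = (SOME V. V \<in> v) in mat_trace (snd V h) - mat_trace (snd W h))"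


section \<open>Devoto K-theory of a point\<close>

definition centr :: "('g, 'm) monoid_scheme \<Rightarrow> 'g \<Rightarrow> ('g, 'm) monoid_scheme" where
  "centr G g = G\<lparr>carrier := {h \<in> carrier G. h \<otimes>\<^bsub>G\<^esub> g = g \<otimes>\<^bsub>G\<^esub> h}\<rparr>"

definition zeta :: "nat \<Rightarrow> complex" where
  "zeta l = cis (2 * pi / real l)"

definition acts_by :: "'h \<Rightarrow> complex \<Rightarrow> 'h rep \<Rightarrow> bool" where
  "acts_by h c V \<longleftrightarrow> snd V h = c \<cdot>\<^sub>m 1\<^sub>m (fst V)"

text \<open>
  \<open>x g j\<close> is the coefficient of \<open>q\<close> to the power \<open>j/|g|\<close> in the \<open>[g]\<close>-summand, computed with the
  representative \<open>g\<close> of its conjugacy class.  Instead of fixing one representative per class, all of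
  them are used, subject to compatibility with the isomorphisms \<open>R(C_g) \<cong> R(C_h)\<close>, \<open>h = t g t\<inverse>\<close>,
  given by conjugation with \<open>t\<close>.
\<close>

definition KDev :: "('g, 'm) monoid_scheme \<Rightarrow> ('g \<Rightarrow> nat \<Rightarrow> 'g vrep) set" where
  "KDev G = {x \<in> extensional (carrier G).
     (\<forall>g\<in>carrier G. \<forall>j. x g j \<in> rep_ring (centr G g) \<and>
        (\<exists>(V, W)\<in>x g j. acts_by g (zeta (group.ord G g) ^ j) V \<and> acts_by g (zeta (group.ord G g) ^ j) W)) \<and>
     (\<forall>g\<in>carrier G. \<forall>t\<in>carrier G. \<forall>j. \<forall>(V, W)\<in>x g j.
        ((fst V, \<lambda>s. snd V (inv\<^bsub>G\<^esub> t \<otimes>\<^bsub>G\<^esub> s \<otimes>\<^bsub>G\<^esub> t)), (fst W, \<lambda>s. snd W (inv\<^bsub>G\<^esub> t \<otimes>\<^bsub>G\<^esub> s \<otimes>\<^bsub>G\<^esub> t)))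
          \<in> x (t \<otimes>\<^bsub>G\<^esub> g \<otimes>\<^bsub>G\<^esub> inv\<^bsub>G\<^esub> t) j)}"

text \<open>
  A formal series in rational powers of \<open>q\<close> is given by the function sending an exponent to its
  coefficient.  With \<open>q = e\<^bsup>2\<pi>iz\<^esup>\<close> it is the formal combination of the functions \<open>e\<^bsup>2\<pi>isz\<^esup>\<close>, and
  \<open>z_subst a b f\<close> (for \<open>a > 0\<close>) is the result of termwise substituting \<open>a z + b\<close> for \<open>z\<close>: the term
  \<open>f(s) e\<^bsup>2\<pi>isz\<^esup>\<close> becomes \<open>f(s) e\<^bsup>2\<pi>isb\<^esup> e\<^bsup>2\<pi>i(as)z\<^esup>\<close>.
\<close>

type_synonym qseries = "rat \<Rightarrow> complex"

definition z_subst :: "rat \<Rightarrow> rat \<Rightarrow> qseries \<Rightarrow> qseries" where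
  "z_subst a b f = (\<lambda>s. f (s / a) * cis (2 * pi * of_rat (s / a * b)))"

text \<open>The series \<open>x(g,h)\<close>; for given \<open>s\<close> at most one \<open>j\<close> contributes.\<close>

definition dev_char :: "('g, 'm) monoid_scheme \<Rightarrow> ('g \<Rightarrow> nat \<Rightarrow> 'g vrep) \<Rightarrow> 'g \<Rightarrow> 'g \<Rightarrow> qseries" where
  "dev_char G x g h = (\<lambda>s. \<Sum>j | of_nat j / of_nat (group.ord G g) = s. vrep_trace h (x g j))"


section \<open>The groups \<open>C_g\<^sup>k\<close> and the map \<open>\<^sub>k(-)\<close>\<close>

definition tw_prod :: "('g, 'm) monoid_scheme \<Rightarrow> nat \<Rightarrow> 'g \<Rightarrow> ('g \<times> int) monoid" where
  "tw_prod G k g = centr G g \<times>\<times> integer_mod_group (k * group.ord G g)"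

definition tw_sub :: "('g, 'm) monoid_scheme \<Rightarrow> nat \<Rightarrow> 'g \<Rightarrow> ('g \<times> int) set" where
  "tw_sub G k g = generate (tw_prod G k g) {(inv\<^bsub>G\<^esub> g, int k mod int (k * group.ord G g))}"

definition tw_centr :: "('g, 'm) monoid_scheme \<Rightarrow> nat \<Rightarrow> 'g \<Rightarrow> ('g \<times> int) set monoid" where
  "tw_centr G k g = tw_prod G k g Mod tw_sub G k g"

definition tw_rep :: "('g, 'm) monoid_scheme \<Rightarrow> nat \<Rightarrow> 'g \<Rightarrow> nat \<Rightarrow> 'g rep \<Rightarrow> ('g \<times> int) set rep" where
  "tw_rep G k g j V = (fst V, \<lambda>D. let (c, m) = (SOME p. p \<in> D)
     in (zeta (k * group.ord G g) ^ j) ^ nat m \<cdot>\<^sub>m snd V c)"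

text \<open>
  \<open>kmap G k x g j\<close> is the coefficient of \<open>q\<close> to the power \<open>j/(k|g|)\<close> in \<open>\<^sub>k(x)\<close> at \<open>g\<close>.  For the action
  to factor through \<open>C_g\<^sup>k\<close>, the coefficient of \<open>x\<close> must be written as a difference of two
  representations on both of which \<open>g\<close> acts by the prescribed scalar.
\<close>

definition kmap :: "('g, 'm) monoid_scheme \<Rightarrow> nat \<Rightarrow> ('g \<Rightarrow> nat \<Rightarrow> 'g vrep) \<Rightarrow> 'g \<Rightarrow> nat \<Rightarrow> ('g \<times> int) set vrep" where
  "kmap G k x g j = (let (V, W) = (SOME (V, W). (V, W) \<in> x g j \<and>
        acts_by g (zeta (group.ord G g) ^ j) V \<and> acts_by g (zeta (group.ord G g) ^ j) W)
     in vrep_class (tw_centr G k g) (tw_rep G k g j V, tw_rep G k g j W))"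


section \<open>Wreath products and the cycles of a permutation\<close>

definition wreath :: "('g, 'm) monoid_scheme \<Rightarrow> nat \<Rightarrow> ((nat \<Rightarrow> 'g) \<times> (nat \<Rightarrow> nat)) monoid" where
  "wreath G n = \<lparr>carrier = ({1..n} \<rightarrow>\<^sub>E carrier G) \<times> carrier (sym_group n),
     mult = (\<lambda>(g, \<sigma>) (h, \<tau>). (\<lambda>i\<in>{1..n}. g i \<otimes>\<^bsub>G\<^esub> h (inv' \<sigma> i), \<sigma> \<circ> \<tau>)),
     one = (\<lambda>i\<in>{1..n}. \<one>\<^bsub>G\<^esub>, id)\<rparr>"

text \<open>
  Every cycle \<open>(i\<^sub>1,\<dots>,i\<^sub>k)\<close> of \<open>\<sigma>\<close> (fixed points included) is written starting with its least element,
  and represented by it; so \<open>i\<^sub>r = \<sigma>\<^bsup>r-1\<^esup>(i\<^sub>1)\<close>.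
\<close>

definition cycle_start :: "(nat \<Rightarrow> nat) \<Rightarrow> nat \<Rightarrow> nat" where
  "cycle_start \<sigma> a = Min (orbit \<sigma> a)"

definition cycles :: "nat \<Rightarrow> (nat \<Rightarrow> nat) \<Rightarrow> nat set" where
  "cycles n \<sigma> = {i \<in> {1..n}. cycle_start \<sigma> i = i}"

definition cycle_len :: "(nat \<Rightarrow> nat) \<Rightarrow> nat \<Rightarrow> nat" where
  "cycle_len \<sigma> i = card (orbit \<sigma> i)"

definition cycle_elt :: "(nat \<Rightarrow> nat) \<Rightarrow> nat \<Rightarrow> nat \<Rightarrow> nat" where
  "cycle_elt \<sigma> i r = (\<sigma> ^^ (r - 1)) i"

definition list_mult :: "('g, 'm) monoid_scheme \<Rightarrow> 'g list \<Rightarrow> 'g" where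
  "list_mult G gs = foldr (mult G) gs \<one>\<^bsub>G\<^esub>"

text \<open>\<open>P\<^bsub>(i)\<^esub> = g\<^bsub>i\<^sub>k\<^esub> \<dots> g\<^bsub>i\<^sub>1\<^esub>\<close>\<close>

definition cycle_prod :: "('g, 'm) monoid_scheme \<Rightarrow> (nat \<Rightarrow> 'g) \<times> (nat \<Rightarrow> nat) \<Rightarrow> nat \<Rightarrow> 'g" where
  "cycle_prod G = (\<lambda>(g, \<sigma>) i. list_mult G (map (\<lambda>r. g (cycle_elt \<sigma> i r)) (rev [1..<cycle_len \<sigma> i + 1])))"

text \<open>The number \<open>m\<close> with \<open>\<tau>(i\<^sub>r) = j\<^bsub>r+m\<^esub>\<close>, where \<open>(j)\<close> is the image under \<open>\<tau>\<close> of the cycle \<open>(i)\<close>.\<close>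

definition cycle_shift :: "(nat \<Rightarrow> nat) \<Rightarrow> (nat \<Rightarrow> nat) \<Rightarrow> nat \<Rightarrow> nat" where
  "cycle_shift \<sigma> \<tau> i = (THE m. m < cycle_len \<sigma> i \<and>
     (\<forall>r\<ge>1. \<tau> (cycle_elt \<sigma> i r) = cycle_elt \<sigma> (cycle_start \<sigma> (\<tau> i)) (r + m)))"

text \<open>
  \<open>h\<^bsub>j\<^sub>k\<^esub> g\<^bsub>i\<^sub>1\<^sub>-\<^sub>m\<^esub>\<inverse> \<dots> g\<^bsub>i\<^sub>k\<^esub>\<inverse>\<close>, with the indices \<open>1-m, \<dots>, 0\<close> shifted by \<open>k\<close>.
\<close>

definition cycle_map_elt :: "('g, 'm) monoid_scheme \<Rightarrow> (nat \<Rightarrow> 'g) \<times> (nat \<Rightarrow> nat) \<Rightarrow>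
    (nat \<Rightarrow> 'g) \<times> (nat \<Rightarrow> nat) \<Rightarrow> nat \<Rightarrow> 'g" where
  "cycle_map_elt G = (\<lambda>(g, \<sigma>) (h, \<tau>) i.
     let k = cycle_len \<sigma> i; m = cycle_shift \<sigma> \<tau> i; j = cycle_start \<sigma> (\<tau> i)
     in h (cycle_elt \<sigma> j k) \<otimes>\<^bsub>G\<^esub>
        list_mult G (map (\<lambda>r. inv\<^bsub>G\<^esub> (g (cycle_elt \<sigma> i r))) [k + 1 - m..<k + 1]))"


section \<open>Stringy power operations\<close>

text \<open>
  The tensor factor \<open>\<^sub>k(x)\<^bsub>[P]\<^esub>\<close> is the value of \<open>\<^sub>k(x)\<close> at a chosen representative of the conjugacy
  class of \<open>P\<close>.  An element \<open>c\<close> with \<open>c P c\<inverse> = P'\<close> maps the factor of \<open>P\<close> to the one of \<open>P'\<close>; in terms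
  of chosen elements conjugating the representative to \<open>P\<close> and \<open>P'\<close> it is an element of the
  centralizer of that representative.
\<close>

definition conj_class :: "('g, 'm) monoid_scheme \<Rightarrow> 'g \<Rightarrow> 'g set" where
  "conj_class G g = {t \<otimes>\<^bsub>G\<^esub> g \<otimes>\<^bsub>G\<^esub> inv\<^bsub>G\<^esub> t | t. t \<in> carrier G}"

definition conj_rep :: "('g, 'm) monoid_scheme \<Rightarrow> 'g \<Rightarrow> 'g" where
  "conj_rep G g = (SOME r. r \<in> conj_class G g)"

definition conj_elt :: "('g, 'm) monoid_scheme \<Rightarrow> 'g \<Rightarrow> 'g" where
  "conj_elt G g = (SOME t. t \<in> carrier G \<and> t \<otimes>\<^bsub>G\<^esub> conj_rep G g \<otimes>\<^bsub>G\<^esub> inv\<^bsub>G\<^esub> t = g)"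

text \<open>
  A virtual representation \<open>(V, W)\<close> is treated as the \<open>\<int>/2\<close>-graded representation with even part
  \<open>V\<close> and odd part \<open>W\<close>.  The Boolean is the parity (\<open>True\<close> for odd).
\<close>

definition parity_part :: "bool \<Rightarrow> 'h rep \<times> 'h rep \<Rightarrow> 'h rep" where
  "parity_part p V = (if p then snd V else fst V)"

definition str_factor :: "('g, 'm) monoid_scheme \<Rightarrow> ('g \<Rightarrow> nat \<Rightarrow> 'g vrep) \<Rightarrow>
    (nat \<Rightarrow> 'g) \<times> (nat \<Rightarrow> nat) \<Rightarrow> nat \<Rightarrow> nat \<Rightarrow> ('g \<times> int) set rep \<times> ('g \<times> int) set rep" where
  "str_factor G x u i j =
     (SOME V. V \<in> kmap G (cycle_len (snd u) i) x (conj_rep G (cycle_prod G u i)) j)"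

text \<open>
  The element of \<open>C_r\<^sup>k\<close>, \<open>r\<close> the representative of \<open>[P\<^bsub>(i)\<^esub>]\<close>, by which \<open>v\<close> acts from the factor of
  the cycle \<open>(i)\<close> to the factor of its image.
\<close>

definition str_elt :: "('g, 'm) monoid_scheme \<Rightarrow> (nat \<Rightarrow> 'g) \<times> (nat \<Rightarrow> nat) \<Rightarrow>
    (nat \<Rightarrow> 'g) \<times> (nat \<Rightarrow> nat) \<Rightarrow> nat \<Rightarrow> ('g \<times> int) set" where
  "str_elt G u v i =
     (let k = cycle_len (snd u) i; r = conj_rep G (cycle_prod G u i);
          t = conj_elt G (cycle_prod G u i);
          t' = conj_elt G (cycle_prod G u (cycle_start (snd u) (snd v i)))
      in tw_sub G k r #>\<^bsub>tw_prod G k r\<^esub>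
           (inv\<^bsub>G\<^esub> t' \<otimes>\<^bsub>G\<^esub> cycle_map_elt G u v i \<otimes>\<^bsub>G\<^esub> t, int (cycle_shift (snd u) (snd v) i)))"

text \<open>
  Basis of the coefficient of \<open>q\<close> to the power \<open>J/|u|\<close> in the external tensor product: each cycle
  \<open>(i)\<close> is assigned \<open>(j, p, a)\<close>, meaning the \<open>a\<close>-th basis vector of the parity \<open>p\<close> part of the
  coefficient of \<open>q\<close> to the power \<open>j/(k|P\<^bsub>(i)\<^esub>|)\<close> in the factor of that cycle.
\<close>

definition str_basis :: "('g, 'm) monoid_scheme \<Rightarrow> nat \<Rightarrow> ('g \<Rightarrow> nat \<Rightarrow> 'g vrep) \<Rightarrow>
    (nat \<Rightarrow> 'g) \<times> (nat \<Rightarrow> nat) \<Rightarrow> nat \<Rightarrow> (nat \<Rightarrow> nat \<times> bool \<times> nat) set" where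
  "str_basis G n x u J =
     {b \<in> (\<Pi>\<^sub>E i\<in>cycles n (snd u). {(j, p, a). a < fst (parity_part p (str_factor G x u i j))}).
        (\<Sum>i\<in>cycles n (snd u). of_nat (fst (b i)) /
            of_nat (cycle_len (snd u) i * group.ord G (cycle_prod G u i)))
          = (of_nat J / of_nat (group.ord (wreath G n) u) :: rat)}"

definition odd_cycles :: "nat \<Rightarrow> (nat \<Rightarrow> nat) \<Rightarrow> (nat \<Rightarrow> nat \<times> bool \<times> nat) \<Rightarrow> nat set" where
  "odd_cycles n \<sigma> b = {i \<in> cycles n \<sigma>. fst (snd (b i))}"

text \<open>Koszul sign: tensor factors are ordered by the least elements of the cycles.\<close>

definition koszul_sign :: "nat \<Rightarrow> (nat \<Rightarrow> nat) \<Rightarrow> (nat \<Rightarrow> nat) \<Rightarrow> (nat \<Rightarrow> nat \<times> bool \<times> nat) \<Rightarrow> complex" where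
  "koszul_sign n \<sigma> \<tau> b = (- 1) ^ card {(i, i'). i \<in> odd_cycles n \<sigma> b \<and> i' \<in> odd_cycles n \<sigma> b \<and>
     i < i' \<and> cycle_start \<sigma> (\<tau> i') < cycle_start \<sigma> (\<tau> i)}"

text \<open>The coefficient of the basis vector \<open>b'\<close> in the image of the basis vector \<open>b\<close> under \<open>v\<close>.\<close>

definition str_entry :: "('g, 'm) monoid_scheme \<Rightarrow> nat \<Rightarrow> ('g \<Rightarrow> nat \<Rightarrow> 'g vrep) \<Rightarrow>
    (nat \<Rightarrow> 'g) \<times> (nat \<Rightarrow> nat) \<Rightarrow> (nat \<Rightarrow> 'g) \<times> (nat \<Rightarrow> nat) \<Rightarrow>
    (nat \<Rightarrow> nat \<times> bool \<times> nat) \<Rightarrow> (nat \<Rightarrow> nat \<times> bool \<times> nat) \<Rightarrow> complex" where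
  "str_entry G n x u v b' b = koszul_sign n (snd u) (snd v) b *
     (\<Prod>i\<in>cycles n (snd u).
        let (j', p', a') = b' (cycle_start (snd u) (snd v i)); (j, p, a) = b i
        in if j' = j \<and> p' = p
           then snd (parity_part p (str_factor G x u i j)) (str_elt G u v i) $$ (a', a)
           else 0)"

definition mat_on :: "'b set \<Rightarrow> ('b \<Rightarrow> 'b \<Rightarrow> complex) \<Rightarrow> complex mat" where
  "mat_on B f = (let e = (SOME e. bij_betw e {..<card B} B)
     in mat (card B) (card B) (\<lambda>(a', a). f (e a') (e a)))"

definition str_part :: "('g, 'm) monoid_scheme \<Rightarrow> nat \<Rightarrow> ('g \<Rightarrow> nat \<Rightarrow> 'g vrep) \<Rightarrow>
    (nat \<Rightarrow> 'g) \<times> (nat \<Rightarrow> nat) \<Rightarrow> nat \<Rightarrow> bool \<Rightarrow> ((nat \<Rightarrow> 'g) \<times> (nat \<Rightarrow> nat)) rep" where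
  "str_part G n x u J p =
     (let B = {b \<in> str_basis G n x u J. odd (card (odd_cycles n (snd u) b)) = p}
      in (card B, \<lambda>v. mat_on B (str_entry G n x u v)))"

definition P_str :: "('g, 'm) monoid_scheme \<Rightarrow> nat \<Rightarrow> ('g \<Rightarrow> nat \<Rightarrow> 'g vrep) \<Rightarrow>
    (nat \<Rightarrow> 'g) \<times> (nat \<Rightarrow> nat) \<Rightarrow> nat \<Rightarrow> ((nat \<Rightarrow> 'g) \<times> (nat \<Rightarrow> nat)) vrep" where
  "P_str G n x = (\<lambda>u\<in>carrier (wreath G n). \<lambda>J.
     vrep_class (centr (wreath G n) u) (str_part G n x u J False, str_part G n x u J True))"


section \<open>Hecke operators\<close>

definition diag :: "nat \<Rightarrow> 'g \<Rightarrow> (nat \<Rightarrow> nat) \<Rightarrow> (nat \<Rightarrow> 'g) \<times> (nat \<Rightarrow> nat)" where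
  "diag n g \<sigma> = (\<lambda>i\<in>{1..n}. g, \<sigma>)"

definition psi :: "('g, 'm) monoid_scheme \<Rightarrow> nat \<Rightarrow> (nat \<Rightarrow> nat) \<times> (nat \<Rightarrow> nat) \<Rightarrow>
    ('g \<Rightarrow> nat \<Rightarrow> 'g vrep) \<Rightarrow> 'g \<Rightarrow> 'g \<Rightarrow> qseries" where
  "psi G n = (\<lambda>(\<sigma>, \<tau>) x g h. dev_char (wreath G n) (P_str G n x) (diag n g \<sigma>) (diag n h \<tau>))"

definition trans_pairs :: "nat \<Rightarrow> ((nat \<Rightarrow> nat) \<times> (nat \<Rightarrow> nat)) set" where
  "trans_pairs n = {(\<sigma>, \<tau>). \<sigma> \<in> carrier (sym_group n) \<and> \<tau> \<in> carrier (sym_group n) \<and>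
     \<sigma> \<circ> \<tau> = \<tau> \<circ> \<sigma> \<and>
     (\<forall>i\<in>{1..n}. \<forall>j\<in>{1..n}. \<exists>\<rho>\<in>generate (sym_group n) {\<sigma>, \<tau>}. \<rho> i = j)}"

definition pair_conj :: "nat \<Rightarrow> (nat \<Rightarrow> nat) \<times> (nat \<Rightarrow> nat) \<Rightarrow> (nat \<Rightarrow> nat) \<times> (nat \<Rightarrow> nat) \<Rightarrow> bool" where
  "pair_conj n = (\<lambda>(\<sigma>, \<tau>) (\<sigma>', \<tau>'). \<exists>\<rho>\<in>carrier (sym_group n).
     \<sigma>' = \<rho> \<circ> \<sigma> \<circ> inv' \<rho> \<and> \<tau>' = \<rho> \<circ> \<tau> \<circ> inv' \<rho>)"

definition rep_system :: "nat \<Rightarrow> ((nat \<Rightarrow> nat) \<times> (nat \<Rightarrow> nat)) set \<Rightarrow> bool" where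
  "rep_system n A \<longleftrightarrow> A \<subseteq> trans_pairs n \<and> (\<forall>\<alpha>\<in>trans_pairs n. \<exists>!\<beta>. \<beta> \<in> A \<and> pair_conj n \<alpha> \<beta>)"

definition hecke :: "('g, 'm) monoid_scheme \<Rightarrow> nat \<Rightarrow> ((nat \<Rightarrow> nat) \<times> (nat \<Rightarrow> nat)) set \<Rightarrow>
    ('g \<Rightarrow> nat \<Rightarrow> 'g vrep) \<Rightarrow> 'g \<Rightarrow> 'g \<Rightarrow> qseries" where
  "hecke G n A x g h = (\<lambda>s. 1 / of_nat n * (\<Sum>\<alpha>\<in>A. psi G n \<alpha> x g h s))"

end

theory Submission
  imports Defs
begin

text \<open>
  A transitive commuting pair \<open>(\<sigma>, \<tau>)\<close> in \<open>\<Sigma>\<^sub>n\<close> is a transitive action of \<open>\<int>\<^sup>2\<close> on \<open>n\<close> points, so its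
  conjugacy class corresponds to a sublattice of \<open>\<int>\<^sup>2\<close> of index \<open>n\<close>, that is, a triple \<open>(N, k, m)\<close> with \<open>Nk = n\<close> and
  \<open>0 \<le> m < k\<close>: \<open>\<sigma>\<close> has \<open>N\<close> cycles of length \<open>k\<close>, which \<open>\<tau>\<close> permutes cyclically, and \<open>\<tau>\<^bsup>N\<^esup> = \<sigma>\<^bsup>m\<^esup>\<close>
  (\<open>chart_exists\<close>, \<open>chart_type_unique\<close>, \<open>types_bij\<close>).  It remains to compute the contribution of one such
  pair (\<open>psi_chart\<close>).

  At \<open>u = ((g, \<dots>, g), \<sigma>)\<close> every cycle has the product \<open>P = g\<^bsup>k\<^esup>\<close>, so the power operation is the \<open>N\<close>-fold
  tensor power of one graded super representation \<open>V\<close>, the value at \<open>P\<close> of the series \<open>\<^sub>k(x)\<close>.  The element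
  \<open>v = ((h, \<dots>, h), \<tau>)\<close> permutes the \<open>N\<close> factors cyclically while acting between them.  The
  supertrace of such an operator on the tensor power is the supertrace on \<open>V\<close> of the product of the operators
  around the loop (\<open>cyclic_trace\<close>): only constant degrees and parities contribute, and the Koszul sign
  \<open>(-1)\<^bsup>N-1\<^esup>\<close> of an \<open>N\<close>-cycle on odd factors together with their total parity \<open>(-1)\<^bsup>N\<^esup>\<close> gives \<open>-1\<close>.
  Since a factor of degree \<open>j\<close> is repeated \<open>N\<close> times, the exponent of \<open>q\<close> is \<open>Nj/(k|P|)\<close>.

  The elements of \<open>C\<^sub>P\<^sup>k\<close> by which \<open>v\<close> acts between the factors form a cocycle
  (\<open>str_elt_mult\<close>), so the product around the loop is the element belonging to \<open>v\<^bsup>N\<^esup>\<close>, which maps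
  each cycle to itself with shift \<open>m\<close>.  This is \<open>(h\<^bsup>N\<^esup>g\<^bsup>-m\<^esup>, m)\<close>, with trace \<open>\<zeta>\<^bsup>jm\<^esup> Trace(g\<^bsup>-m\<^esup>h\<^bsup>N\<^esup> | V\<^sub>j)\<close> on the
  coefficient \<open>V\<^sub>j\<close> of \<open>x\<close>, where \<open>\<zeta> = e\<^bsup>2\<pi>i/k|P|\<^esup>\<close>.  Summed over \<open>j\<close>, these terms are
  \<open>x(g\<^bsup>k\<^esup>, g\<^bsup>-m\<^esup>h\<^bsup>N\<^esup>; (Nz + m)/k)\<close> (\<open>rescale_series\<close>).

  All traces are taken in Grothendieck groups, where characters are defined on classes of honest
  representations.  So it must also be known that the matrices above form representations: of
  the quotient \<open>C\<^sub>P\<^sup>k\<close> (\<open>tw_rep_in_reps\<close>), and of the full centralizer of \<open>u\<close> in the wreath product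
  (\<open>str_part_in_reps\<close>).  The second fact combines the cocycle property with the multiplicativity of
  Koszul signs (\<open>order_sign_comp\<close>).
\<close>

section \<open>Traces of virtual representations\<close>

lemma repsD:
  assumes "V \<in> reps H"
  shows "h \<in> carrier H \<Longrightarrow> snd V h \<in> carrier_mat (fst V) (fst V)"
    and "snd V \<one>\<^bsub>H\<^esub> = 1\<^sub>m (fst V)"
    and "h \<in> carrier H \<Longrightarrow> h' \<in> carrier H \<Longrightarrow> snd V (h \<otimes>\<^bsub>H\<^esub> h') = snd V h * snd V h'"
  using assms unfolding reps_def by auto

lemma repsI:
  assumes "\<And>h. h \<in> carrier H \<Longrightarrow> \<rho> h \<in> carrier_mat d d" and "\<rho> \<one>\<^bsub>H\<^esub> = 1\<^sub>m d"
    and "\<And>h h'. h \<in> carrier H \<Longrightarrow> h' \<in> carrier H \<Longrightarrow> \<rho> (h \<otimes>\<^bsub>H\<^esub> h') = \<rho> h * \<rho> h'"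
  shows "(d, \<rho>) \<in> reps H"
  using assms unfolding reps_def by auto

lemma mat_trace_comm:
  assumes "A \<in> carrier_mat m l" "B \<in> carrier_mat l m"
  shows "mat_trace (A * B) = mat_trace (B * A)"
proof -
  have "mat_trace (A * B) = (\<Sum>i<m. \<Sum>j<l. A $$ (i, j) * B $$ (j, i))"
    using assms by (auto simp: mat_trace_def scalar_prod_def atLeast0LessThan intro!: sum.cong)
  also have "\<dots> = (\<Sum>j<l. \<Sum>i<m. B $$ (j, i) * A $$ (i, j))"
    by (subst sum.swap) (simp add: mult.commute)
  also have "\<dots> = mat_trace (B * A)"
    using assms by (auto simp: mat_trace_def scalar_prod_def atLeast0LessThan intro!: sum.cong)
  finally show ?thesis .
qed

lemma mat_trace_smult: "A \<in> carrier_mat d d \<Longrightarrow> mat_trace (c \<cdot>\<^sub>m A) = c * mat_trace A"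
  by (auto simp: mat_trace_def sum_distrib_left intro!: sum.cong)

lemma mat_trace_diag_block:
  assumes "A \<in> carrier_mat m m" "B \<in> carrier_mat l l"
  shows "mat_trace (four_block_mat A (0\<^sub>m m l) (0\<^sub>m l m) B) = mat_trace A + mat_trace B"
proof -
  have "mat_trace (four_block_mat A (0\<^sub>m m l) (0\<^sub>m l m) B)
      = (\<Sum>i<m + l. if i < m then A $$ (i, i) else B $$ (i - m, i - m))"
    using assms by (auto simp: mat_trace_def intro!: sum.cong)
  also have "\<dots> = (\<Sum>i<m. A $$ (i, i)) + (\<Sum>i<l. B $$ (i, i))"
  proof (induction l)
    case 0
    then show ?case by (auto intro!: sum.cong)
  next
    case (Suc l)
    then show ?case by (simp add: add.assoc)
  qed
  finally show ?thesis
    using assms by (simp add: mat_trace_def)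
qed

lemma rep_sum_in_reps:
  assumes "V \<in> reps H" "W \<in> reps H" "group H"
  shows "rep_sum V W \<in> reps H"
  unfolding rep_sum_def
proof (rule repsI)
  fix h h' assume h: "h \<in> carrier H" and h': "h' \<in> carrier H"
  note V = repsD[OF assms(1)] and W = repsD[OF assms(2)]
  show "four_block_mat (snd V h) (0\<^sub>m (fst V) (fst W)) (0\<^sub>m (fst W) (fst V)) (snd W h)
      \<in> carrier_mat (fst V + fst W) (fst V + fst W)"
    using V(1)[OF h] W(1)[OF h] by simp
  show "four_block_mat (snd V (h \<otimes>\<^bsub>H\<^esub> h')) (0\<^sub>m (fst V) (fst W)) (0\<^sub>m (fst W) (fst V))
          (snd W (h \<otimes>\<^bsub>H\<^esub> h')) =
        four_block_mat (snd V h) (0\<^sub>m (fst V) (fst W)) (0\<^sub>m (fst W) (fst V)) (snd W h) *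
        four_block_mat (snd V h') (0\<^sub>m (fst V) (fst W)) (0\<^sub>m (fst W) (fst V)) (snd W h')"
    unfolding mult_four_block_mat[OF V(1)[OF h] zero_carrier_mat zero_carrier_mat W(1)[OF h]
        V(1)[OF h'] zero_carrier_mat zero_carrier_mat W(1)[OF h']]
    using V(1)[OF h] V(1)[OF h'] W(1)[OF h] W(1)[OF h'] V(3)[OF h h'] W(3)[OF h h'] by simp
qed (use repsD(2)[OF assms(1)] repsD(2)[OF assms(2)] in simp)

lemma mat_trace_rep_sum:
  assumes "V \<in> reps H" "W \<in> reps H" "h \<in> carrier H"
  shows "mat_trace (snd (rep_sum V W) h) = mat_trace (snd V h) + mat_trace (snd W h)"
  using mat_trace_diag_block[OF repsD(1)[OF assms(1,3)] repsD(1)[OF assms(2,3)]]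
  by (simp add: rep_sum_def)

lemma mat_trace_rep_iso:
  assumes "rep_iso H V W" "V \<in> reps H" "W \<in> reps H" "h \<in> carrier H"
  shows "mat_trace (snd V h) = mat_trace (snd W h)"
proof -
  obtain S where S: "S \<in> carrier_mat (fst V) (fst V)" "invertible_mat S" "S * snd V h = snd W h * S"
    and eq: "fst V = fst W"
    using assms(1,4) unfolding rep_iso_def by blast
  then obtain T where T: "S * T = 1\<^sub>m (fst V)" "T * S = 1\<^sub>m (dim_row T)"
    unfolding invertible_mat_def inverts_mat_def by auto
  have "dim_col (S * T) = fst V" "dim_col (T * S) = dim_row T"
    using T by simp_all
  then have Tc: "T \<in> carrier_mat (fst V) (fst V)"
    using S(1) by auto
  have V: "snd V h \<in> carrier_mat (fst V) (fst V)" and W: "snd W h \<in> carrier_mat (fst V) (fst V)"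
    using repsD(1)[OF assms(2,4)] repsD(1)[OF assms(3,4)] eq by simp_all
  have "snd V h = (T * S) * snd V h"
    using T Tc V by simp
  also have "\<dots> = T * (snd W h * S)"
    using S(1,3) Tc V by (simp add: assoc_mult_mat)
  finally have "mat_trace (snd V h) = mat_trace ((snd W h * S) * T)"
    using mat_trace_comm[OF Tc, of "snd W h * S"] S(1) W by simp
  also have "(snd W h * S) * T = snd W h"
    using S(1) Tc W T by (simp add: assoc_mult_mat)
  finally show ?thesis .
qed

text \<open>
  An isomorphism preserves traces and the trace of a sum is the sum of the traces.  So the trace of
  the auxiliary summand cancels, and all representatives of a virtual representation have the same
  character.
\<close>

lemma groth_rel_trace:
  assumes "group H" "((V, W), (V', W')) \<in> groth_rel H" "h \<in> carrier H"
  shows "mat_trace (snd V h) - mat_trace (snd W h) = mat_trace (snd V' h) - mat_trace (snd W' h)"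
proof -
  obtain U where r: "V \<in> reps H" "W \<in> reps H" "V' \<in> reps H" "W' \<in> reps H" "U \<in> reps H"
    and iso: "rep_iso H (rep_sum (rep_sum V W') U) (rep_sum (rep_sum V' W) U)"
    using assms(2) unfolding groth_rel_def by auto
  have "mat_trace (snd (rep_sum (rep_sum V W') U) h) = mat_trace (snd (rep_sum (rep_sum V' W) U) h)"
    using r assms by (intro mat_trace_rep_iso[OF iso] rep_sum_in_reps)
  then show ?thesis
    using r assms by (simp add: mat_trace_rep_sum[OF _ _ assms(3)] rep_sum_in_reps algebra_simps)
qed

lemma vrep_trace_eq:
  assumes "group H" "v \<in> rep_ring H" "(V, W) \<in> v" "h \<in> carrier H"
  shows "vrep_trace h v = mat_trace (snd V h) - mat_trace (snd W h)"
proof -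
  obtain V0 W0 where v: "v = groth_rel H `` {(V0, W0)}"
    using assms(2) unfolding rep_ring_def quotient_def by auto
  obtain V1 W1 where some: "(SOME V. V \<in> v) = (V1, W1)"
    using prod.exhaust by blast
  have "(V1, W1) \<in> v"
    using someI[of "\<lambda>V. V \<in> v", OF assms(3)] some by simp
  then have "mat_trace (snd V1 h) - mat_trace (snd W1 h) = mat_trace (snd V h) - mat_trace (snd W h)"
    using groth_rel_trace[OF assms(1) _ assms(4), of V0 W0 V1 W1]
      groth_rel_trace[OF assms(1) _ assms(4), of V0 W0 V W] assms(3) unfolding v by simp
  then show ?thesis
    by (simp add: vrep_trace_def some)
qed

text \<open>
  The relation holds between representations only, so the class of a pair that is not known to consist
  of representations could be empty.  This is why the power operation is later shown to be a
  representation of the whole centralizer.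
\<close>

lemma vrep_class_in:
  assumes "group H" "V \<in> reps H" "W \<in> reps H"
  shows "vrep_class H (V, W) \<in> rep_ring H" and "(V, W) \<in> vrep_class H (V, W)"
proof -
  show "vrep_class H (V, W) \<in> rep_ring H"
    using assms(2,3) unfolding vrep_class_def rep_ring_def by (blast intro: quotientI)
  let ?U = "rep_sum (rep_sum V W) V"
  have "?U \<in> reps H"
    using assms by (simp add: rep_sum_in_reps)
  then have "\<forall>h\<in>carrier H. 1\<^sub>m (fst ?U) * snd ?U h = snd ?U h * 1\<^sub>m (fst ?U)"
    using repsD(1)[of ?U H] left_mult_one_mat right_mult_one_mat by metis
  moreover have "invertible_mat (1\<^sub>m (fst ?U) :: complex mat)"
    by (auto simp: invertible_mat_def inverts_mat_def intro!: exI[of _ "1\<^sub>m (fst ?U)"])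
  ultimately have "rep_iso H ?U ?U"
    unfolding rep_iso_def using one_carrier_mat by blast
  then show "(V, W) \<in> vrep_class H (V, W)"
    using assms unfolding vrep_class_def groth_rel_def by auto
qed

lemma rep_ring_reps:
  assumes "v \<in> rep_ring H" "(V, W) \<in> v"
  shows "V \<in> reps H" "W \<in> reps H"
  using assms unfolding rep_ring_def quotient_def groth_rel_def by auto

section \<open>The groups \<open>C\<^sub>g\<^sup>k\<close>\<close>

lemma (in group) commute_inv:
  assumes "a \<in> carrier G" "g \<in> carrier G" "a \<otimes> g = g \<otimes> a"
  shows "inv a \<otimes> g = g \<otimes> inv a"
proof -
  have "a \<otimes> (g \<otimes> inv a) = g"
    using assms by (simp add: m_assoc[symmetric]) (simp add: m_assoc)
  then show ?thesis
    using inv_solve_left[of "g \<otimes> inv a" a g] assms by simp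
qed

lemma nat_add_mod: "0 \<le> a \<Longrightarrow> 0 \<le> b \<Longrightarrow> nat ((a + b) mod int l) = (nat a + nat b) mod l"
  by (simp add: nat_mod_distrib nat_add_distrib)

lemma nat_int_mod: "nat (int a mod int l) = a mod l"
  by (simp add: nat_mod_distrib)

lemma (in group) centr_group:
  assumes "g \<in> carrier G"
  shows "Group.group (centr G g)"
proof -
  have "subgroup {h \<in> carrier G. h \<otimes> g = g \<otimes> h} G"
  proof (rule subgroupI)
    fix a assume a: "a \<in> {h \<in> carrier G. h \<otimes> g = g \<otimes> h}"
    then show "inv a \<in> {h \<in> carrier G. h \<otimes> g = g \<otimes> h}"
      using commute_inv[of a g] a assms by simp
  next
    fix a b assume "a \<in> {h \<in> carrier G. h \<otimes> g = g \<otimes> h}" "b \<in> {h \<in> carrier G. h \<otimes> g = g \<otimes> h}"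
    then show "a \<otimes> b \<in> {h \<in> carrier G. h \<otimes> g = g \<otimes> h}"
      using assms by (simp add: m_assoc) (simp add: m_assoc[symmetric])
  qed (use assms in auto)
  then show ?thesis
    unfolding centr_def by (rule subgroup.subgroup_is_group) (rule is_group)
qed

lemma centr_simps [simp]:
  "c \<in> carrier (centr G g) \<longleftrightarrow> c \<in> carrier G \<and> c \<otimes>\<^bsub>G\<^esub> g = g \<otimes>\<^bsub>G\<^esub> c"
  "mult (centr G g) = mult G" "one (centr G g) = one G"
  by (auto simp: centr_def)

lemma zeta_pow: "k > 0 \<Longrightarrow> zeta (k * l) ^ k = zeta l"
  by (simp add: zeta_def DeMoivre)

lemma zeta_pow_self: "l > 0 \<Longrightarrow> zeta l ^ l = 1"
  by (simp add: zeta_def DeMoivre)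

lemma power_mod_period: "w ^ l = (1::complex) \<Longrightarrow> w ^ (a mod l) = w ^ a"
  by (metis (no_types, lifting) div_mult_mod_eq mult.commute mult.left_neutral power_add power_mult power_one)

locale twisted_centralizer = group G for G (structure) +
  fixes k :: nat and r
  assumes fin: "finite (carrier G)" and r: "r \<in> carrier G" and k: "k > 0"
begin

abbreviation "M \<equiv> k * ord r"
abbreviation "Z \<equiv> tw_prod G k r"
abbreviation "z \<equiv> (inv r, int k mod int M)"

lemma M_pos: "M > 0"
  using ord_ge_1[OF fin r] k by simp

lemma carrier_Z: "p \<in> carrier Z \<longleftrightarrow> fst p \<in> carrier (centr G r) \<and> 0 \<le> snd p \<and> snd p < int M"
  using M_pos by (cases p) (auto simp: tw_prod_def carrier_integer_mod_group)

lemma mult_Z: "p \<otimes>\<^bsub>Z\<^esub> p' = (fst p \<otimes> fst p', (snd p + snd p') mod int M)"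
  by (cases p; cases p') (simp add: tw_prod_def)

lemma one_Z: "\<one>\<^bsub>Z\<^esub> = (\<one>, 0)"
  by (simp add: tw_prod_def)

lemma group_Z: "Group.group Z"
  unfolding tw_prod_def by (intro DirProd_group centr_group r group_integer_mod_group)

lemma z_carrier: "z \<in> carrier Z"
  using M_pos r by (simp add: carrier_Z)

text \<open>The relation \<open>(r\<inverse>, k)\<close> is central, so the subgroup that it generates is normal.\<close>

lemma tw_sub_normal: "tw_sub G k r \<lhd> Z"
proof -
  interpret Z: group Z by (rule group_Z)
  have comm: "x \<otimes>\<^bsub>Z\<^esub> s = s \<otimes>\<^bsub>Z\<^esub> x" if "x \<in> carrier Z" "s \<in> generate Z {z}" for x s
  proof -
    have base: "x \<otimes>\<^bsub>Z\<^esub> z = z \<otimes>\<^bsub>Z\<^esub> x"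
    proof -
      have "fst x \<in> carrier G" "fst x \<otimes> r = r \<otimes> fst x"
        using that(1) by (auto simp: carrier_Z)
      then have "fst x \<otimes> inv r = inv r \<otimes> fst x"
        using r commute_inv[of r "fst x"] by simp
      then show ?thesis
        by (simp add: mult_Z add.commute)
    qed
    from that(2) show ?thesis
    proof induction
      case (inv h)
      then have "h = z" by simp
      then show ?case
        using base z_carrier that(1) Z.commute_inv[of h x] by simp
    next
      case (eng h1 h2)
      then have "h1 \<in> carrier Z" "h2 \<in> carrier Z"
        using Z.generate_in_carrier z_carrier by blast+
      then show ?case
        using eng that(1) by (metis Z.m_assoc)
    qed (use that(1) base in simp_all)
  qed
  show ?thesis
    unfolding tw_sub_def
  proof (subst Z.normal_inv_iff, intro conjI ballI)
    show "subgroup (generate Z {z}) Z"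
      using z_carrier by (intro Z.generate_is_subgroup) simp
    fix x s assume x: "x \<in> carrier Z" and s: "s \<in> generate Z {z}"
    then have "s \<in> carrier Z"
      using Z.generate_in_carrier z_carrier by blast
    then show "x \<otimes>\<^bsub>Z\<^esub> s \<otimes>\<^bsub>Z\<^esub> inv\<^bsub>Z\<^esub> x \<in> generate Z {z}"
      using comm[OF x s] x s by (simp add: Z.m_assoc)
  qed
qed

lemma group_tw_centr: "Group.group (tw_centr G k r)"
  unfolding tw_centr_def using tw_sub_normal by (rule normal.factorgroup_is_group)

lemma coset_mult:
  assumes "p \<in> carrier Z" "p' \<in> carrier Z"
  shows "(tw_sub G k r #>\<^bsub>Z\<^esub> p) \<otimes>\<^bsub>tw_centr G k r\<^esub> (tw_sub G k r #>\<^bsub>Z\<^esub> p') = tw_sub G k r #>\<^bsub>Z\<^esub> (p \<otimes>\<^bsub>Z\<^esub> p')"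
  using normal.rcos_sum[OF tw_sub_normal assms] by (simp add: tw_centr_def FactGroup_def)

lemma coset_carrier:
  "p \<in> carrier Z \<Longrightarrow> tw_sub G k r #>\<^bsub>Z\<^esub> p \<in> carrier (tw_centr G k r)"
  by (auto simp: tw_centr_def FactGroup_def RCOSETS_def)

lemma coset_one: "tw_sub G k r #>\<^bsub>Z\<^esub> (\<one>, 0) = \<one>\<^bsub>tw_centr G k r\<^esub>"
  using group.coset_mult_one[OF group_Z normal_imp_subgroup[OF tw_sub_normal, THEN subgroup.subset]]
  by (simp add: one_Z tw_centr_def FactGroup_def)

lemma coset_z:
  assumes "p \<in> carrier Z"
  shows "tw_sub G k r #>\<^bsub>Z\<^esub> (z \<otimes>\<^bsub>Z\<^esub> p) = tw_sub G k r #>\<^bsub>Z\<^esub> p"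
proof -
  interpret Z: group Z by (rule group_Z)
  have sub: "subgroup (tw_sub G k r) Z"
    using tw_sub_normal by (rule normal_imp_subgroup)
  have "z \<in> tw_sub G k r"
    unfolding tw_sub_def by (rule generate.incl) simp
  then have "tw_sub G k r #>\<^bsub>Z\<^esub> z = tw_sub G k r"
    using Z.coset_join2 z_carrier sub by blast
  then show ?thesis
    using Z.coset_mult_assoc[OF subgroup.subset[OF sub] z_carrier assms] by simp
qed

context
  fixes V :: "'a rep" and j :: nat
  assumes V: "V \<in> reps (centr G r)" and scalar: "acts_by r (zeta (ord r) ^ j) V"
begin

text \<open>The action before passing to the quotient by the relation \<open>(r\<inverse>, k)\<close>.\<close>

definition lift_act :: "'a \<times> int \<Rightarrow> complex mat" where
  "lift_act p = (zeta M ^ j) ^ nat (snd p) \<cdot>\<^sub>m snd V (fst p)"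

lemma lift_act_carrier: "p \<in> carrier Z \<Longrightarrow> lift_act p \<in> carrier_mat (fst V) (fst V)"
  using repsD(1)[OF V] by (simp add: lift_act_def carrier_Z)

lemma lift_act_mult:
  assumes "p \<in> carrier Z" "p' \<in> carrier Z"
  shows "lift_act (p \<otimes>\<^bsub>Z\<^esub> p') = lift_act p * lift_act p'"
proof -
  let ?w = "zeta M ^ j"
  have "?w ^ M = 1"
    using zeta_pow_self[OF M_pos] by (metis power_mult mult.commute power_one)
  moreover have "nat ((snd p + snd p') mod int M) = (nat (snd p) + nat (snd p')) mod M"
    using assms by (intro nat_add_mod) (simp_all add: carrier_Z)
  ultimately have "?w ^ nat ((snd p + snd p') mod int M) = ?w ^ nat (snd p) * ?w ^ nat (snd p')"
    using power_mod_period by (simp add: power_add)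
  moreover have c: "fst p \<in> carrier (centr G r)" "fst p' \<in> carrier (centr G r)"
    using assms by (simp_all add: carrier_Z)
  ultimately show ?thesis
    using repsD(3)[OF V c] repsD(1)[OF V c(1)] repsD(1)[OF V c(2)]
    by (auto simp: lift_act_def mult_Z mult_smult_assoc_mat mult_smult_distrib intro!: eq_matI)
qed

lemma lift_act_one: "lift_act \<one>\<^bsub>Z\<^esub> = 1\<^sub>m (fst V)"
  using repsD(2)[OF V] by (simp add: lift_act_def one_Z) (rule eq_matI, auto)

lemma lift_act_z: "lift_act z = 1\<^sub>m (fst V)"
proof -
  let ?w = "zeta M ^ j"
  have "?w ^ M = 1"
    using zeta_pow_self[OF M_pos] by (metis power_mult mult.commute power_one)
  then have "?w ^ nat (int k mod int M) = ?w ^ k"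
    using power_mod_period[of ?w M k] nat_int_mod[of k M] by presburger
  also have "\<dots> = zeta (ord r) ^ j"
    using zeta_pow[OF k] by (metis power_mult mult.commute)
  finally have w: "?w ^ nat (int k mod int M) = zeta (ord r) ^ j" .
  have c: "inv r \<in> carrier (centr G r)" "r \<in> carrier (centr G r)"
    using r by simp_all
  have "snd V (inv r) * snd V r = 1\<^sub>m (fst V)"
    using repsD(3)[OF V c] repsD(2)[OF V] r by simp
  moreover have "snd V r = zeta (ord r) ^ j \<cdot>\<^sub>m 1\<^sub>m (fst V)"
    using scalar by (simp add: acts_by_def)
  ultimately show ?thesis
    using repsD(1)[OF V c(1)] unfolding lift_act_def fst_conv snd_conv w
    by (simp add: mult_smult_distrib[OF _ one_carrier_mat])
qed

lemma lift_act_sub: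
  assumes "s \<in> tw_sub G k r"
  shows "lift_act s = 1\<^sub>m (fst V)"
proof -
  interpret Z: group Z by (rule group_Z)
  from assms show ?thesis
    unfolding tw_sub_def
  proof induction
    case (inv h)
    then have "h = z" by simp
    then have "lift_act (inv\<^bsub>Z\<^esub> h) * lift_act h = 1\<^sub>m (fst V)" "h \<in> carrier Z"
      using lift_act_mult[of "inv\<^bsub>Z\<^esub> h" h] z_carrier lift_act_one by simp_all
    then show ?case
      using lift_act_z lift_act_carrier[of "inv\<^bsub>Z\<^esub> h"] \<open>h = z\<close> by simp
  next
    case (eng h1 h2)
    then have "h1 \<in> carrier Z" "h2 \<in> carrier Z"
      using Z.generate_in_carrier z_carrier by blast+
    then show ?case
      using eng lift_act_mult by simp
  qed (use lift_act_one lift_act_z in auto)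
qed

text \<open>
  With \<open>\<zeta>\<close> of order \<open>k|r|\<close>, the matrix \<open>\<zeta>\<^bsup>jm\<^esup> V(c)\<close> is the same for all \<open>(c, m)\<close> in one coset, because \<open>r\<close>
  acts on \<open>V\<close> by the scalar \<open>\<zeta>\<^bsup>jk\<^esup>\<close>.  This is where the condition on the coefficients of an element of
  Devoto K-theory enters.
\<close>

lemma tw_rep_coset:
  assumes "c \<in> carrier (centr G r)" "0 \<le> m" "m < int M"
  shows "snd (tw_rep G k r j V) (tw_sub G k r #>\<^bsub>Z\<^esub> (c, m)) = (zeta M ^ j) ^ nat m \<cdot>\<^sub>m snd V c"
proof -
  interpret Z: group Z by (rule group_Z)
  have sub: "subgroup (tw_sub G k r) Z"
    using tw_sub_normal by (rule normal_imp_subgroup)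
  let ?D = "tw_sub G k r #>\<^bsub>Z\<^esub> (c, m)"
  have p: "(c, m) \<in> carrier Z"
    using assms by (simp add: carrier_Z)
  define p' where "p' = (SOME p. p \<in> ?D)"
  have "p' \<in> ?D"
    unfolding p'_def using Z.rcos_self[OF p sub] by (rule someI)
  then obtain s where s: "s \<in> tw_sub G k r" "p' = s \<otimes>\<^bsub>Z\<^esub> (c, m)"
    unfolding r_coset_def by auto
  then have "lift_act p' = lift_act s * lift_act (c, m)"
    using lift_act_mult p subgroup.mem_carrier[OF sub] by simp
  then have "lift_act p' = lift_act (c, m)"
    using lift_act_sub[OF s(1)] lift_act_carrier[OF p] by simp
  moreover have "snd (tw_rep G k r j V) ?D = lift_act p'"
    by (simp add: tw_rep_def lift_act_def p'_def[symmetric] case_prod_beta)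
  ultimately show ?thesis
    by (simp add: lift_act_def)
qed

lemma tw_rep_in_reps: "tw_rep G k r j V \<in> reps (tw_centr G k r)"
proof -
  interpret Z: group Z by (rule group_Z)
  have eq: "snd (tw_rep G k r j V) (tw_sub G k r #>\<^bsub>Z\<^esub> p) = lift_act p" if "p \<in> carrier Z" for p
    using tw_rep_coset[of "fst p" "snd p"] that by (simp add: carrier_Z lift_act_def)
  have cosets: "\<exists>p\<in>carrier Z. D = tw_sub G k r #>\<^bsub>Z\<^esub> p" if "D \<in> carrier (tw_centr G k r)" for D
    using that by (auto simp: tw_centr_def FactGroup_def RCOSETS_def)
  have "(fst V, snd (tw_rep G k r j V)) \<in> reps (tw_centr G k r)"
  proof (rule repsI)
    show "snd (tw_rep G k r j V) \<one>\<^bsub>tw_centr G k r\<^esub> = 1\<^sub>m (fst V)"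
      using eq[of "\<one>\<^bsub>Z\<^esub>"] lift_act_one coset_one by (simp add: one_Z[symmetric])
  next
    fix D assume "D \<in> carrier (tw_centr G k r)"
    then show "snd (tw_rep G k r j V) D \<in> carrier_mat (fst V) (fst V)"
      using cosets eq lift_act_carrier by metis
  next
    fix D D' assume "D \<in> carrier (tw_centr G k r)" "D' \<in> carrier (tw_centr G k r)"
    then obtain p p' where "p \<in> carrier Z" "p' \<in> carrier Z"
      "D = tw_sub G k r #>\<^bsub>Z\<^esub> p" "D' = tw_sub G k r #>\<^bsub>Z\<^esub> p'"
      using cosets by metis
    then show "snd (tw_rep G k r j V) (D \<otimes>\<^bsub>tw_centr G k r\<^esub> D') =
        snd (tw_rep G k r j V) D * snd (tw_rep G k r j V) D'"
      using coset_mult eq lift_act_mult by simp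
  qed
  then show ?thesis
    by (simp add: tw_rep_def)
qed

end

end

section \<open>The sign of a rearrangement\<close>

text \<open>
  The sign by which \<open>f\<close> permutes anticommuting factors indexed by \<open>A\<close>: a product over all pairs of
  factors, and for this reason easier to compose than a parity of a number of inversions.
\<close>

definition order_sign :: "(nat \<Rightarrow> nat) \<Rightarrow> nat set \<Rightarrow> complex" where
  "order_sign f A = (\<Prod>(i, j)\<in>{(i, j). i \<in> A \<and> j \<in> A \<and> i < j}. if f j < f i then - 1 else 1)"

lemma finite_increasing_pairs: "finite A \<Longrightarrow> finite {(i, j). i \<in> A \<and> j \<in> A \<and> i < (j::nat)}"
  by (rule finite_subset[of _ "A \<times> A"]) auto

lemma order_sign_inversions:
  assumes "finite A"
  shows "order_sign f A = (- 1) ^ card {(i, j). i \<in> A \<and> j \<in> A \<and> i < j \<and> f j < f i}"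
proof -
  let ?T = "{(i, j). i \<in> A \<and> j \<in> A \<and> i < j}"
  have "order_sign f A = (\<Prod>p\<in>?T. if f (snd p) < f (fst p) then - 1 else 1)"
    by (simp add: order_sign_def case_prod_beta)
  also have "\<dots> = (- 1) ^ card (?T \<inter> {p. f (snd p) < f (fst p)})"
    using finite_increasing_pairs[OF assms] by (simp add: prod.If_cases)
  also have "?T \<inter> {p. f (snd p) < f (fst p)} = {(i, j). i \<in> A \<and> j \<in> A \<and> i < j \<and> f j < f i}"
    by auto
  finally show ?thesis .
qed

lemma order_sign_cong:
  "(\<And>i. i \<in> A \<Longrightarrow> f i = f' i) \<Longrightarrow> order_sign f A = order_sign f' A"
  by (auto simp: order_sign_def intro!: prod.cong)

lemma order_sign_nonzero: "finite A \<Longrightarrow> order_sign f A \<noteq> 0"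
  by (simp add: order_sign_inversions)

text \<open>
  Whether a map reverses a two-element set does not depend on how the set is listed.  A composite
  reverses \<open>{i, j}\<close> iff exactly one of the two maps reverses its argument, and an injective \<open>f\<close>
  matches the two-element subsets of \<open>A\<close> with those of \<open>f ` A\<close>.
\<close>

lemma order_sign_comp:
  assumes "finite A" "inj_on f A" "inj_on g (f ` A)"
  shows "order_sign (g \<circ> f) A = order_sign g (f ` A) * order_sign f A"
proof -
  let ?T = "\<lambda>A. {(i, j). i \<in> A \<and> j \<in> A \<and> i < (j::nat)}"
  let ?h = "\<lambda>(i, j). (min (f i) (f j), max (f i) (f j))"
  have bij: "bij_betw ?h (?T A) (?T (f ` A))"
  proof (rule bij_betwI')
    fix p q assume p: "p \<in> ?T A" and q: "q \<in> ?T A"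
    obtain i j i' j' where pq: "p = (i, j)" "q = (i', j')" by fastforce
    have "f i \<noteq> f j" "f i' \<noteq> f j'"
      using p q inj_onD[OF assms(2)] pq by fastforce+
    then have 1: "?h p = ?h q \<longleftrightarrow> (f i = f i' \<and> f j = f j') \<or> (f i = f j' \<and> f j = f i')"
      unfolding pq by (auto simp: min_def max_def)
    have 2: "(f i = f i' \<and> f j = f j') \<or> (f i = f j' \<and> f j = f i') \<longleftrightarrow> p = q"
      using p q inj_on_eq_iff[OF assms(2)] pq by auto
    show "?h p = ?h q \<longleftrightarrow> p = q"
      using 1 2 by (rule trans)
  next
    fix p assume p: "p \<in> ?T A"
    obtain i j where ij: "p = (i, j)" by fastforce
    then have "f i \<noteq> f j"
      using p inj_onD[OF assms(2)] by fastforce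
    then show "?h p \<in> ?T (f ` A)"
      using p ij by (auto simp: min_def max_def)
  next
    fix q assume "q \<in> ?T (f ` A)"
    then obtain i j where ij: "i \<in> A" "j \<in> A" "q = (f i, f j)" "f i < f j" by auto
    have "i \<noteq> j" using ij by auto
    show "\<exists>p\<in>?T A. q = ?h p"
    proof (cases "i < j")
      case True
      then show ?thesis using ij by (intro bexI[of _ "(i, j)"]) auto
    next
      case False
      then show ?thesis using ij \<open>i \<noteq> j\<close> by (intro bexI[of _ "(j, i)"]) auto
    qed
  qed
  have "order_sign g (f ` A) = (\<Prod>p\<in>?T A. (\<lambda>(i, j). if g j < g i then - 1 else 1) (?h p))"
    unfolding order_sign_def by (rule prod.reindex_bij_betw[OF bij, symmetric])
  then have "order_sign g (f ` A) * order_sign f A =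
      (\<Prod>p\<in>?T A. (\<lambda>(i, j). if g j < g i then - 1 else 1) (?h p) * (\<lambda>(i, j). if f j < f i then - 1 else 1) p)"
    by (simp add: order_sign_def prod.distrib)
  also have "\<dots> = order_sign (g \<circ> f) A"
    unfolding order_sign_def
  proof (rule prod.cong[OF refl])
    fix p assume p: "p \<in> ?T A"
    obtain i j where ij: "p = (i, j)" by fastforce
    then have "f i \<noteq> f j" "g (f i) \<noteq> g (f j)"
      using p inj_on_eq_iff[OF assms(2)] inj_on_eq_iff[OF assms(3)] by auto
    then show "(\<lambda>(i, j). if g j < g i then - 1 else 1) (?h p) * (\<lambda>(i, j). if f j < f i then - 1 else 1) p =
        (case p of (i, j) \<Rightarrow> if (g \<circ> f) j < (g \<circ> f) i then - 1 else (1::complex))"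
      by (auto simp: ij min_def max_def)
  qed
  finally show ?thesis ..
qed

definition cyc :: "nat \<Rightarrow> nat \<Rightarrow> nat" where
  "cyc N i = (if Suc i = N then 0 else Suc i)"

lemma cyc_less: "i < N \<Longrightarrow> cyc N i < N"
  by (auto simp: cyc_def)

lemma cyc_bij: "bij_betw (cyc N) {..<N} {..<N}"
proof (rule bij_betwI[where g = "\<lambda>i. if i = 0 then N - 1 else i - 1"])
qed (auto simp: cyc_def)

lemma order_sign_cyc:
  assumes "N > 0"
  shows "order_sign (cyc N) {..<N} = (- 1) ^ (N - 1)"
proof -
  have "{(i, j). i \<in> {..<N} \<and> j \<in> {..<N} \<and> i < j \<and> cyc N j < cyc N i} = {..<N - 1} \<times> {N - 1}"
    using assms by (auto simp: cyc_def split: if_splits)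
  then show ?thesis
    by (simp add: order_sign_inversions card_cartesian_product)
qed

text \<open>
  Conjugating by the enumeration \<open>e\<close> does not change the sign, so the sign of a cyclic permutation
  does not depend on how the cycle is placed with respect to the order.
\<close>

lemma order_sign_cyclic:
  assumes "N > 0" and e: "bij_betw e {..<N} C" and f: "\<And>i. i < N \<Longrightarrow> f (e i) = e (cyc N i)"
  shows "order_sign f C = (- 1) ^ (N - 1)"
proof -
  have inj: "inj_on e {..<N}" and im: "e ` {..<N} = C"
    using e by (auto simp: bij_betw_def)
  have cyc: "inj_on (cyc N) {..<N}" "cyc N ` {..<N} = {..<N}"
    using cyc_bij by (auto simp: bij_betw_def)
  have "f x = e (cyc N (the_inv_into {..<N} e x))" if "x \<in> C" for x
    using that f im the_inv_into_f_f[OF inj] by auto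
  moreover have "inj_on (e \<circ> cyc N \<circ> the_inv_into {..<N} e) C"
    using inj im cyc inj_on_the_inv_into[OF inj] the_inv_into_onto[OF inj] by (intro comp_inj_on) simp_all
  ultimately have "inj_on f C"
    by (simp add: inj_on_def)
  then have "order_sign (f \<circ> e) {..<N} = order_sign f C * order_sign e {..<N}"
    using order_sign_comp[of "{..<N}" e f] inj im by simp
  moreover have "order_sign (e \<circ> cyc N) {..<N} = order_sign e {..<N} * order_sign (cyc N) {..<N}"
    using order_sign_comp[of "{..<N}" "cyc N" e] inj cyc by simp
  moreover have "order_sign (f \<circ> e) {..<N} = order_sign (e \<circ> cyc N) {..<N}"
    by (rule order_sign_cong) (simp add: f)
  ultimately show ?thesis
    using order_sign_nonzero[of "{..<N}" e] order_sign_cyc[OF assms(1)] by simp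
qed


section \<open>Sums over the assignments of indices to a loop\<close>

text \<open>The product \<open>A (l - 1) * \<dots> * A 0\<close>, whose entries are sums over the paths of length \<open>l\<close>.\<close>

fun mat_path :: "(nat \<Rightarrow> complex mat) \<Rightarrow> nat \<Rightarrow> nat \<Rightarrow> complex mat" where
  "mat_path A d 0 = 1\<^sub>m d"
| "mat_path A d (Suc l) = A l * mat_path A d l"

lemma mat_path_carrier: "(\<And>i. i < l \<Longrightarrow> A i \<in> carrier_mat d d) \<Longrightarrow> mat_path A d l \<in> carrier_mat d d"
proof (induction l)
  case (Suc l)
  then show ?case
    using mult_carrier_mat[OF Suc.prems[of l] Suc.IH] by simp
qed simp

lemma mat_path_entry:
  assumes "\<And>i. i \<le> l \<Longrightarrow> A i \<in> carrier_mat d d" "b < d" "c < d"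
  shows "(\<Sum>a\<in>{..<Suc l} \<rightarrow>\<^sub>E {..<d}.
      if a 0 = c then (\<Prod>i<l. A i $$ (a (Suc i), a i)) * A l $$ (b, a l) else 0)
    = mat_path A d (Suc l) $$ (b, c)"
  using assms
proof (induction l arbitrary: b)
  case 0
  have "{..<Suc 0} \<rightarrow>\<^sub>E {..<d} = (\<lambda>(y, a). a(0 := y)) ` ({..<d} \<times> {\<lambda>i. undefined})"
    by (simp only: lessThan_Suc PiE_insert_eq lessThan_0 PiE_empty_domain)
  moreover have "inj_on (\<lambda>(y, a). a(0 := y)) ({..<d} \<times> {\<lambda>i. undefined})"
    by (auto simp: inj_on_def fun_eq_iff split: if_splits)
  ultimately have "(\<Sum>a\<in>{..<Suc 0} \<rightarrow>\<^sub>E {..<d}. if a 0 = c then A 0 $$ (b, a 0) else 0)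
      = (\<Sum>(y, a)\<in>{..<d} \<times> {\<lambda>i::nat. undefined::nat}. if y = c then A 0 $$ (b, y) else 0)"
    by (simp only:) (subst sum.reindex, simp, auto intro!: sum.cong)
  also have "\<dots> = (\<Sum>y<d. if y = c then A 0 $$ (b, y) else 0)"
    by (subst sum.cartesian_product[symmetric]) simp
  finally have "(\<Sum>a\<in>{..<Suc 0} \<rightarrow>\<^sub>E {..<d}. if a 0 = c then A 0 $$ (b, a 0) else 0)
      = (\<Sum>y<d. if y = c then A 0 $$ (b, y) else 0)" .
  then show ?case
    using 0 by (simp cong: if_cong)
next
  case (Suc l)
  let ?T = "{..<Suc l} \<rightarrow>\<^sub>E {..<d}"
  let ?f = "\<lambda>(y, a). a(Suc l := y)"
  have P: "{..<Suc (Suc l)} \<rightarrow>\<^sub>E {..<d} = ?f ` ({..<d} \<times> ?T)"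
    by (simp add: lessThan_Suc[of "Suc l"] PiE_insert_eq)
  have inj: "inj_on ?f ({..<d} \<times> ?T)"
    using inj_combinator[of "Suc l" "{..<Suc l}" "\<lambda>_. {..<d}"] by simp
  have "(\<Sum>a\<in>{..<Suc (Suc l)} \<rightarrow>\<^sub>E {..<d}.
      if a 0 = c then (\<Prod>i<Suc l. A i $$ (a (Suc i), a i)) * A (Suc l) $$ (b, a (Suc l)) else 0)
    = (\<Sum>(y, a)\<in>{..<d} \<times> ?T.
      if a 0 = c then (\<Prod>i<l. A i $$ (a (Suc i), a i)) * A l $$ (y, a l) * A (Suc l) $$ (b, y) else 0)"
    unfolding P sum.reindex[OF inj] o_def
  proof (rule sum.cong[OF refl], clarify)
    fix y a
    have "(\<Prod>i<l. A i $$ ((a(Suc l := y)) (Suc i), (a(Suc l := y)) i)) = (\<Prod>i<l. A i $$ (a (Suc i), a i))"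
      by (rule prod.cong) simp_all
    then show "(if (a(Suc l := y)) 0 = c then (\<Prod>i<Suc l. A i $$ ((a(Suc l := y)) (Suc i), (a(Suc l := y)) i)) *
          A (Suc l) $$ (b, (a(Suc l := y)) (Suc l)) else 0) =
        (if a 0 = c then (\<Prod>i<l. A i $$ (a (Suc i), a i)) * A l $$ (y, a l) * A (Suc l) $$ (b, y) else 0)"
      by simp
  qed
  also have "\<dots> = (\<Sum>y<d. \<Sum>a\<in>?T.
      if a 0 = c then (\<Prod>i<l. A i $$ (a (Suc i), a i)) * A l $$ (y, a l) * A (Suc l) $$ (b, y) else 0)"
    by (rule sum.cartesian_product[symmetric])
  also have "\<dots> = (\<Sum>y<d. A (Suc l) $$ (b, y) * (\<Sum>a\<in>?T.
      if a 0 = c then (\<Prod>i<l. A i $$ (a (Suc i), a i)) * A l $$ (y, a l) else 0))"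
    unfolding sum_distrib_left by (intro sum.cong refl) simp
  also have "\<dots> = (\<Sum>y<d. A (Suc l) $$ (b, y) * mat_path A d (Suc l) $$ (y, c))"
    using Suc.IH Suc.prems by (intro sum.cong) simp_all
  also have "\<dots> = (A (Suc l) * mat_path A d (Suc l)) $$ (b, c)"
  proof -
    have "mat_path A d (Suc l) \<in> carrier_mat d d"
      using Suc.prems(1) by (intro mat_path_carrier) simp
    moreover have "A (Suc l) \<in> carrier_mat d d"
      using Suc.prems(1) by simp
    ultimately show ?thesis
      using Suc.prems(2,3) by (simp add: scalar_prod_def atLeast0LessThan del: mat_path.simps)
  qed
  finally show ?case
    by simp
qed

text \<open>
  The trace of the operator that sends a tensor \<open>v\<^sub>0 \<otimes> \<dots> \<otimes> v\<^bsub>N-1\<^esub>\<close> to one with \<open>A l v\<^sub>l\<close> in the next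
  position: closing the paths up to loops, it is the trace of the product around the loop.
\<close>

lemma mat_path_trace:
  assumes "\<And>i. i < N \<Longrightarrow> A i \<in> carrier_mat d d" "N > 0"
  shows "(\<Sum>a\<in>{..<N} \<rightarrow>\<^sub>E {..<d}. \<Prod>i<N. A i $$ (a (cyc N i), a i)) = mat_trace (mat_path A d N)"
proof -
  obtain l where N: "N = Suc l"
    using assms(2) gr0_conv_Suc by blast
  let ?T = "{..<Suc l} \<rightarrow>\<^sub>E {..<d}"
  have "mat_trace (mat_path A d N) = (\<Sum>c<d. mat_path A d (Suc l) $$ (c, c))"
    using carrier_matD(1)[OF mat_path_carrier[of N A d]] assms N
    unfolding mat_trace_def by (metis lessThan_iff)
  also have "\<dots> = (\<Sum>c<d. \<Sum>a\<in>?T.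
      if a 0 = c then (\<Prod>i<l. A i $$ (a (Suc i), a i)) * A l $$ (c, a l) else 0)"
    using assms N by (intro sum.cong refl mat_path_entry[symmetric]) auto
  also have "\<dots> = (\<Sum>a\<in>?T. \<Sum>c<d.
      if a 0 = c then (\<Prod>i<l. A i $$ (a (Suc i), a i)) * A l $$ (c, a l) else 0)"
    by (rule sum.swap)
  also have "\<dots> = (\<Sum>a\<in>?T. \<Prod>i<N. A i $$ (a (cyc N i), a i))"
  proof (rule sum.cong[OF refl])
    fix a assume "a \<in> ?T"
    then have "a 0 < d"
      by (auto simp: PiE_iff)
    moreover have "(\<Prod>i<l. A i $$ (a (Suc i), a i)) = (\<Prod>i<l. A i $$ (a (cyc N i), a i))"
      by (intro prod.cong) (auto simp: cyc_def N)
    ultimately show "(\<Sum>c<d. if a 0 = c then (\<Prod>i<l. A i $$ (a (Suc i), a i)) * A l $$ (c, a l) else 0)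
        = (\<Prod>i<N. A i $$ (a (cyc N i), a i))"
      by (simp add: N sum.delta') (simp add: cyc_def)
  qed
  finally show ?thesis
    by (simp add: N)
qed

section \<open>Permutations all of whose cycles have the same length\<close>

locale uniform_cycles =
  fixes n k :: nat and \<sigma> :: "nat \<Rightarrow> nat"
  assumes perm: "\<sigma> permutes {1..n}" and k: "k > 0"
    and card_orbit: "\<And>i. i \<in> {1..n} \<Longrightarrow> card (orbit \<sigma> i) = k"
begin

lemma permutation: "permutation \<sigma>"
  using perm permutation_permutes by auto

lemma pow_permutes: "(\<sigma> ^^ a) permutes {1..n}"
  using perm by (induction a) (auto simp: permutes_id intro: permutes_compose)

lemma pow_in: "i \<in> {1..n} \<Longrightarrow> (\<sigma> ^^ a) i \<in> {1..n}"
  using permutes_in_image[OF pow_permutes] by blast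

lemma pow_outside: "i \<notin> {1..n} \<Longrightarrow> (\<sigma> ^^ a) i = i"
  using pow_permutes by (meson permutes_not_in)

lemma
  assumes i: "i \<in> {1..n}"
  shows pow_len: "(\<sigma> ^^ k) i = i" and inj_pow: "inj_on (\<lambda>a. (\<sigma> ^^ a) i) {0..<k}"
proof -
  have self: "i \<in> orbit \<sigma> i"
    using permutation by (rule permutation_self_in_orbit)
  have inj: "inj_on (\<lambda>a. (\<sigma> ^^ a) i) {0..<funpow_dist1 \<sigma> i i}"
    using self by (rule inj_on_funpow_dist1)
  have "card (orbit \<sigma> i) = funpow_dist1 \<sigma> i i"
    using orbit_conv_funpow_dist1[OF self] card_image[OF inj] by simp
  then have d: "funpow_dist1 \<sigma> i i = k"
    using card_orbit[OF i] by simp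
  show "(\<sigma> ^^ k) i = i"
    using funpow_dist1_prop[OF self] by (simp only: d)
  show "inj_on (\<lambda>a. (\<sigma> ^^ a) i) {0..<k}"
    using inj by (simp only: d)
qed

lemma pow_mod: "i \<in> {1..n} \<Longrightarrow> (\<sigma> ^^ (a mod k)) i = (\<sigma> ^^ a) i"
  using pow_len by (rule funpow_mod_eq)

lemma pow_eq_iff:
  assumes "i \<in> {1..n}"
  shows "(\<sigma> ^^ a) i = (\<sigma> ^^ b) i \<longleftrightarrow> a mod k = b mod k"
proof -
  have "(\<sigma> ^^ (a mod k)) i = (\<sigma> ^^ (b mod k)) i \<longleftrightarrow> a mod k = b mod k"
    using inj_on_eq_iff[OF inj_pow[OF assms], of "a mod k" "b mod k"] k by simp
  then show ?thesis
    using pow_mod[OF assms] by simp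
qed

lemma pow_id_iff:
  assumes "n \<ge> 1"
  shows "\<sigma> ^^ a = id \<longleftrightarrow> k dvd a"
proof
  assume "\<sigma> ^^ a = id"
  then have "(\<sigma> ^^ a) 1 = (\<sigma> ^^ 0) 1" by simp
  then show "k dvd a"
    using pow_eq_iff[of 1 a 0] assms by (auto simp: mod_eq_0_iff_dvd)
next
  assume "k dvd a"
  then have "(\<sigma> ^^ a) i = i" for i
    using pow_eq_iff[of i a 0] pow_outside[of i a] by (cases "i \<in> {1..n}") (auto simp: mod_eq_0_iff_dvd)
  then show "\<sigma> ^^ a = id" by auto
qed

abbreviation "start \<equiv> cycle_start \<sigma>"
abbreviation "C \<equiv> cycles n \<sigma>"

lemma finite_C: "finite C" and C_sub: "i \<in> C \<Longrightarrow> i \<in> {1..n}" and start_C: "i \<in> C \<Longrightarrow> start i = i"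
  by (auto simp: cycles_def)

lemma orbit_pow: "orbit \<sigma> ((\<sigma> ^^ a) i) = orbit \<sigma> i"
  by (induction a) (simp_all add: permutation_orbit_step[OF permutation])

lemma start_pow: "start ((\<sigma> ^^ a) i) = start i"
  by (simp add: cycle_start_def orbit_pow)

lemma start_exists:
  assumes "i \<in> {1..n}"
  shows "\<exists>a<k. i = (\<sigma> ^^ a) (start i)"
proof -
  have "finite (orbit \<sigma> i)"
    using permutation_self_in_orbit[OF permutation] by (rule finite_orbit)
  then have "start i \<in> orbit \<sigma> i"
    unfolding cycle_start_def using orbit_nonempty by (intro Min_in)
  then obtain a where a: "start i = (\<sigma> ^^ a) i"
    by (auto simp: orbit_altdef)
  have "(\<sigma> ^^ ((k - a mod k) + a)) i = i"
  proof -
    have "(k - a mod k + a) mod k = 0"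
      by (metis k le_add_diff_inverse2 mod_add_right_eq mod_le_divisor mod_self)
    then show ?thesis
      using pow_eq_iff[OF assms, of "k - a mod k + a" 0] by simp
  qed
  then have "i = (\<sigma> ^^ (k - a mod k)) (start i)"
    by (simp add: a funpow_add)
  then have "i = (\<sigma> ^^ ((k - a mod k) mod k)) (start i)"
    using pow_mod[of "start i"] pow_in[OF assms] a by simp
  then show ?thesis
    using k by (intro exI[of _ "(k - a mod k) mod k"]) simp
qed

lemma start_in_C: "i \<in> {1..n} \<Longrightarrow> start i \<in> C"
proof -
  assume i: "i \<in> {1..n}"
  then obtain a where a: "i = (\<sigma> ^^ a) (start i)"
    using start_exists by blast
  then have s: "start (start i) = start i"
    using start_pow by metis
  have "start i \<in> {1..n}"
    using a i pow_outside by metis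
  with s show "start i \<in> C"
    by (simp add: cycles_def)
qed

lemma cycle_len: "i \<in> {1..n} \<Longrightarrow> cycle_len \<sigma> i = k"
  by (simp add: cycle_len_def card_orbit)

lemma cycle_elt_in: "i \<in> {1..n} \<Longrightarrow> cycle_elt \<sigma> i a \<in> {1..n}"
  unfolding cycle_elt_def by (rule pow_in)

text \<open>
  A permutation that commutes with \<open>\<sigma>\<close> permutes the cycles, by \<open>move\<close>, and rotates each of them
  against its image by the cycle shift.  Both are determined at one point of the cycle, and so they
  compose: \<open>move\<close> is multiplicative, and the shifts add up modulo \<open>k\<close>.
\<close>

definition centralizes :: "(nat \<Rightarrow> nat) \<Rightarrow> bool" where
  "centralizes \<tau> \<longleftrightarrow> \<tau> permutes {1..n} \<and> \<sigma> \<circ> \<tau> = \<tau> \<circ> \<sigma>"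

abbreviation move :: "(nat \<Rightarrow> nat) \<Rightarrow> nat \<Rightarrow> nat" where
  "move \<tau> i \<equiv> start (\<tau> i)"

lemma centralizes_in: "centralizes \<tau> \<Longrightarrow> i \<in> {1..n} \<Longrightarrow> \<tau> i \<in> {1..n}"
  unfolding centralizes_def using permutes_in_image[of \<tau> "{1..n}" i] by blast

lemma centralizes_pow:
  assumes "centralizes \<tau>"
  shows "\<tau> ((\<sigma> ^^ a) i) = (\<sigma> ^^ a) (\<tau> i)"
proof (induction a)
  case (Suc a)
  have "\<sigma> (\<tau> j) = \<tau> (\<sigma> j)" for j
    using assms unfolding centralizes_def comp_def by metis
  then show ?case using Suc by (metis comp_apply funpow.simps(2))
qed simp

lemma centralizes_comp: "centralizes \<tau> \<Longrightarrow> centralizes \<tau>' \<Longrightarrow> centralizes (\<tau> \<circ> \<tau>')"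
  unfolding centralizes_def by (metis comp_assoc permutes_compose)

lemma centralizes_id: "centralizes id"
  by (simp add: centralizes_def permutes_id)

lemma move_in: "centralizes \<tau> \<Longrightarrow> i \<in> {1..n} \<Longrightarrow> move \<tau> i \<in> C"
  using start_in_C centralizes_in by blast

lemma
  assumes "centralizes \<tau>" "i \<in> {1..n}"
  shows shift_less: "cycle_shift \<sigma> \<tau> i < k"
    and shift_eq: "\<tau> i = (\<sigma> ^^ cycle_shift \<sigma> \<tau> i) (move \<tau> i)"
    and shift_unique: "m < k \<Longrightarrow> \<tau> i = (\<sigma> ^^ m) (move \<tau> i) \<Longrightarrow> cycle_shift \<sigma> \<tau> i = m"
proof -
  have ti: "\<tau> i \<in> {1..n}" and si: "move \<tau> i \<in> {1..n}"
    using centralizes_in[OF assms] C_sub[OF move_in[OF assms]] by auto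
  obtain a where a: "a < k" "\<tau> i = (\<sigma> ^^ a) (move \<tau> i)"
    using start_exists[OF ti] by blast
  have all: "(\<forall>r\<ge>1. \<tau> (cycle_elt \<sigma> i r) = cycle_elt \<sigma> (move \<tau> i) (r + m)) \<longleftrightarrow> \<tau> i = (\<sigma> ^^ m) (move \<tau> i)" for m
  proof
    assume "\<forall>r\<ge>1. \<tau> (cycle_elt \<sigma> i r) = cycle_elt \<sigma> (move \<tau> i) (r + m)"
    then have "\<tau> (cycle_elt \<sigma> i 1) = cycle_elt \<sigma> (move \<tau> i) (1 + m)"
      by blast
    moreover have "cycle_elt \<sigma> i 1 = i" "cycle_elt \<sigma> (move \<tau> i) (1 + m) = (\<sigma> ^^ m) (move \<tau> i)"
      by (simp_all add: cycle_elt_def)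
    ultimately show "\<tau> i = (\<sigma> ^^ m) (move \<tau> i)"
      by metis
  next
    assume m: "\<tau> i = (\<sigma> ^^ m) (move \<tau> i)"
    show "\<forall>r\<ge>1. \<tau> (cycle_elt \<sigma> i r) = cycle_elt \<sigma> (move \<tau> i) (r + m)"
    proof (intro allI impI)
      fix r :: nat assume "r \<ge> 1"
      then have r: "r + m - 1 = (r - 1) + m" by simp
      have "\<tau> (cycle_elt \<sigma> i r) = (\<sigma> ^^ (r - 1)) (\<tau> i)"
        by (simp add: cycle_elt_def centralizes_pow[OF assms(1)])
      also have "\<dots> = (\<sigma> ^^ (r - 1)) ((\<sigma> ^^ m) (move \<tau> i))"
        using m by (rule arg_cong)
      also have "\<dots> = cycle_elt \<sigma> (move \<tau> i) (r + m)"
        by (simp only: cycle_elt_def funpow_add r o_apply)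
      finally show "\<tau> (cycle_elt \<sigma> i r) = cycle_elt \<sigma> (move \<tau> i) (r + m)" .
    qed
  qed
  have uniq: "m = a" if "m < k" "\<tau> i = (\<sigma> ^^ m) (move \<tau> i)" for m
    using that a pow_eq_iff[OF si, of m a] by (metis mod_less)
  have "cycle_shift \<sigma> \<tau> i = a"
    unfolding cycle_shift_def cycle_len[OF assms(2)] all
    using a uniq by (intro the_equality) blast+
  then show "cycle_shift \<sigma> \<tau> i < k" "\<tau> i = (\<sigma> ^^ cycle_shift \<sigma> \<tau> i) (move \<tau> i)"
    "m < k \<Longrightarrow> \<tau> i = (\<sigma> ^^ m) (move \<tau> i) \<Longrightarrow> cycle_shift \<sigma> \<tau> i = m"
    using a uniq by blast+
qed

lemma move_start:
  assumes "centralizes \<tau>" "i \<in> {1..n}"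
  shows "move \<tau> (start i) = move \<tau> i"
proof -
  obtain a where a: "i = (\<sigma> ^^ a) (start i)"
    using start_exists[OF assms(2)] by blast
  have "\<tau> i = (\<sigma> ^^ a) (\<tau> (start i))"
    by (subst a) (rule centralizes_pow[OF assms(1)])
  then show ?thesis
    using start_pow by metis
qed

lemma move_comp:
  assumes "centralizes \<tau>" "centralizes \<tau>'" "i \<in> {1..n}"
  shows "move (\<tau> \<circ> \<tau>') i = move \<tau> (move \<tau>' i)"
  using move_start[OF assms(1) centralizes_in[OF assms(2,3)]] by simp

lemma shift_comp:
  assumes "centralizes \<tau>" "centralizes \<tau>'" "i \<in> {1..n}"
  shows "cycle_shift \<sigma> (\<tau> \<circ> \<tau>') i = (cycle_shift \<sigma> \<tau> (move \<tau>' i) + cycle_shift \<sigma> \<tau>' i) mod k"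
proof (rule shift_unique[OF centralizes_comp[OF assms(1,2)] assms(3)])
  let ?j = "move \<tau>' i" and ?m = "cycle_shift \<sigma> \<tau>' i"
  have j: "?j \<in> {1..n}"
    using C_sub move_in assms by blast
  have "(\<tau> \<circ> \<tau>') i = \<tau> ((\<sigma> ^^ ?m) ?j)"
    by (simp add: shift_eq[OF assms(2,3), symmetric])
  also have "\<dots> = (\<sigma> ^^ ?m) (\<tau> ?j)"
    by (rule centralizes_pow[OF assms(1)])
  also have "\<dots> = (\<sigma> ^^ (?m + cycle_shift \<sigma> \<tau> ?j)) (move \<tau> ?j)"
    by (simp add: funpow_add shift_eq[OF assms(1) j, symmetric])
  also have "\<dots> = (\<sigma> ^^ ((cycle_shift \<sigma> \<tau> ?j + ?m) mod k)) (move \<tau> ?j)"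
    by (simp only: pow_mod[OF C_sub[OF move_in[OF assms(1) j]]] add.commute)
  finally show "(\<tau> \<circ> \<tau>') i = (\<sigma> ^^ ((cycle_shift \<sigma> \<tau> ?j + ?m) mod k)) (move (\<tau> \<circ> \<tau>') i)"
    using move_comp[OF assms] by simp
qed (use k in simp)

lemma move_bij:
  assumes "centralizes \<tau>"
  shows "bij_betw (move \<tau>) C C"
proof -
  have "inj_on (move \<tau>) C"
  proof (rule inj_onI)
    fix i j assume i: "i \<in> C" and j: "j \<in> C" and eq: "move \<tau> i = move \<tau> j"
    have ij: "i \<in> {1..n}" "j \<in> {1..n}"
      using i j C_sub by auto
    define s where "s = move \<tau> i"
    obtain a b where ab: "\<tau> i = (\<sigma> ^^ a) s" "\<tau> j = (\<sigma> ^^ b) s"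
      using shift_eq[OF assms ij(1)] shift_eq[OF assms ij(2)] eq s_def by metis
    have "\<tau> ((\<sigma> ^^ b) i) = (\<sigma> ^^ (b + a)) s" "\<tau> ((\<sigma> ^^ a) j) = (\<sigma> ^^ (a + b)) s"
      using ab by (simp_all add: centralizes_pow[OF assms] funpow_add)
    then have "\<tau> ((\<sigma> ^^ b) i) = \<tau> ((\<sigma> ^^ a) j)"
      by (simp add: add.commute)
    then have "(\<sigma> ^^ b) i = (\<sigma> ^^ a) j"
      using assms permutes_inj unfolding centralizes_def inj_def by metis
    then have "start i = start j"
      using start_pow by metis
    then show "i = j"
      using start_C i j by simp
  qed
  moreover have "move \<tau> ` C \<subseteq> C"
    using move_in[OF assms] C_sub by blast
  ultimately show ?thesis
    using endo_inj_surj[OF finite_C] by (auto simp: bij_betw_def)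
qed

end

section \<open>Wreath products\<close>

lemma carrier_wreath: "(h, \<tau>) \<in> carrier (wreath G n) \<longleftrightarrow> h \<in> {1..n} \<rightarrow>\<^sub>E carrier G \<and> \<tau> permutes {1..n}"
  by (simp add: wreath_def sym_group_carrier)

lemma mult_wreath:
  "(g, \<sigma>) \<otimes>\<^bsub>wreath G n\<^esub> (h, \<tau>) = (\<lambda>i\<in>{1..n}. g i \<otimes>\<^bsub>G\<^esub> h (inv' \<sigma> i), \<sigma> \<circ> \<tau>)"
  by (simp add: wreath_def)

lemma one_wreath: "\<one>\<^bsub>wreath G n\<^esub> = (\<lambda>i\<in>{1..n}. \<one>\<^bsub>G\<^esub>, id)"
  by (simp add: wreath_def)

lemma permutes_inv_in: "\<sigma> permutes A \<Longrightarrow> i \<in> A \<Longrightarrow> inv' \<sigma> i \<in> A"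
  using permutes_in_image[OF permutes_inv[of \<sigma> A], of i] by blast

lemma (in group) wreath_group: "Group.group (wreath G n)"
proof (rule groupI)
  fix x y assume x: "x \<in> carrier (wreath G n)" and y: "y \<in> carrier (wreath G n)"
  obtain g \<sigma> h \<tau> where xy: "x = (g, \<sigma>)" "y = (h, \<tau>)" by fastforce
  show "x \<otimes>\<^bsub>wreath G n\<^esub> y \<in> carrier (wreath G n)"
    using x y permutes_inv_in[of \<sigma> "{1..n}"] unfolding xy
    by (auto simp: mult_wreath carrier_wreath PiE_iff intro!: permutes_compose)
next
  show "\<one>\<^bsub>wreath G n\<^esub> \<in> carrier (wreath G n)"
    by (auto simp: one_wreath carrier_wreath permutes_id)
next
  fix x y z assume x: "x \<in> carrier (wreath G n)" and y: "y \<in> carrier (wreath G n)" and z: "z \<in> carrier (wreath G n)"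
  obtain g \<sigma> h \<tau> l \<rho> where xyz: "x = (g, \<sigma>)" "y = (h, \<tau>)" "z = (l, \<rho>)"
    by (metis surj_pair)
  have p: "\<sigma> permutes {1..n}" "\<tau> permutes {1..n}"
    using x y z by (auto simp: xyz carrier_wreath)
  have G: "g i \<in> carrier G" "h i \<in> carrier G" "l i \<in> carrier G" if "i \<in> {1..n}" for i
    using x y z that by (auto simp: xyz carrier_wreath PiE_iff)
  have "inv' (\<sigma> \<circ> \<tau>) = inv' \<tau> \<circ> inv' \<sigma>"
    using p permutes_bij by (intro o_inv_distrib) auto
  moreover have "g i \<otimes> h (inv' \<sigma> i) \<otimes> l (inv' \<tau> (inv' \<sigma> i)) = g i \<otimes> (h (inv' \<sigma> i) \<otimes> l (inv' \<tau> (inv' \<sigma> i)))"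
    if "i \<in> {1..n}" for i
    using that permutes_inv_in[OF p(1)] permutes_inv_in[OF p(2)] by (intro m_assoc G) blast+
  ultimately show "x \<otimes>\<^bsub>wreath G n\<^esub> y \<otimes>\<^bsub>wreath G n\<^esub> z = x \<otimes>\<^bsub>wreath G n\<^esub> (y \<otimes>\<^bsub>wreath G n\<^esub> z)"
    using permutes_inv_in[OF p(1)] by (simp add: xyz mult_wreath comp_assoc cong: restrict_cong)
next
  fix x assume x: "x \<in> carrier (wreath G n)"
  obtain g \<sigma> where x': "x = (g, \<sigma>)" by fastforce
  then have p: "\<sigma> permutes {1..n}" and g: "\<And>i. i \<in> {1..n} \<Longrightarrow> g i \<in> carrier G" "g \<in> extensional {1..n}"
    using x by (auto simp: carrier_wreath PiE_iff)
  then show "\<one>\<^bsub>wreath G n\<^esub> \<otimes>\<^bsub>wreath G n\<^esub> x = x"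
    unfolding x' mult_wreath one_wreath
    by (simp cong: restrict_cong add: extensional_restrict)
  let ?y = "(\<lambda>i\<in>{1..n}. inv (g (\<sigma> i)), inv' \<sigma>)"
  have "?y \<in> carrier (wreath G n)"
    using p g(1) permutes_in_image[OF p] by (auto simp: carrier_wreath intro: permutes_inv)
  moreover have "?y \<otimes>\<^bsub>wreath G n\<^esub> x = \<one>\<^bsub>wreath G n\<^esub>"
    using p g(1) permutes_in_image[OF p] permutes_inv_o(2)[OF p]
    by (auto simp: x' mult_wreath one_wreath permutes_inv_inv[OF p] intro!: restrict_ext)
  ultimately show "\<exists>y\<in>carrier (wreath G n). y \<otimes>\<^bsub>wreath G n\<^esub> x = \<one>\<^bsub>wreath G n\<^esub>" by blast
qed

lemma diag_in: "g \<in> carrier G \<Longrightarrow> \<sigma> permutes {1..n} \<Longrightarrow> diag n g \<sigma> \<in> carrier (wreath G n)"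
  by (auto simp: diag_def carrier_wreath)

lemma diag_mult:
  assumes "\<sigma> permutes {1..n}"
  shows "diag n g \<sigma> \<otimes>\<^bsub>wreath G n\<^esub> diag n h \<tau> = diag n (g \<otimes>\<^bsub>G\<^esub> h) (\<sigma> \<circ> \<tau>)"
  using permutes_inv_in[OF assms] by (auto simp: diag_def mult_wreath intro!: restrict_ext)

lemma (in group) diag_pow:
  assumes "\<sigma> permutes {1..n}" "g \<in> carrier G"
  shows "diag n g \<sigma> [^]\<^bsub>wreath G n\<^esub> (l::nat) = diag n (g [^] l) (\<sigma> ^^ l)"
proof (induction l)
  case 0
  then show ?case by (simp add: diag_def one_wreath id_def)
next
  case (Suc l)
  have "(\<sigma> ^^ l) permutes {1..n}"
    using assms(1) by (induction l) (auto simp: permutes_id intro: permutes_compose)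
  then have "diag n g \<sigma> [^]\<^bsub>wreath G n\<^esub> Suc l = diag n (g [^] l \<otimes> g) (\<sigma> ^^ l \<circ> \<sigma>)"
    by (simp add: Suc diag_mult)
  then show ?case
    unfolding nat_pow_Suc funpow_Suc_right .
qed


section \<open>Conjugation\<close>

lemma (in group) conj_hom:
  assumes "t \<in> carrier G" "a \<in> carrier G" "b \<in> carrier G"
  shows "inv t \<otimes> (a \<otimes> b) \<otimes> t = (inv t \<otimes> a \<otimes> t) \<otimes> (inv t \<otimes> b \<otimes> t)"
proof -
  have "(inv t \<otimes> a \<otimes> t) \<otimes> (inv t \<otimes> b \<otimes> t) = inv t \<otimes> a \<otimes> (t \<otimes> inv t) \<otimes> b \<otimes> t"
    using assms by (simp only: m_assoc m_closed inv_closed)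
  then show ?thesis
    using assms by (simp add: m_assoc)
qed

lemma (in group) conj_pow:
  assumes "t \<in> carrier G" "a \<in> carrier G"
  shows "inv t \<otimes> (a [^] (l::nat)) \<otimes> t = (inv t \<otimes> a \<otimes> t) [^] l"
proof (induction l)
  case (Suc l)
  have "inv t \<otimes> (a [^] l \<otimes> a) \<otimes> t = (inv t \<otimes> (a [^] l) \<otimes> t) \<otimes> (inv t \<otimes> a \<otimes> t)"
    using assms by (intro conj_hom) simp_all
  then show ?case
    by (simp add: Suc)
qed (use assms in simp)

lemma (in group) conj_eq_one_iff:
  assumes "t \<in> carrier G" "a \<in> carrier G"
  shows "inv t \<otimes> a \<otimes> t = \<one> \<longleftrightarrow> a = \<one>"
proof
  assume "inv t \<otimes> a \<otimes> t = \<one>"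
  then have "inv t \<otimes> a = inv t"
    using assms inv_equality[of "inv t \<otimes> a" t] by simp
  then show "a = \<one>"
    using assms by simp
qed (use assms in simp)

lemma (in group) ord_conj:
  assumes "t \<in> carrier G" "a \<in> carrier G"
  shows "ord (inv t \<otimes> a \<otimes> t) = ord a"
  using assms by (subst ord_unique) (simp_all add: conj_pow[symmetric] conj_eq_one_iff pow_eq_id)

lemma (in group) conj_elt:
  assumes "P \<in> carrier G"
  shows "conj_elt G P \<in> carrier G" "conj_rep G P \<in> carrier G"
    and "conj_rep G P = inv (conj_elt G P) \<otimes> P \<otimes> conj_elt G P"
proof -
  have "P \<in> conj_class G P"
    unfolding conj_class_def using assms by (auto intro!: exI[of _ \<one>])
  then have "conj_rep G P \<in> conj_class G P"
    unfolding conj_rep_def by (rule someI)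
  then obtain w where w: "w \<in> carrier G" "conj_rep G P = w \<otimes> P \<otimes> inv w"
    unfolding conj_class_def by auto
  then show r: "conj_rep G P \<in> carrier G"
    using assms by simp
  have "inv w \<otimes> conj_rep G P \<otimes> inv (inv w) = P"
    using w assms by (simp add: m_assoc) (simp add: m_assoc[symmetric])
  then have "\<exists>t. t \<in> carrier G \<and> t \<otimes> conj_rep G P \<otimes> inv t = P"
    using w(1) inv_closed by blast
  from someI_ex[OF this] have *: "conj_elt G P \<in> carrier G" "conj_elt G P \<otimes> conj_rep G P \<otimes> inv (conj_elt G P) = P"
    unfolding conj_elt_def by auto
  show "conj_elt G P \<in> carrier G" by (rule *(1))
  show "conj_rep G P = inv (conj_elt G P) \<otimes> P \<otimes> conj_elt G P"
  proof -
    have "inv (conj_elt G P) \<otimes> (conj_elt G P \<otimes> conj_rep G P \<otimes> inv (conj_elt G P)) \<otimes> conj_elt G P =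
        (inv (conj_elt G P) \<otimes> conj_elt G P) \<otimes> conj_rep G P \<otimes> (inv (conj_elt G P) \<otimes> conj_elt G P)"
      using *(1) r by (simp only: m_assoc m_closed inv_closed)
    then show ?thesis
      using * r by simp
  qed
qed

lemma (in group) list_mult_const:
  assumes "a \<in> carrier G" "\<And>y. y \<in> set ys \<Longrightarrow> f y = a"
  shows "list_mult G (map f ys) = a [^] length ys"
  using assms(2)
proof (induction ys)
  case Nil
  then show ?case by (simp add: list_mult_def)
next
  case (Cons y ys)
  then show ?case
    using assms(1) nat_pow_Suc2[of a "length ys"] by (simp add: list_mult_def)
qed


section \<open>The cycle maps at a diagonal element\<close>

locale diag_cycles = group G + uniform_cycles n k \<sigma>
  for G :: "('g, 'm) monoid_scheme" (structure) and n k \<sigma> +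
  fixes g :: 'g
  assumes fin: "finite (carrier G)" and g: "g \<in> carrier G" and n: "n \<ge> 1"
begin

abbreviation "P \<equiv> g [^] k"
abbreviation "r \<equiv> conj_rep G P"
abbreviation "t \<equiv> conj_elt G P"
abbreviation "u \<equiv> diag n g \<sigma>"
abbreviation "W \<equiv> wreath G n"
abbreviation "Cu \<equiv> centr W u"
abbreviation "coset \<equiv> \<lambda>p. tw_sub G k r #>\<^bsub>tw_prod G k r\<^esub> p"

lemma t: "t \<in> carrier G" and r: "r \<in> carrier G" and r_eq: "r = inv t \<otimes> P \<otimes> t"
  using conj_elt[of P] g by auto

sublocale tw: twisted_centralizer G k r
  using fin k r by unfold_locales

lemma ord_r: "ord r = ord P"
  using ord_conj[OF t, of P] r_eq g by simp

lemma group_W: "Group.group W"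
  by (rule wreath_group)

lemma u_in: "u \<in> carrier W"
  using g perm by (rule diag_in)

lemma group_Cu: "Group.group Cu"
  using group.centr_group[OF group_W u_in] .

text \<open>The order is a multiple of the order \<open>k\<close> of \<open>\<sigma>\<close>, and \<open>u\<^bsup>k\<^esup>\<close> is the diagonal element of \<open>P\<close>.\<close>

lemma ord_u: "group.ord W u = k * ord P"
proof (subst group.ord_unique[OF group_W u_in], intro allI)
  fix l :: nat
  have "u [^]\<^bsub>W\<^esub> l = \<one>\<^bsub>W\<^esub> \<longleftrightarrow> (\<forall>i\<in>{1..n}. g [^] l = \<one>) \<and> \<sigma> ^^ l = id"
    unfolding diag_pow[OF perm g] one_wreath by (auto simp: diag_def restrict_def fun_eq_iff)
  also have "\<dots> \<longleftrightarrow> g [^] l = \<one> \<and> k dvd l"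
    using n pow_id_iff[OF n] by auto
  also have "\<dots> \<longleftrightarrow> k * ord P dvd l"
  proof
    assume "g [^] l = \<one> \<and> k dvd l"
    then obtain l' where l': "l = k * l'" and "g [^] l = \<one>" by auto
    then have "P [^] l' = \<one>"
      using g by (simp add: nat_pow_pow)
    then have "ord P dvd l'"
      using g by (simp add: pow_eq_id)
    then show "k * ord P dvd l"
      by (simp add: l' mult_dvd_mono)
  next
    assume "k * ord P dvd l"
    then obtain l' where l': "l = k * ord P * l'" by auto
    have "(P [^] ord P) [^] l' = g [^] l"
      using g by (simp only: nat_pow_pow nat_pow_closed l')
    then show "g [^] l = \<one> \<and> k dvd l"
      using g by (simp add: l')
  qed
  finally show "u [^]\<^bsub>W\<^esub> l = \<one>\<^bsub>W\<^esub> \<longleftrightarrow> k * ord P dvd l" .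
qed

lemma snd_u: "snd u = \<sigma>"
  by (simp add: diag_def)

lemma cycle_prod_u: "i \<in> {1..n} \<Longrightarrow> cycle_prod G u i = P"
  unfolding cycle_prod_def diag_def prod.case
  by (subst list_mult_const[OF g])
    (simp_all add: restrict_apply'[OF cycle_elt_in] cycle_len del: One_nat_def restrict_apply atLeastAtMost_iff)

lemma Cu_iff:
  "(h, \<tau>) \<in> carrier Cu \<longleftrightarrow> h \<in> {1..n} \<rightarrow>\<^sub>E carrier G \<and> centralizes \<tau> \<and>
     (\<forall>i\<in>{1..n}. g \<otimes> h i = h (\<sigma> i) \<otimes> g)"
proof -
  have "(h, \<tau>) \<otimes>\<^bsub>W\<^esub> u = u \<otimes>\<^bsub>W\<^esub> (h, \<tau>) \<longleftrightarrow>
      (\<forall>i\<in>{1..n}. g \<otimes> h i = h (\<sigma> i) \<otimes> g) \<and> \<sigma> \<circ> \<tau> = \<tau> \<circ> \<sigma>" if \<tau>: "\<tau> permutes {1..n}"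
  proof -
    have "(h, \<tau>) \<otimes>\<^bsub>W\<^esub> u = (\<lambda>i\<in>{1..n}. h i \<otimes> g, \<tau> \<circ> \<sigma>)"
      using permutes_inv_in[OF \<tau>] by (auto simp: diag_def mult_wreath intro!: restrict_ext)
    moreover have "u \<otimes>\<^bsub>W\<^esub> (h, \<tau>) = (\<lambda>i\<in>{1..n}. g \<otimes> h (inv' \<sigma> i), \<sigma> \<circ> \<tau>)"
      by (auto simp: diag_def mult_wreath intro!: restrict_ext)
    moreover have "(\<lambda>i\<in>{1..n}. h i \<otimes> g) = (\<lambda>i\<in>{1..n}. g \<otimes> h (inv' \<sigma> i)) \<longleftrightarrow>
        (\<forall>i\<in>{1..n}. h i \<otimes> g = g \<otimes> h (inv' \<sigma> i))"
      by (auto simp: fun_eq_iff restrict_def)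
    moreover have "(\<forall>i\<in>{1..n}. h i \<otimes> g = g \<otimes> h (inv' \<sigma> i)) \<longleftrightarrow> (\<forall>i\<in>{1..n}. g \<otimes> h i = h (\<sigma> i) \<otimes> g)"
    proof (intro iffI ballI)
      fix i assume *: "\<forall>i\<in>{1..n}. h i \<otimes> g = g \<otimes> h (inv' \<sigma> i)" and i: "i \<in> {1..n}"
      have "\<sigma> i \<in> {1..n}"
        using pow_in[OF i, of 1] by simp
      then show "g \<otimes> h i = h (\<sigma> i) \<otimes> g"
        using * permutes_inverses(2)[OF perm] by simp
    next
      fix i assume *: "\<forall>i\<in>{1..n}. g \<otimes> h i = h (\<sigma> i) \<otimes> g" and i: "i \<in> {1..n}"
      then show "h i \<otimes> g = g \<otimes> h (inv' \<sigma> i)"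
        using permutes_inv_in[OF perm i] permutes_inverses(1)[OF perm] by simp
    qed
    ultimately show ?thesis by auto
  qed
  then show ?thesis
    by (auto simp: carrier_wreath centralizes_def)
qed

text \<open>
  At a diagonal element the product \<open>h(j\<^sub>k) g(i\<^bsub>1-m\<^esub>)\<inverse> \<dots> g(i\<^sub>k)\<inverse>\<close> is \<open>h(j\<^sub>k) g\<^bsup>-m\<^esup>\<close>; the position \<open>j\<^sub>k\<close> is reached from
  the start of the cycle by \<open>k - 1\<close> steps.
\<close>

definition cmap :: "(nat \<Rightarrow> 'g) \<times> (nat \<Rightarrow> nat) \<Rightarrow> nat \<Rightarrow> 'g" where
  "cmap v i = fst v ((\<sigma> ^^ (k - 1)) (move (snd v) i)) \<otimes> inv g [^] cycle_shift \<sigma> (snd v) i"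

lemma cycle_map_elt_u:
  assumes "v \<in> carrier Cu" "i \<in> {1..n}"
  shows "cycle_map_elt G u v i = cmap v i"
proof -
  obtain h \<tau> where v: "v = (h, \<tau>)" by fastforce
  then have c: "centralizes \<tau>"
    using assms by (simp add: Cu_iff del: centr_simps)
  let ?m = "cycle_shift \<sigma> \<tau> i"
  have m: "?m < k"
    using shift_less[OF c assms(2)] .
  have "list_mult G (map (\<lambda>r. inv ((\<lambda>i\<in>{1..n}. g) (cycle_elt \<sigma> i r))) [k + 1 - ?m..<k + 1]) = inv g [^] ?m"
    using g m by (subst list_mult_const[of "inv g"]) 
      (simp_all add: restrict_apply'[OF cycle_elt_in[OF assms(2)]] del: One_nat_def restrict_apply)
  then show ?thesis
    unfolding cycle_map_elt_def diag_def v prod.case Let_def cycle_len[OF assms(2)] cmap_def fst_conv snd_conv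
    by (simp only: cycle_elt_def)
qed

lemma g_pow_h:
  assumes "(h, \<tau>) \<in> carrier Cu" "i \<in> {1..n}"
  shows "g [^] (a::nat) \<otimes> h i = h ((\<sigma> ^^ a) i) \<otimes> g [^] a"
proof (induction a)
  case 0
  have "h i \<in> carrier G"
    using assms by (auto simp: Cu_iff simp del: centr_simps)
  then show ?case by simp
next
  case (Suc a)
  have h: "h i \<in> carrier G" "h ((\<sigma> ^^ a) i) \<in> carrier G" "h ((\<sigma> ^^ Suc a) i) \<in> carrier G"
    using assms pow_in[OF assms(2), of a] pow_in[OF assms(2), of "Suc a"] by (auto simp: Cu_iff simp del: centr_simps)
  have "g [^] Suc a \<otimes> h i = g \<otimes> (g [^] a \<otimes> h i)"
    using g h nat_pow_Suc2[of g a] by (simp add: m_assoc)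
  also have "\<dots> = (g \<otimes> h ((\<sigma> ^^ a) i)) \<otimes> g [^] a"
    using g h by (simp add: Suc m_assoc)
  also have "g \<otimes> h ((\<sigma> ^^ a) i) = h ((\<sigma> ^^ Suc a) i) \<otimes> g"
    using assms pow_in[OF assms(2), of a] by (simp add: Cu_iff del: centr_simps)
  also have "\<dots> \<otimes> g [^] a = h ((\<sigma> ^^ Suc a) i) \<otimes> g [^] Suc a"
    using g h nat_pow_Suc2[of g a] by (simp add: m_assoc)
  finally show ?case .
qed

lemma h_inv_g_pow:
  assumes "(h, \<tau>) \<in> carrier Cu" "i \<in> {1..n}"
  shows "inv g [^] (a::nat) \<otimes> h ((\<sigma> ^^ a) i) = h i \<otimes> inv g [^] a"
proof -
  have h: "h i \<in> carrier G" "h ((\<sigma> ^^ a) i) \<in> carrier G"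
    using assms pow_in[OF assms(2), of a] by (auto simp: Cu_iff simp del: centr_simps)
  have "inv g [^] a \<otimes> h ((\<sigma> ^^ a) i) = inv g [^] a \<otimes> (h ((\<sigma> ^^ a) i) \<otimes> g [^] a) \<otimes> inv g [^] a"
    using g h by (simp add: m_assoc nat_pow_inv)
  also have "\<dots> = inv g [^] a \<otimes> (g [^] a \<otimes> h i) \<otimes> inv g [^] a"
    by (simp add: g_pow_h[OF assms])
  also have "\<dots> = h i \<otimes> inv g [^] a"
    using g h by (simp add: m_assoc[symmetric] nat_pow_inv)
  finally show ?thesis .
qed

lemma cmap_centr:
  assumes "v \<in> carrier Cu" "i \<in> {1..n}"
  shows "cmap v i \<in> carrier (centr G P)"
proof -
  obtain h \<tau> where v: "v = (h, \<tau>)" by fastforce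
  note hv = assms(1)[unfolded v]
  let ?y = "(\<sigma> ^^ (k - 1)) (move \<tau> i)"
  have "move \<tau> i \<in> {1..n}"
    using hv C_sub[OF move_in[OF _ assms(2)]] by (simp add: Cu_iff del: centr_simps)
  then have y: "?y \<in> {1..n}"
    by (rule pow_in)
  then have h: "h ?y \<in> carrier G"
    using hv by (auto simp: Cu_iff simp del: centr_simps)
  have 1: "P \<otimes> h ?y = h ?y \<otimes> P"
    using g_pow_h[OF hv y, of k] unfolding pow_len[OF y] .
  have 2: "inv g [^] (a::nat) \<otimes> P = P \<otimes> inv g [^] a" for a
    using g by (intro group_commutes_pow[symmetric] group_commutes_pow) simp_all
  show ?thesis
    using g h 1 2 by (simp add: cmap_def v m_assoc) (simp add: m_assoc[symmetric])
qed

lemma conj_centr: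
  assumes "c \<in> carrier (centr G P)"
  shows "inv t \<otimes> c \<otimes> t \<in> carrier (centr G r)"
  using assms conj_hom[OF t, of c P] conj_hom[OF t, of P c] g t by (simp add: r_eq)

lemma str_elt_u:
  assumes "v \<in> carrier Cu" "i \<in> {1..n}"
  shows "str_elt G u v i = coset (inv t \<otimes> cmap v i \<otimes> t, int (cycle_shift \<sigma> (snd v) i))"
proof -
  have "move (snd v) i \<in> {1..n}"
    using assms C_sub[OF move_in[OF _ assms(2)]] by (cases v) (simp add: Cu_iff del: centr_simps)
  then show ?thesis
    using assms by (simp add: str_elt_def snd_u cycle_len cycle_prod_u cycle_map_elt_u Let_def)
qed

lemma str_pair_carrier:
  assumes "v \<in> carrier Cu" "i \<in> {1..n}"
  shows "(inv t \<otimes> cmap v i \<otimes> t, int (cycle_shift \<sigma> (snd v) i)) \<in> carrier tw.Z"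
proof -
  have "cycle_shift \<sigma> (snd v) i < k"
    using assms shift_less[OF _ assms(2)] by (cases v) (simp add: Cu_iff del: centr_simps)
  also have "k \<le> k * ord r"
    using tw.M_pos by simp
  finally show ?thesis
    using conj_centr[OF cmap_centr[OF assms]] by (simp add: tw.carrier_Z del: centr_simps of_nat_mult)
qed

lemma str_elt_carrier:
  assumes "v \<in> carrier Cu" "i \<in> {1..n}"
  shows "str_elt G u v i \<in> carrier (tw_centr G k r)"
  unfolding str_elt_u[OF assms] by (rule tw.coset_carrier[OF str_pair_carrier[OF assms]])

lemma str_elt_one:
  assumes "i \<in> C"
  shows "str_elt G u \<one>\<^bsub>W\<^esub> i = \<one>\<^bsub>tw_centr G k r\<^esub>"
proof -
  have i: "i \<in> {1..n}"
    using assms by (rule C_sub)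
  have one: "\<one>\<^bsub>W\<^esub> \<in> carrier Cu"
    using monoid.one_closed[OF group.is_monoid[OF group_Cu]] by (simp del: carrier_wreath add: centr_def)
  have "cycle_shift \<sigma> id i = 0"
    using k start_C[OF assms] by (intro shift_unique[OF centralizes_id i]) simp_all
  then show ?thesis
    using t pow_in[OF i] unfolding str_elt_u[OF one i]
    by (simp add: cmap_def one_wreath start_C[OF assms] tw.coset_one)
qed

text \<open>
  Up to conjugation by \<open>t\<close>, the element attached to \<open>v\<close> at a cycle \<open>(i)\<close> with image \<open>(j)\<close> is the block
  from \<open>i\<^sub>k\<close> to \<open>j\<^sub>k\<close> of the monomial matrix \<open>v u\<^bsup>-m\<^esup>\<close>, together with \<open>m\<close>.  Blocks compose, and \<open>u\<^bsup>-k\<^esup>\<close> has the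
  block \<open>P\<inverse>\<close>.  So if the shifts add up to at least \<open>k\<close>, the product of the two elements differs from
  the element of the product by \<open>(P\<inverse>, k)\<close>, which the quotient defining \<open>C\<^sub>P\<^sup>k\<close> makes trivial.
\<close>

lemma str_elt_mult:
  assumes v: "v \<in> carrier Cu" and w: "w \<in> carrier Cu" and i: "i \<in> {1..n}"
  shows "str_elt G u v (move (snd w) i) \<otimes>\<^bsub>tw_centr G k r\<^esub> str_elt G u w i = str_elt G u (v \<otimes>\<^bsub>W\<^esub> w) i"
proof -
  obtain h \<tau> h' \<tau>' where vw: "v = (h, \<tau>)" "w = (h', \<tau>')" by fastforce
  have vc: "(h, \<tau>) \<in> carrier Cu" and wc: "(h', \<tau>') \<in> carrier Cu"
    using v w vw by simp_all
  have h: "h i \<in> carrier G" "h' i \<in> carrier G" if "i \<in> {1..n}" for i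
    using vc wc that by (auto simp: Cu_iff simp del: centr_simps)
  have c: "centralizes \<tau>" "centralizes \<tau>'"
    using vc wc by (simp_all add: Cu_iff del: centr_simps)
  have prod: "v \<otimes>\<^bsub>W\<^esub> w \<in> carrier Cu"
    using group.is_monoid[OF group_Cu, THEN monoid.m_closed, OF v w] by simp
  define j where "j = move \<tau>' i"
  define l where "l = move \<tau> j"
  define m where "m = cycle_shift \<sigma> \<tau> j"
  define m' where "m' = cycle_shift \<sigma> \<tau>' i"
  have j: "j \<in> {1..n}"
    unfolding j_def using C_sub move_in c i by blast
  have l: "l \<in> {1..n}"
    unfolding l_def using C_sub move_in c j by blast
  have less: "m < k" "m' < k"
    unfolding m_def m'_def using shift_less c i j by auto
  have \<tau>j: "\<tau> j = (\<sigma> ^^ m) l"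
    unfolding m_def l_def by (rule shift_eq[OF c(1) j])
  have \<tau>p: "\<tau> permutes {1..n}"
    using c by (simp add: centralizes_def)
  define y where "y = (\<sigma> ^^ (k - 1)) l"
  define z where "z = inv' \<tau> y"
  have y: "y \<in> {1..n}"
    unfolding y_def using l by (rule pow_in)
  have z: "z \<in> {1..n}"
    unfolding z_def by (rule permutes_inv_in[OF \<tau>p y])
  have "\<tau> ((\<sigma> ^^ m) z) = (\<sigma> ^^ m) y"
    using centralizes_pow[OF c(1)] permutes_inverses(1)[OF \<tau>p] by (simp add: z_def)
  also have "\<dots> = (\<sigma> ^^ (k - 1)) ((\<sigma> ^^ m) l)"
    unfolding y_def by (simp only: funpow_add[THEN fun_cong, unfolded o_apply, symmetric] add.commute)
  also have "\<dots> = \<tau> ((\<sigma> ^^ (k - 1)) j)"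
    using centralizes_pow[OF c(1)] \<tau>j by simp
  \<comment> \<open>This shows where the entry of \<open>w\<close> that enters the product \<open>v w\<close> at \<open>y\<close> sits relative to \<open>j\<close>;
    moving it there is what the factor \<open>g\<^bsup>-m\<^esup>\<close> of \<open>v\<close> does.\<close>
  finally have zj: "(\<sigma> ^^ m) z = (\<sigma> ^^ (k - 1)) j"
    using permutes_inj[OF \<tau>p] by (simp add: inj_eq)
  have fst_vw: "fst (v \<otimes>\<^bsub>W\<^esub> w) y = h y \<otimes> h' z" and snd_vw: "snd (v \<otimes>\<^bsub>W\<^esub> w) = \<tau> \<circ> \<tau>'"
    using y by (simp_all add: vw mult_wreath z_def)
  have move_vw: "move (\<tau> \<circ> \<tau>') i = l" and shift_vw: "cycle_shift \<sigma> (\<tau> \<circ> \<tau>') i = (m + m') mod k"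
    using move_comp[OF c i] shift_comp[OF c i] by (simp_all add: l_def j_def m_def m'_def)
  have cv: "cmap v j = h y \<otimes> inv g [^] m"
    by (simp add: cmap_def vw m_def y_def l_def)
  have cw: "cmap w i = h' ((\<sigma> ^^ m) z) \<otimes> inv g [^] m'"
    unfolding zj by (simp add: cmap_def vw m'_def j_def)
  have cvw: "cmap (v \<otimes>\<^bsub>W\<^esub> w) i = h y \<otimes> h' z \<otimes> inv g [^] ((m + m') mod k)"
    unfolding cmap_def snd_vw move_vw shift_vw y_def[symmetric] fst_vw ..
  have z': "(\<sigma> ^^ m) z \<in> {1..n}"
    using z by (rule pow_in)
  have "cmap v j \<otimes> cmap w i = h y \<otimes> (inv g [^] m \<otimes> h' ((\<sigma> ^^ m) z)) \<otimes> inv g [^] m'"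
    unfolding cv cw using h[OF y] h[OF z'] g by (simp add: m_assoc)
  also have "\<dots> = h y \<otimes> h' z \<otimes> inv g [^] (m + m')"
    unfolding h_inv_g_pow[OF wc z] using h[OF y] h[OF z] g by (simp add: m_assoc nat_pow_mult)
  finally have prod_eq: "cmap v j \<otimes> cmap w i = h y \<otimes> h' z \<otimes> inv g [^] (m + m')" .
  let ?\<phi> = "\<lambda>a. inv t \<otimes> a \<otimes> t"
  have cc: "cmap v j \<in> carrier G" "cmap w i \<in> carrier G" "cmap (v \<otimes>\<^bsub>W\<^esub> w) i \<in> carrier (centr G P)"
    using cmap_centr[OF v j] cmap_centr[OF w i] cmap_centr[OF prod i] by simp_all
  have str_vw: "str_elt G u (v \<otimes>\<^bsub>W\<^esub> w) i = coset (?\<phi> (cmap (v \<otimes>\<^bsub>W\<^esub> w) i), int ((m + m') mod k))"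
    unfolding str_elt_u[OF prod i] snd_vw shift_vw by simp
  have vwZ: "(?\<phi> (cmap (v \<otimes>\<^bsub>W\<^esub> w) i), int ((m + m') mod k)) \<in> carrier tw.Z"
    using str_pair_carrier[OF prod i] unfolding snd_vw shift_vw .
  have "str_elt G u v j \<otimes>\<^bsub>tw_centr G k r\<^esub> str_elt G u w i =
      coset ((?\<phi> (cmap v j), int m) \<otimes>\<^bsub>tw.Z\<^esub> (?\<phi> (cmap w i), int m'))"
    unfolding str_elt_u[OF v j] str_elt_u[OF w i]
    using tw.coset_mult[OF str_pair_carrier[OF v j] str_pair_carrier[OF w i]]
    by (simp add: vw m_def m'_def)
  also have "(?\<phi> (cmap v j), int m) \<otimes>\<^bsub>tw.Z\<^esub> (?\<phi> (cmap w i), int m') =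
      (?\<phi> (cmap v j \<otimes> cmap w i), int (m + m') mod int (k * ord r))"
    using conj_hom[OF t cc(1,2)] by (simp add: tw.mult_Z)
  also have "coset \<dots> = coset (?\<phi> (cmap (v \<otimes>\<^bsub>W\<^esub> w) i), int ((m + m') mod k))"
  proof (cases "m + m' < k")
    case True
    moreover have "k \<le> k * ord r"
      using tw.M_pos by simp
    ultimately have "int (m + m') mod int (k * ord r) = int ((m + m') mod k)"
      by (metis mod_less of_nat_mod order_less_le_trans)
    then show ?thesis
      unfolding prod_eq cvw using True by simp
  next
    case False
    then have mm: "(m + m') mod k = m + m' - k"
      using less by (simp add: mod_if)
    then have split: "m + m' = k + (m + m') mod k"
      using False by simp
    have "inv g [^] (m + m') = inv g [^] ((m + m') mod k) \<otimes> inv P"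
    proof -
      have "inv g [^] (m + m') = inv g [^] ((m + m') mod k + k)"
        using split by (simp add: add.commute)
      also have "\<dots> = inv g [^] ((m + m') mod k) \<otimes> inv g [^] k"
        using g by (simp add: nat_pow_mult)
      finally show ?thesis
        using g by (simp add: nat_pow_inv)
    qed
    then have "cmap v j \<otimes> cmap w i = cmap (v \<otimes>\<^bsub>W\<^esub> w) i \<otimes> inv P"
      unfolding prod_eq cvw using h[OF y] h[OF z] g by (simp add: m_assoc)
    also have "\<dots> = inv P \<otimes> cmap (v \<otimes>\<^bsub>W\<^esub> w) i"
      using commute_inv[of P "cmap (v \<otimes>\<^bsub>W\<^esub> w) i"] cc(3) g by simp
    finally have "?\<phi> (cmap v j \<otimes> cmap w i) = ?\<phi> (inv P) \<otimes> ?\<phi> (cmap (v \<otimes>\<^bsub>W\<^esub> w) i)"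
      using conj_hom[OF t, of "inv P"] cc(3) g by simp
    also have "?\<phi> (inv P) = inv r"
      unfolding r_eq using t g by (simp add: inv_mult_group m_assoc)
    finally have "(?\<phi> (cmap v j \<otimes> cmap w i), int (m + m') mod int (k * ord r)) =
        tw.z \<otimes>\<^bsub>tw.Z\<^esub> (?\<phi> (cmap (v \<otimes>\<^bsub>W\<^esub> w) i), int ((m + m') mod k))"
      unfolding tw.mult_Z by (subst split) (simp add: mod_add_left_eq del: of_nat_mult of_nat_mod)
    then show ?thesis
      using tw.coset_z[OF vwZ] by simp
  qed
  finally show ?thesis
    unfolding str_vw by (simp add: vw j_def)
qed

end

section \<open>The power operation at a diagonal element\<close>

lemma mat_on_carrier: "mat_on B f \<in> carrier_mat (card B) (card B)"
  by (simp add: mat_on_def Let_def)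

lemma mat_on_enum:
  assumes "finite B"
  obtains e where "bij_betw e {..<card B} B"
    "\<forall>f. mat_on B f = mat (card B) (card B) (\<lambda>(a', a). f (e a') (e a))"
proof -
  have "\<exists>e. bij_betw e {..<card B} B"
    using ex_bij_betw_nat_finite[OF assms] by (simp add: atLeast0LessThan)
  from someI_ex[OF this] that show thesis
    unfolding mat_on_def Let_def by blast
qed

lemma mat_on_mult:
  assumes "finite B" "\<And>b b''. b \<in> B \<Longrightarrow> b'' \<in> B \<Longrightarrow> (\<Sum>b'\<in>B. f b'' b' * f' b' b) = f'' b'' b"
  shows "mat_on B f * mat_on B f' = mat_on B f''"
proof -
  obtain e where e: "bij_betw e {..<card B} B"
    "\<forall>f. mat_on B f = mat (card B) (card B) (\<lambda>(a', a). f (e a') (e a))"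
    by (rule mat_on_enum[OF assms(1)])
  have "(\<Sum>c<card B. f (e a') (e c) * f' (e c) (e a)) = f'' (e a') (e a)" if "a < card B" "a' < card B" for a a'
    using sum.reindex_bij_betw[OF e(1), of "\<lambda>c. f (e a') c * f' c (e a)"] that bij_betwE[OF e(1)] assms(2)
    by simp
  then show ?thesis
    unfolding e(2)[rule_format] by (intro eq_matI) (auto simp: scalar_prod_def atLeast0LessThan)
qed

lemma mat_on_one:
  assumes "finite B" "\<And>b b'. b \<in> B \<Longrightarrow> b' \<in> B \<Longrightarrow> f b' b = (if b' = b then 1 else 0)"
  shows "mat_on B f = 1\<^sub>m (card B)"
proof -
  obtain e where e: "bij_betw e {..<card B} B"
    "\<forall>f. mat_on B f = mat (card B) (card B) (\<lambda>(a', a). f (e a') (e a))"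
    by (rule mat_on_enum[OF assms(1)])
  have "e a' = e a \<longleftrightarrow> a' = a" if "a < card B" "a' < card B" for a a'
    using that e(1) by (auto simp: bij_betw_def inj_on_def)
  then show ?thesis
    unfolding e(2)[rule_format] using bij_betwE[OF e(1)] assms(2) by (intro eq_matI) auto
qed

lemma mat_trace_mat_on:
  assumes "finite B"
  shows "mat_trace (mat_on B f) = (\<Sum>b\<in>B. f b b)"
proof -
  obtain e where e: "bij_betw e {..<card B} B"
    "\<forall>f. mat_on B f = mat (card B) (card B) (\<lambda>(a', a). f (e a') (e a))"
    by (rule mat_on_enum[OF assms(1)])
  show ?thesis
    unfolding e(2)[rule_format] mat_trace_def using sum.reindex_bij_betw[OF e(1), of "\<lambda>b. f b b"] by simp
qed

lemma prod_indicator: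
  "finite A \<Longrightarrow> (\<Prod>i\<in>A. if Q i then 1 else 0) = (if \<forall>i\<in>A. Q i then 1 else (0::complex))"
  by (induction A rule: finite_induct) auto

locale devoto_power = diag_cycles G n k \<sigma> g
  for G :: "('g, 'm) monoid_scheme" (structure) and n k \<sigma> g +
  fixes x :: "'g \<Rightarrow> nat \<Rightarrow> 'g vrep"
  assumes x: "x \<in> KDev G"
begin

lemma x_in:
  assumes "q \<in> carrier G"
  shows "x q j \<in> rep_ring (centr G q)"
    and "\<exists>V W. (V, W) \<in> x q j \<and> acts_by q (zeta (ord q) ^ j) V \<and> acts_by q (zeta (ord q) ^ j) W"
proof -
  have "x q j \<in> rep_ring (centr G q) \<and>
      (\<exists>(V, W)\<in>x q j. acts_by q (zeta (ord q) ^ j) V \<and> acts_by q (zeta (ord q) ^ j) W)"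
    using x assms unfolding KDev_def by blast
  then show "x q j \<in> rep_ring (centr G q)"
    "\<exists>V W. (V, W) \<in> x q j \<and> acts_by q (zeta (ord q) ^ j) V \<and> acts_by q (zeta (ord q) ^ j) W"
    by auto
qed

text \<open>
  The tensor factors use the chosen representative \<open>r\<close> of the class of \<open>P\<close>; the compatibility of \<open>x\<close>
  with conjugation by \<open>t\<close> turns its traces into traces at \<open>P\<close> itself.
\<close>

lemma conj_trace:
  assumes "c \<in> carrier (centr G P)"
  shows "vrep_trace (inv t \<otimes> c \<otimes> t) (x r j) = vrep_trace c (x P j)"
proof -
  obtain V W where VW: "(V, W) \<in> x r j"
    using x_in(2)[OF r] by blast
  have P: "P \<in> carrier G" using g by simp
  have "t \<otimes> r \<otimes> inv t = (t \<otimes> inv t) \<otimes> P \<otimes> (t \<otimes> inv t)"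
    unfolding r_eq using t P by (simp only: m_assoc m_closed inv_closed)
  then have tr: "t \<otimes> r \<otimes> inv t = P"
    using t P by simp
  have "\<forall>(V, W)\<in>x r j. ((fst V, \<lambda>s. snd V (inv t \<otimes> s \<otimes> t)), (fst W, \<lambda>s. snd W (inv t \<otimes> s \<otimes> t)))
      \<in> x (t \<otimes> r \<otimes> inv t) j"
    using x r t unfolding KDev_def by blast
  then have VW': "((fst V, \<lambda>s. snd V (inv t \<otimes> s \<otimes> t)), (fst W, \<lambda>s. snd W (inv t \<otimes> s \<otimes> t))) \<in> x P j"
    using VW tr by auto
  show ?thesis
    using vrep_trace_eq[OF centr_group[OF r] x_in(1)[OF r] VW conj_centr[OF assms]]
      vrep_trace_eq[OF centr_group[OF P] x_in(1)[OF P] VW' assms] by simp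
qed

text \<open>
  All cycles have length \<open>k\<close> and cycle product \<open>P\<close>, so the tensor product is a tensor power of one
  graded representation.
\<close>

definition factor :: "nat \<Rightarrow> ('g \<times> int) set rep \<times> ('g \<times> int) set rep" where
  "factor j = (SOME V. V \<in> kmap G k x r j)"

lemma str_factor_u: "i \<in> {1..n} \<Longrightarrow> str_factor G x u i j = factor j"
  by (simp add: str_factor_def factor_def snd_u cycle_len cycle_prod_u)

lemma
  shows factor_reps: "fst (factor j) \<in> reps (tw_centr G k r)" "snd (factor j) \<in> reps (tw_centr G k r)"
    and factor_trace: "\<And>c m. c \<in> carrier (centr G r) \<Longrightarrow> m < k \<Longrightarrow>
      mat_trace (snd (fst (factor j)) (coset (c, int m))) - mat_trace (snd (snd (factor j)) (coset (c, int m)))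
      = zeta (k * ord r) ^ (j * m) * vrep_trace c (x r j)"
proof -
  let ?Q = "\<lambda>(V, W). (V, W) \<in> x r j \<and> acts_by r (zeta (ord r) ^ j) V \<and> acts_by r (zeta (ord r) ^ j) W"
  obtain V W where some: "(SOME VW. ?Q VW) = (V, W)"
    using prod.exhaust by blast
  have "\<exists>VW. ?Q VW"
    using x_in(2)[OF r] by auto
  then have Q: "?Q (V, W)"
    unfolding some[symmetric] by (rule someI_ex)
  then have VW: "(V, W) \<in> x r j" and V: "V \<in> reps (centr G r)" "acts_by r (zeta (ord r) ^ j) V"
    and W: "W \<in> reps (centr G r)" "acts_by r (zeta (ord r) ^ j) W"
    using Q rep_ring_reps[OF x_in(1)[OF r], of V W j] by auto
  let ?K = "kmap G k x r j"
  have K: "?K = vrep_class (tw_centr G k r) (tw_rep G k r j V, tw_rep G k r j W)"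
    unfolding kmap_def some by simp
  have TV: "tw_rep G k r j V \<in> reps (tw_centr G k r)" and TW: "tw_rep G k r j W \<in> reps (tw_centr G k r)"
    using tw.tw_rep_in_reps V W by auto
  note cls = vrep_class_in[OF tw.group_tw_centr TV TW, folded K]
  have F: "factor j \<in> ?K"
    unfolding factor_def using cls(2) by (rule someI)
  then show "fst (factor j) \<in> reps (tw_centr G k r)" "snd (factor j) \<in> reps (tw_centr G k r)"
    using rep_ring_reps[OF cls(1), of "fst (factor j)" "snd (factor j)"] by simp_all
  fix c m assume c: "c \<in> carrier (centr G r)" and m: "m < k"
  have mM: "int m < int (k * ord r)"
  proof -
    have "k \<le> k * ord r" using tw.M_pos by simp
    then show ?thesis using m by linarith
  qed
  have D: "coset (c, int m) \<in> carrier (tw_centr G k r)"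
    using c mM by (intro tw.coset_carrier) (simp add: tw.carrier_Z)
  have "mat_trace (snd (fst (factor j)) (coset (c, int m))) - mat_trace (snd (snd (factor j)) (coset (c, int m)))
      = vrep_trace (coset (c, int m)) ?K"
    using vrep_trace_eq[OF tw.group_tw_centr cls(1) _ D, of "fst (factor j)" "snd (factor j)"] F by simp
  also have "\<dots> = mat_trace (snd (tw_rep G k r j V) (coset (c, int m))) - mat_trace (snd (tw_rep G k r j W) (coset (c, int m)))"
    using vrep_trace_eq[OF tw.group_tw_centr cls(1) cls(2) D] .
  also have "\<dots> = zeta (k * ord r) ^ (j * m) * (mat_trace (snd V c) - mat_trace (snd W c))"
    using tw.tw_rep_coset[OF V c _ mM] tw.tw_rep_coset[OF W c _ mM]
      mat_trace_smult[OF repsD(1)[OF V(1) c]] mat_trace_smult[OF repsD(1)[OF W(1) c]]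
    by (simp add: power_mult right_diff_distrib)
  also have "mat_trace (snd V c) - mat_trace (snd W c) = vrep_trace c (x r j)"
    using vrep_trace_eq[OF centr_group[OF r] x_in(1)[OF r] VW c] by simp
  finally show "mat_trace (snd (fst (factor j)) (coset (c, int m))) - mat_trace (snd (snd (factor j)) (coset (c, int m)))
      = zeta (k * ord r) ^ (j * m) * vrep_trace c (x r j)" .
qed

definition rdim :: "nat \<Rightarrow> bool \<Rightarrow> nat" where
  "rdim j p = fst (parity_part p (factor j))"

definition rho :: "nat \<Rightarrow> bool \<Rightarrow> ('g \<times> int) set \<Rightarrow> complex mat" where
  "rho j p = snd (parity_part p (factor j))"

lemma rho_rep: "(rdim j p, rho j p) \<in> reps (tw_centr G k r)"
  using factor_reps by (simp add: rdim_def rho_def parity_part_def)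

lemmas rhoD = repsD[OF rho_rep, unfolded fst_conv snd_conv]

text \<open>The values of a basis vector of the tensor product at a cycle of degree \<open>j\<close> and parity \<open>p\<close>.\<close>

definition slots :: "nat \<Rightarrow> bool \<Rightarrow> (nat \<times> bool \<times> nat) set" where
  "slots j p = (\<lambda>a. (j, p, a)) ` {..<rdim j p}"

lemma finite_slots: "finite (slots j p)"
  by (simp add: slots_def)

text \<open>The exponents at the cycles and the order of \<open>u\<close> have the same denominator \<open>k|P|\<close>.\<close>

lemma str_basis_u:
  "str_basis G n x u J = {b \<in> \<Pi>\<^sub>E i\<in>C. {(j, p, a). a < rdim j p}. (\<Sum>i\<in>C. fst (b i)) = J}"
proof -
  have M: "(of_nat (k * ord P) :: rat) \<noteq> 0"
    using tw.M_pos by (simp add: ord_r)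
  have "(\<Sum>i\<in>C. of_nat (fst (b i)) / of_nat (cycle_len \<sigma> i * ord (cycle_prod G u i))) =
      (of_nat J / of_nat (group.ord W u) :: rat) \<longleftrightarrow> (\<Sum>i\<in>C. fst (b i)) = J" for b :: "nat \<Rightarrow> nat \<times> bool \<times> nat"
  proof -
    have "(\<Sum>i\<in>C. of_nat (fst (b i)) / of_nat (cycle_len \<sigma> i * ord (cycle_prod G u i))) =
        (\<Sum>i\<in>C. of_nat (fst (b i)) / (of_nat (k * ord P) :: rat))"
      by (rule sum.cong[OF refl]) (simp only: cycle_len cycle_prod_u C_sub)
    also have "\<dots> = of_nat (\<Sum>i\<in>C. fst (b i)) / of_nat (k * ord P)"
      by (simp only: sum_divide_distrib of_nat_sum)
    also have "\<dots> = of_nat J / of_nat (group.ord W u) \<longleftrightarrow> (\<Sum>i\<in>C. fst (b i)) = J"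
      unfolding ord_u using M by (simp only: divide_cancel_right of_nat_eq_iff) simp
    finally show ?thesis .
  qed
  moreover have "(\<Pi>\<^sub>E i\<in>C. {(j, p, a). a < fst (parity_part p (str_factor G x u i j))}) =
      (\<Pi>\<^sub>E i\<in>C. {(j, p, a). a < rdim j p})"
    by (rule PiE_cong) (simp only: str_factor_u[OF C_sub] rdim_def)
  ultimately show ?thesis
    unfolding str_basis_def snd_u by simp
qed

lemma finite_str_basis: "finite (str_basis G n x u J)"
proof (rule finite_subset)
  show "str_basis G n x u J \<subseteq> (\<Pi>\<^sub>E i\<in>C. \<Union>j\<le>J. \<Union>p. slots j p)"
  proof
    fix b assume "b \<in> str_basis G n x u J"
    then have b: "b \<in> (\<Pi>\<^sub>E i\<in>C. {(j, p, a). a < rdim j p})" and J: "(\<Sum>i\<in>C. fst (b i)) = J"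
      by (simp_all add: str_basis_u)
    have "b i \<in> (\<Union>j\<le>J. \<Union>p. slots j p)" if i: "i \<in> C" for i
    proof -
      obtain j p a where y: "b i = (j, p, a)" by (cases "b i")
      then have "j \<le> J"
        using member_le_sum[OF i _ finite_C, of "\<lambda>i. fst (b i)"] J by simp
      moreover have "a < rdim j p"
        using PiE_mem[OF b i] y by simp
      ultimately show ?thesis
        by (auto simp: y slots_def)
    qed
    then show "b \<in> (\<Pi>\<^sub>E i\<in>C. \<Union>j\<le>J. \<Union>p. slots j p)"
      using b by (auto simp: PiE_iff)
  qed
  show "finite (\<Pi>\<^sub>E i\<in>C. \<Union>j\<le>J. \<Union>p. slots j p)"
    using finite_slots finite_C by (intro finite_PiE) auto
qed

definition ent :: "(nat \<Rightarrow> 'g) \<times> (nat \<Rightarrow> nat) \<Rightarrow> nat \<Rightarrow> nat \<times> bool \<times> nat \<Rightarrow> nat \<times> bool \<times> nat \<Rightarrow> complex" where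
  "ent v i = (\<lambda>(j', p', a') (j, p, a).
     if j' = j \<and> p' = p then rho j p (str_elt G u v i) $$ (a', a) else 0)"

abbreviation odds :: "(nat \<Rightarrow> nat \<times> bool \<times> nat) \<Rightarrow> nat set" where
  "odds b \<equiv> odd_cycles n \<sigma> b"

lemma odds_sub: "odds b \<subseteq> C" and finite_odds: "finite (odds b)"
  using finite_C by (auto simp: odd_cycles_def intro: finite_subset[of _ C])

lemma str_entry_u:
  "str_entry G n x u v b' b = order_sign (move (snd v)) (odds b) * (\<Prod>i\<in>C. ent v i (b' (move (snd v) i)) (b i))"
proof -
  have "koszul_sign n \<sigma> (snd v) b = order_sign (move (snd v)) (odds b)"
    unfolding koszul_sign_def order_sign_inversions[OF finite_odds] ..
  moreover have "(let (j', p', a') = b' (move (snd v) i); (j, p, a) = b i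
      in if j' = j \<and> p' = p then snd (parity_part p (str_factor G x u i j)) (str_elt G u v i) $$ (a', a) else 0)
    = ent v i (b' (move (snd v) i)) (b i)" if "i \<in> C" for i
    by (simp add: Let_def case_prod_beta ent_def str_factor_u[OF C_sub[OF that]] rho_def)
  ultimately show ?thesis
    unfolding str_entry_def snd_u by simp
qed

lemma Cu_centralizes: "v \<in> carrier Cu \<Longrightarrow> centralizes (snd v)"
  by (cases v) (simp add: Cu_iff del: centr_simps)

lemma snd_mult: "snd (v \<otimes>\<^bsub>W\<^esub> w) = snd v \<circ> snd w"
  by (cases v; cases w) (simp add: mult_wreath)

lemma ent_mult:
  assumes v: "v \<in> carrier Cu" and w: "w \<in> carrier Cu" and i: "i \<in> C"
    and y: "y = (j, p, a)" "a < rdim j p" and y'': "y'' = (j'', p'', a'')" "a'' < rdim j'' p''"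
  shows "(\<Sum>y'\<in>slots j p. ent v (move (snd w) i) y'' y' * ent w i y' y) = ent (v \<otimes>\<^bsub>W\<^esub> w) i y'' y"
proof (cases "j'' = j \<and> p'' = p")
  case True
  have i': "i \<in> {1..n}"
    using i by (rule C_sub)
  have j: "move (snd w) i \<in> {1..n}"
    using C_sub[OF move_in[OF Cu_centralizes[OF w] i']] .
  note el = str_elt_carrier[OF v j] str_elt_carrier[OF w i']
  let ?A = "rho j p (str_elt G u v (move (snd w) i))" and ?B = "rho j p (str_elt G u w i)"
  have AB: "?A \<in> carrier_mat (rdim j p) (rdim j p)" "?B \<in> carrier_mat (rdim j p) (rdim j p)"
    using rhoD(1) el by auto
  have "(\<Sum>y'\<in>slots j p. ent v (move (snd w) i) y'' y' * ent w i y' y) =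
      (\<Sum>c<rdim j p. ?A $$ (a'', c) * ?B $$ (c, a))"
    unfolding slots_def using True y y'' by (subst sum.reindex) (auto simp: inj_on_def ent_def)
  also have "\<dots> = (?A * ?B) $$ (a'', a)"
    using AB y y'' True by (simp add: scalar_prod_def atLeast0LessThan)
  also have "?A * ?B = rho j p (str_elt G u (v \<otimes>\<^bsub>W\<^esub> w) i)"
    using rhoD(3)[OF el, of j p] str_elt_mult[OF v w i'] by simp
  finally show ?thesis
    using True y y'' by (simp add: ent_def)
next
  case False
  then have "ent v (move (snd w) i) y'' y' = 0" if "y' \<in> slots j p" for y'
    using that y'' by (auto simp: ent_def slots_def)
  then show ?thesis
    using False y y'' by (auto simp: ent_def)
qed

text \<open>
  For a given \<open>b\<close> the intermediate basis vectors that contribute are those whose degree and parity at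
  the image of a cycle \<open>(i)\<close> agree with those of \<open>b\<close> at \<open>(i)\<close>.  They form a product set, so that the sum
  over them factors into one matrix product for each cycle, and they all have the same Koszul sign.
\<close>

lemma str_entry_mult:
  assumes v: "v \<in> carrier Cu" and w: "w \<in> carrier Cu"
    and B: "B = {b \<in> str_basis G n x u J. odd (card (odds b)) = q}" and b: "b \<in> B" and b'': "b'' \<in> B"
  shows "(\<Sum>b'\<in>B. str_entry G n x u v b'' b' * str_entry G n x u w b' b) =
    str_entry G n x u (v \<otimes>\<^bsub>W\<^esub> w) b'' b"
proof -
  let ?\<tau> = "snd v" and ?\<tau>' = "snd w"
  note cv = Cu_centralizes[OF v] and cw = Cu_centralizes[OF w]
  let ?\<pi> = "move ?\<tau>'"
  define \<psi> where "\<psi> = the_inv_into C ?\<pi>"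
  have bij: "bij_betw ?\<pi> C C"
    by (rule move_bij[OF cw])
  have \<psi>bij: "bij_betw \<psi> C C"
    unfolding \<psi>_def by (rule bij_betw_the_inv_into[OF bij])
  have \<pi>\<psi>: "?\<pi> (\<psi> i) = i" and \<psi>C: "\<psi> i \<in> C" if "i \<in> C" for i
    using that f_the_inv_into_f_bij_betw[OF bij] bij_betwE[OF \<psi>bij] by (auto simp: \<psi>_def)
  have \<psi>\<pi>: "\<psi> (?\<pi> i) = i" if "i \<in> C" for i
    unfolding \<psi>_def by (rule the_inv_into_f_f[OF bij_betw_imp_inj_on[OF bij] that])
  let ?S = "\<lambda>i. slots (fst (b (\<psi> i))) (fst (snd (b (\<psi> i))))"
  \<comment> \<open>the intermediate basis vectors that contribute\<close>
  define B0 where "B0 = (\<Pi>\<^sub>E i\<in>C. ?S i)"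
  have bd: "snd (snd (b i)) < rdim (fst (b i)) (fst (snd (b i)))"
    and bd'': "snd (snd (b'' i)) < rdim (fst (b'' i)) (fst (snd (b'' i)))" if "i \<in> C" for i
    using b b'' that unfolding B str_basis_u by (auto simp: PiE_iff case_prod_beta)
  have B0D: "fst (b' i) = fst (b (\<psi> i))" "fst (snd (b' i)) = fst (snd (b (\<psi> i)))"
    "snd (snd (b' i)) < rdim (fst (b (\<psi> i))) (fst (snd (b (\<psi> i))))" if "b' \<in> B0" "i \<in> C" for b' i
    using PiE_mem[OF that(1)[unfolded B0_def] that(2)] by (auto simp: slots_def)
  have odds0: "odds b' = ?\<pi> ` odds b" if b': "b' \<in> B0" for b'
  proof
    show "odds b' \<subseteq> ?\<pi> ` odds b"
    proof
      fix i assume i: "i \<in> odds b'"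
      then have "i \<in> C" using odds_sub by blast
      moreover from this have "\<psi> i \<in> odds b"
        using i B0D(2)[OF b'] \<psi>C by (simp add: odd_cycles_def)
      ultimately show "i \<in> ?\<pi> ` odds b"
        using \<pi>\<psi> by (metis imageI)
    qed
    show "?\<pi> ` odds b \<subseteq> odds b'"
    proof
      fix i assume "i \<in> ?\<pi> ` odds b"
      then obtain l where l: "l \<in> odds b" "i = ?\<pi> l" by blast
      then have "l \<in> C" using odds_sub by blast
      then have "i \<in> C" "\<psi> i = l"
        using bij_betwE[OF bij] \<psi>\<pi> l by auto
      then show "i \<in> odds b'"
        using l B0D(2)[OF b'] by (simp add: odd_cycles_def)
    qed
  qed
  have sub: "B0 \<subseteq> B"
  proof
    fix b' assume b': "b' \<in> B0"
    have "b' i \<in> {(j, p, a). a < rdim j p}" if "i \<in> C" for i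
      using B0D[OF b' that] by (simp add: case_prod_beta)
    then have "b' \<in> (\<Pi>\<^sub>E i\<in>C. {(j, p, a). a < rdim j p})"
      using b' by (auto simp: B0_def PiE_iff)
    moreover have "(\<Sum>i\<in>C. fst (b' i)) = (\<Sum>i\<in>C. fst (b (\<psi> i)))"
      using B0D(1)[OF b'] by simp
    moreover have "(\<Sum>i\<in>C. fst (b (\<psi> i))) = (\<Sum>i\<in>C. fst (b i))"
      by (rule sum.reindex_bij_betw[OF \<psi>bij])
    moreover have "card (odds b') = card (odds b)"
      unfolding odds0[OF b'] using bij odds_sub by (intro card_image) (auto simp: bij_betw_def inj_on_subset)
    ultimately show "b' \<in> B"
      using b by (simp add: B str_basis_u)
  qed
  have zero: "str_entry G n x u w b' b = 0" if "b' \<in> B - B0" for b'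
  proof -
    have b': "b' \<in> (\<Pi>\<^sub>E i\<in>C. {(j, p, a). a < rdim j p})" and "b' \<notin> B0"
      using that by (auto simp: B str_basis_u)
    then obtain i where i: "i \<in> C" "b' i \<notin> ?S i"
      by (auto simp: B0_def PiE_iff)
    have "ent w (\<psi> i) (b' (?\<pi> (\<psi> i))) (b (\<psi> i)) = 0"
      using i PiE_mem[OF b' i(1)] unfolding \<pi>\<psi>[OF i(1)]
      by (cases "b' i"; cases "b (\<psi> i)") (auto simp: ent_def slots_def)
    then have "(\<Prod>i\<in>C. ent w i (b' (?\<pi> i)) (b i)) = 0"
      using finite_C \<psi>C[OF i(1)] by (auto simp: prod_zero_iff)
    then show ?thesis
      by (simp add: str_entry_u)
  qed
  have finB: "finite B"
    unfolding B using finite_str_basis by simp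
  let ?s = "order_sign (move (?\<tau> \<circ> ?\<tau>')) (odds b)"
  have sign: "order_sign (move ?\<tau>) (odds b') * order_sign ?\<pi> (odds b) = ?s" if "b' \<in> B0" for b'
  proof -
    have "order_sign (move ?\<tau> \<circ> ?\<pi>) (odds b) = order_sign (move ?\<tau>) (?\<pi> ` odds b) * order_sign ?\<pi> (odds b)"
    proof (rule order_sign_comp[OF finite_odds])
      show "inj_on ?\<pi> (odds b)"
        using bij odds_sub by (auto simp: bij_betw_def inj_on_subset)
      have "?\<pi> ` odds b \<subseteq> C"
        using bij_betwE[OF bij] odds_sub by blast
      then show "inj_on (move ?\<tau>) (?\<pi> ` odds b)"
        using move_bij[OF cv] by (auto simp: bij_betw_def inj_on_subset)
    qed
    moreover have "order_sign (move ?\<tau> \<circ> ?\<pi>) (odds b) = ?s"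
      using odds_sub C_sub move_comp[OF cv cw] by (intro order_sign_cong) fastforce
    ultimately show ?thesis
      unfolding odds0[OF that] by simp
  qed
  have fact: "(\<Prod>l\<in>C. ent v l (b'' (move ?\<tau> l)) (b' l)) * (\<Prod>i\<in>C. ent w i (b' (?\<pi> i)) (b i)) =
      (\<Prod>l\<in>C. ent v l (b'' (move ?\<tau> l)) (b' l) * ent w (\<psi> l) (b' l) (b (\<psi> l)))" for b'
  proof -
    have "(\<Prod>i\<in>C. ent w i (b' (?\<pi> i)) (b i)) = (\<Prod>l\<in>C. ent w (\<psi> l) (b' (?\<pi> (\<psi> l))) (b (\<psi> l)))"
      by (rule prod.reindex_bij_betw[OF \<psi>bij, symmetric])
    then show ?thesis
      by (simp add: prod.distrib \<pi>\<psi> cong: prod.cong)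
  qed
  have "(\<Sum>b'\<in>B. str_entry G n x u v b'' b' * str_entry G n x u w b' b) =
      (\<Sum>b'\<in>B0. str_entry G n x u v b'' b' * str_entry G n x u w b' b)"
    using sub zero finB by (intro sum.mono_neutral_right) auto
  also have "\<dots> = (\<Sum>b'\<in>B0. ?s * (\<Prod>l\<in>C. ent v l (b'' (move ?\<tau> l)) (b' l) * ent w (\<psi> l) (b' l) (b (\<psi> l))))"
  proof (rule sum.cong[OF refl])
    fix b' assume "b' \<in> B0"
    show "str_entry G n x u v b'' b' * str_entry G n x u w b' b =
        ?s * (\<Prod>l\<in>C. ent v l (b'' (move ?\<tau> l)) (b' l) * ent w (\<psi> l) (b' l) (b (\<psi> l)))"
      unfolding str_entry_u sign[OF \<open>b' \<in> B0\<close>, symmetric] fact[symmetric] by (simp only: mult_ac)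
  qed
  also have "\<dots> = ?s * (\<Prod>l\<in>C. \<Sum>y'\<in>?S l. ent v l (b'' (move ?\<tau> l)) y' * ent w (\<psi> l) y' (b (\<psi> l)))"
    unfolding B0_def sum_distrib_left[symmetric]
    by (subst prod_sum_PiE) (simp_all add: finite_C finite_slots)
  also have "(\<Prod>l\<in>C. \<Sum>y'\<in>?S l. ent v l (b'' (move ?\<tau> l)) y' * ent w (\<psi> l) y' (b (\<psi> l))) =
      (\<Prod>l\<in>C. ent (v \<otimes>\<^bsub>W\<^esub> w) (\<psi> l) (b'' (move (?\<tau> \<circ> ?\<tau>') (\<psi> l))) (b (\<psi> l)))"
  proof (rule prod.cong[OF refl])
    fix l assume l: "l \<in> C"
    have m: "move (?\<tau> \<circ> ?\<tau>') (\<psi> l) = move ?\<tau> l"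
      using move_comp[OF cv cw C_sub[OF \<psi>C[OF l]]] \<pi>\<psi>[OF l] by simp
    have ml: "move ?\<tau> l \<in> C"
      using move_in[OF cv C_sub[OF l]] .
    show "(\<Sum>y'\<in>?S l. ent v l (b'' (move ?\<tau> l)) y' * ent w (\<psi> l) y' (b (\<psi> l))) =
        ent (v \<otimes>\<^bsub>W\<^esub> w) (\<psi> l) (b'' (move (?\<tau> \<circ> ?\<tau>') (\<psi> l))) (b (\<psi> l))"
      using ent_mult[OF v w \<psi>C[OF l] _ bd[OF \<psi>C[OF l]] _ bd''[OF ml], of "b (\<psi> l)" "b'' (move ?\<tau> l)"]
      unfolding m \<pi>\<psi>[OF l] by simp
  qed
  also have "\<dots> = (\<Prod>i\<in>C. ent (v \<otimes>\<^bsub>W\<^esub> w) i (b'' (move (?\<tau> \<circ> ?\<tau>') i)) (b i))"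
    by (rule prod.reindex_bij_betw[OF \<psi>bij])
  finally show ?thesis
    unfolding str_entry_u snd_mult .
qed

lemma str_entry_one:
  assumes "b \<in> str_basis G n x u J" "b' \<in> str_basis G n x u J"
  shows "str_entry G n x u \<one>\<^bsub>W\<^esub> b' b = (if b' = b then 1 else 0)"
proof -
  have move: "move (snd \<one>\<^bsub>W\<^esub>) i = i" if "i \<in> C" for i
    using start_C[OF that] by (simp add: one_wreath)
  have "order_sign (move (snd \<one>\<^bsub>W\<^esub>)) (odds b) = order_sign (\<lambda>i. i) (odds b)"
    using odds_sub move by (intro order_sign_cong) blast
  also have "\<dots> = 1"
    unfolding order_sign_def by (rule prod.neutral) auto
  finally have s: "order_sign (move (snd \<one>\<^bsub>W\<^esub>)) (odds b) = 1" .
  have b: "b \<in> (\<Pi>\<^sub>E i\<in>C. {(j, p, a). a < rdim j p})" "b' \<in> (\<Pi>\<^sub>E i\<in>C. {(j, p, a). a < rdim j p})"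
    using assms by (simp_all add: str_basis_u)
  have "ent \<one>\<^bsub>W\<^esub> i (b' (move (snd \<one>\<^bsub>W\<^esub>) i)) (b i) = (if b' i = b i then 1 else 0)" if i: "i \<in> C" for i
    using PiE_mem[OF b(1) i] PiE_mem[OF b(2) i] unfolding move[OF i] ent_def str_elt_one[OF i] rhoD(2)
    by (auto simp: case_prod_beta prod_eq_iff)
  then have "(\<Prod>i\<in>C. ent \<one>\<^bsub>W\<^esub> i (b' (move (snd \<one>\<^bsub>W\<^esub>) i)) (b i)) = (if \<forall>i\<in>C. b' i = b i then 1 else 0)"
    using prod_indicator[OF finite_C] by (simp cong: prod.cong)
  moreover have "(\<forall>i\<in>C. b' i = b i) \<longleftrightarrow> b' = b"
    using PiE_ext[OF b(2,1)] by auto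
  ultimately show ?thesis
    unfolding str_entry_u s by simp
qed

lemma str_part_in_reps: "str_part G n x u J q \<in> reps Cu"
proof -
  define B where "B = {b \<in> str_basis G n x u J. odd (card (odds b)) = q}"
  have fin: "finite B"
    unfolding B_def using finite_str_basis by simp
  have "(card B, \<lambda>v. mat_on B (str_entry G n x u v)) \<in> reps Cu"
  proof (rule repsI)
    show "mat_on B (str_entry G n x u \<one>\<^bsub>Cu\<^esub>) = 1\<^sub>m (card B)"
      using str_entry_one[of _ J] by (intro mat_on_one[OF fin]) (simp_all add: B_def)
    show "mat_on B (str_entry G n x u (v \<otimes>\<^bsub>Cu\<^esub> w)) = mat_on B (str_entry G n x u v) * mat_on B (str_entry G n x u w)"
      if "v \<in> carrier Cu" "w \<in> carrier Cu" for v w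
      using str_entry_mult[OF that B_def] by (intro mat_on_mult[OF fin, symmetric]) simp
  qed (rule mat_on_carrier)
  then show ?thesis
    by (simp add: str_part_def snd_u B_def[symmetric])
qed

lemma P_str_trace:
  assumes "v \<in> carrier Cu"
  shows "vrep_trace v (P_str G n x u J) =
    (\<Sum>b\<in>str_basis G n x u J. (- 1) ^ card (odds b) * str_entry G n x u v b b)"
proof -
  let ?B = "\<lambda>q. {b \<in> str_basis G n x u J. odd (card (odds b)) = q}"
  have fin: "finite (?B q)" for q
    using finite_str_basis by simp
  have "P_str G n x u J = vrep_class Cu (str_part G n x u J False, str_part G n x u J True)"
    using u_in by (simp add: P_str_def)
  then have "vrep_trace v (P_str G n x u J) =
      mat_trace (snd (str_part G n x u J False) v) - mat_trace (snd (str_part G n x u J True) v)"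
    using vrep_trace_eq[OF group_Cu _ _ assms] vrep_class_in[OF group_Cu str_part_in_reps str_part_in_reps]
    by simp
  also have "\<dots> = (\<Sum>b\<in>?B False. str_entry G n x u v b b) - (\<Sum>b\<in>?B True. str_entry G n x u v b b)"
    using fin[of False] fin[of True] by (simp add: str_part_def snd_u mat_trace_mat_on Let_def)
  also have "\<dots> = (\<Sum>b\<in>?B False. (- 1) ^ card (odds b) * str_entry G n x u v b b) +
      (\<Sum>b\<in>?B True. (- 1) ^ card (odds b) * str_entry G n x u v b b)"
    by (simp add: sum_negf)
  also have "\<dots> = (\<Sum>b\<in>?B False \<union> ?B True. (- 1) ^ card (odds b) * str_entry G n x u v b b)"
    using fin[of False] fin[of True] by (intro sum.union_disjoint[symmetric]) auto
  also have "?B False \<union> ?B True = str_basis G n x u J"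
    by auto
  finally show ?thesis .
qed

end

section \<open>The trace of an element that permutes the cycles cyclically\<close>

context devoto_power
begin

lemma
  assumes v: "v \<in> carrier Cu"
  shows pow_Cu: "v [^]\<^bsub>W\<^esub> (l::nat) \<in> carrier Cu"
    and pow_Suc_W: "v [^]\<^bsub>W\<^esub> Suc l = v \<otimes>\<^bsub>W\<^esub> v [^]\<^bsub>W\<^esub> l"
proof -
  have vW: "v \<in> carrier W"
    using v by simp
  have SucW: "v [^]\<^bsub>W\<^esub> Suc l = v \<otimes>\<^bsub>W\<^esub> v [^]\<^bsub>W\<^esub> l" for l
    using monoid.nat_pow_Suc2[OF group.is_monoid[OF group_W] vW] .
  then show "v [^]\<^bsub>W\<^esub> Suc l = v \<otimes>\<^bsub>W\<^esub> v [^]\<^bsub>W\<^esub> l" .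
  show "v [^]\<^bsub>W\<^esub> l \<in> carrier Cu"
  proof (induction l)
    case 0
    then show ?case
      using monoid.one_closed[OF group.is_monoid[OF group_Cu]] by (simp add: centr_def)
  next
    case (Suc l)
    show ?case
      using monoid.m_closed[OF group.is_monoid[OF group_Cu] v Suc] unfolding SucW
      by (simp del: centr_simps(1))
  qed
qed

lemma move_pow:
  assumes v: "v \<in> carrier Cu" and eC: "\<forall>a<N. e a \<in> C"
    and e: "\<forall>a<N. move (snd v) (e a) = e (cyc N a)" and "l < N"
  shows "move (snd (v [^]\<^bsub>W\<^esub> l)) (e 0) = e l"
  using \<open>l < N\<close>
proof (induction l)
  case 0
  then show ?case
    using start_C[of "e 0"] eC by (simp add: one_wreath)
next
  case (Suc l)
  have "e 0 \<in> {1..n}"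
    using C_sub eC Suc.prems by simp
  then have "move (snd (v [^]\<^bsub>W\<^esub> Suc l)) (e 0) = move (snd v) (move (snd (v [^]\<^bsub>W\<^esub> l)) (e 0))"
    unfolding pow_Suc_W[OF v] snd_mult
    by (rule move_comp[OF Cu_centralizes[OF v] Cu_centralizes[OF pow_Cu[OF v]]])
  also have "\<dots> = e (Suc l)"
    using Suc e by (simp add: cyc_def)
  finally show ?case .
qed

text \<open>
  Because the elements attached to the cycles are multiplicative in \<open>v\<close>, composing them once around
  the loop of cycles yields the element attached to \<open>v\<^bsup>N\<^esup>\<close> at one cycle.  So the trace over the tensor
  power is the trace of a single operator on a single factor.
\<close>

lemma loop_trace:
  assumes v: "v \<in> carrier Cu" and N: "N > 0" and bij: "bij_betw e {..<N} C"
    and e: "\<And>a. a < N \<Longrightarrow> move (snd v) (e a) = e (cyc N a)"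
  shows "(\<Sum>b\<in>(\<Pi>\<^sub>E i\<in>C. slots j p). \<Prod>i\<in>C. ent v i (b (move (snd v) i)) (b i)) =
    mat_trace (rho j p (str_elt G u (v [^]\<^bsub>W\<^esub> N) (e 0)))"
proof -
  let ?d = "rdim j p"
  let ?A = "\<lambda>l. rho j p (str_elt G u v (e l))"
  have eC: "e a \<in> C" if "a < N" for a
    using bij_betwE[OF bij] that by simp
  have A: "?A l \<in> carrier_mat ?d ?d" if "l < N" for l
    using rhoD(1)[OF str_elt_carrier[OF v C_sub[OF eC[OF that]]]] .
  define e' where "e' = the_inv_into {..<N} e"
  have e'e: "e' (e l) = l" if "l < N" for l
    unfolding e'_def using bij that by (intro the_inv_into_f_f) (auto simp: bij_betw_def)
  have ee': "e (e' i) = i" and e'N: "e' i < N" if "i \<in> C" for i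
    using f_the_inv_into_f_bij_betw[OF bij] bij_betwE[OF bij_betw_the_inv_into[OF bij]] that
    by (auto simp: e'_def)
  have path: "mat_path ?A ?d l = rho j p (str_elt G u (v [^]\<^bsub>W\<^esub> l) (e 0))" if "l \<le> N" for l
    using that
  proof (induction l)
    case 0
    then show ?case
      using str_elt_one[OF eC[OF N]] rhoD(2) by simp
  next
    case (Suc l)
    then have l: "l < N" by simp
    note e0 = C_sub[OF eC[OF N]]
    note pow = pow_Cu[OF v] and Suc_W = pow_Suc_W[OF v]
    have mv: "move (snd (v [^]\<^bsub>W\<^esub> l)) (e 0) = e l"
      using move_pow[OF v _ _ l] eC e by blast
    have "mat_path ?A ?d (Suc l) = rho j p (str_elt G u v (e l)) * rho j p (str_elt G u (v [^]\<^bsub>W\<^esub> l) (e 0))"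
      using Suc by simp
    also have "\<dots> = rho j p (str_elt G u v (e l) \<otimes>\<^bsub>tw_centr G k r\<^esub> str_elt G u (v [^]\<^bsub>W\<^esub> l) (e 0))"
      by (rule rhoD(3)[OF str_elt_carrier[OF v C_sub[OF eC[OF l]]] str_elt_carrier[OF pow e0], symmetric])
    also have "str_elt G u v (e l) \<otimes>\<^bsub>tw_centr G k r\<^esub> str_elt G u (v [^]\<^bsub>W\<^esub> l) (e 0) = str_elt G u (v [^]\<^bsub>W\<^esub> Suc l) (e 0)"
      using str_elt_mult[OF v pow e0, of l] unfolding mv Suc_W .
    finally show ?case .
  qed
  have "(\<Sum>b\<in>(\<Pi>\<^sub>E i\<in>C. slots j p). \<Prod>i\<in>C. ent v i (b (move (snd v) i)) (b i)) =
      (\<Sum>a\<in>{..<N} \<rightarrow>\<^sub>E {..<?d}. \<Prod>l<N. ?A l $$ (a (cyc N l), a l))"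
  proof (rule sum.reindex_bij_witness[where i = "\<lambda>a. \<lambda>i\<in>C. (j, p, a (e' i))" and j = "\<lambda>b. \<lambda>l\<in>{..<N}. snd (snd (b (e l)))"])
    fix b assume b: "b \<in> (\<Pi>\<^sub>E i\<in>C. slots j p)"
    have bi: "b i = (j, p, snd (snd (b i)))" "snd (snd (b i)) < ?d" if "i \<in> C" for i
      using PiE_mem[OF b that] by (auto simp: slots_def)
    show "(\<lambda>i\<in>C. (j, p, (\<lambda>l\<in>{..<N}. snd (snd (b (e l)))) (e' i))) = b"
    proof (rule extensionalityI[of _ C])
      fix i assume i: "i \<in> C"
      then show "(\<lambda>i\<in>C. (j, p, (\<lambda>l\<in>{..<N}. snd (snd (b (e l)))) (e' i))) i = b i"
        using e'N[OF i] ee'[OF i] bi(1)[OF i] by simp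
    qed (use b in \<open>auto simp: PiE_iff\<close>)
    show "(\<lambda>l\<in>{..<N}. snd (snd (b (e l)))) \<in> {..<N} \<rightarrow>\<^sub>E {..<?d}"
      using bi(2) eC by auto
    have "(\<Prod>i\<in>C. ent v i (b (move (snd v) i)) (b i)) = (\<Prod>l<N. ent v (e l) (b (move (snd v) (e l))) (b (e l)))"
      by (rule prod.reindex_bij_betw[OF bij, symmetric])
    also have "\<dots> = (\<Prod>l<N. ?A l $$ (snd (snd (b (e (cyc N l)))), snd (snd (b (e l)))))"
    proof (rule prod.cong[OF refl])
      fix l assume "l \<in> {..<N}"
      then have l: "l < N" by simp
      obtain a where a: "b (e l) = (j, p, a)"
        using bi(1)[OF eC[OF l]] by blast
      obtain a' where a': "b (e (cyc N l)) = (j, p, a')"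
        using bi(1)[OF eC[OF cyc_less[OF l]]] by blast
      show "ent v (e l) (b (move (snd v) (e l))) (b (e l)) =
          ?A l $$ (snd (snd (b (e (cyc N l)))), snd (snd (b (e l))))"
        unfolding e[OF l] a a' by (simp add: ent_def)
    qed
    finally show "(\<Prod>l<N. ?A l $$ ((\<lambda>l\<in>{..<N}. snd (snd (b (e l)))) (cyc N l), (\<lambda>l\<in>{..<N}. snd (snd (b (e l)))) l)) =
        (\<Prod>i\<in>C. ent v i (b (move (snd v) i)) (b i))"
      using cyc_less by simp
  next
    fix a assume a: "a \<in> {..<N} \<rightarrow>\<^sub>E {..<?d}"
    show "(\<lambda>l\<in>{..<N}. snd (snd ((\<lambda>i\<in>C. (j, p, a (e' i))) (e l)))) = a"
      by (rule extensionalityI[of _ "{..<N}"]) (use a eC e'e in \<open>auto simp: PiE_iff\<close>)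
    show "(\<lambda>i\<in>C. (j, p, a (e' i))) \<in> (\<Pi>\<^sub>E i\<in>C. slots j p)"
      using a e'N by (auto simp: slots_def PiE_iff)
  qed
  also have "\<dots> = mat_trace (mat_path ?A ?d N)"
    using A N by (rule mat_path_trace)
  finally show ?thesis
    using path[of N] by simp
qed

lemma ent_nonzero: "ent v i y' y \<noteq> 0 \<Longrightarrow> fst y' = fst y \<and> fst (snd y') = fst (snd y)"
  by (cases y; cases y') (auto simp: ent_def split: if_splits)

text \<open>
  Only basis vectors of constant degree and parity contribute.  In odd parity the Koszul sign
  \<open>(-1)\<^bsup>N-1\<^esup>\<close> of the \<open>N\<close>-cycle and the parity \<open>(-1)\<^bsup>N\<^esup>\<close> of the basis vector combine to \<open>-1\<close>, whatever
  \<open>N\<close> is; so the result is again a difference of an even and an odd trace.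
\<close>

lemma cyclic_trace:
  assumes v: "v \<in> carrier Cu" and N: "N > 0" and bij: "bij_betw e {..<N} C"
    and e: "\<And>a. a < N \<Longrightarrow> move (snd v) (e a) = e (cyc N a)"
  shows "vrep_trace v (P_str G n x u J) =
    (if N dvd J then mat_trace (rho (J div N) False (str_elt G u (v [^]\<^bsub>W\<^esub> N) (e 0)))
        - mat_trace (rho (J div N) True (str_elt G u (v [^]\<^bsub>W\<^esub> N) (e 0))) else 0)"
proof -
  let ?term = "\<lambda>b. (- 1) ^ card (odds b) * str_entry G n x u v b b"
  let ?Bc = "\<lambda>p. (\<Pi>\<^sub>E i\<in>C. slots (J div N) p)"
  let ?D = "str_elt G u (v [^]\<^bsub>W\<^esub> N) (e 0)"
  have eC: "e a \<in> C" if "a < N" for a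
    using bij_betwE[OF bij] that by simp
  have im: "C = e ` {..<N}" and cardC: "card C = N"
    using bij bij_betw_same_card[OF bij] by (auto simp: bij_betw_def)
  have const: "N dvd J \<and> (\<exists>p. b \<in> ?Bc p)"
    if b: "b \<in> str_basis G n x u J" and nz: "?term b \<noteq> 0" for b
  proof -
    have bE: "b \<in> (\<Pi>\<^sub>E i\<in>C. {(j, p, a). a < rdim j p})" and J: "(\<Sum>i\<in>C. fst (b i)) = J"
      using b by (simp_all add: str_basis_u)
    have prod: "(\<Prod>i\<in>C. ent v i (b (move (snd v) i)) (b i)) \<noteq> 0"
      using nz by (auto simp: str_entry_u)
    have step: "fst (b (move (snd v) i)) = fst (b i) \<and> fst (snd (b (move (snd v) i))) = fst (snd (b i))" if "i \<in> C" for i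
    proof -
      have "ent v i (b (move (snd v) i)) (b i) \<noteq> 0"
        using prod that finite_C by (simp add: prod_zero_iff)
      then show ?thesis
        by (rule ent_nonzero)
    qed
    have const: "fst (b (e a)) = fst (b (e 0)) \<and> fst (snd (b (e a))) = fst (snd (b (e 0)))" if "a < N" for a
      using that
    proof (induction a)
      case (Suc a)
      then show ?case
        using step[OF eC[of a]] e[of a] by (simp add: cyc_def)
    qed simp
    have constC: "fst (b i) = fst (b (e 0))" "fst (snd (b i)) = fst (snd (b (e 0)))" if i: "i \<in> C" for i
    proof -
      obtain a where a: "a < N" "i = e a" using i im by auto
      show "fst (b i) = fst (b (e 0))" "fst (snd (b i)) = fst (snd (b (e 0)))"
        using const[OF a(1)] unfolding a(2) by (rule conjunct1, rule conjunct2)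
    qed
    have "J = (\<Sum>i\<in>C. fst (b (e 0)))"
      unfolding J[symmetric] by (rule sum.cong[OF refl constC(1)])
    then have JN: "J = N * fst (b (e 0))"
      by (simp add: cardC)
    have mem: "b i \<in> slots (J div N) (fst (snd (b (e 0))))" if i: "i \<in> C" for i
    proof -
      note c = constC[OF i]
      have "snd (snd (b i)) < rdim (fst (b i)) (fst (snd (b i)))"
        using PiE_mem[OF bE i] by (simp add: case_prod_beta)
      then have "snd (snd (b i)) \<in> {..<rdim (J div N) (fst (snd (b (e 0))))}"
        using N unfolding c JN by simp
      moreover have "b i = (J div N, fst (snd (b (e 0))), snd (snd (b i)))"
      proof -
        have "J div N = fst (b i)"
          using N unfolding c(1) JN by simp
        then show ?thesis
          unfolding c(2)[symmetric] by (simp only: prod.collapse)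
      qed
      ultimately show ?thesis
        unfolding slots_def by (rule rev_image_eqI)
    qed
    have "b \<in> ?Bc (fst (snd (b (e 0))))"
      using bE mem by (auto simp: PiE_iff)
    moreover have "N dvd J"
      using JN by simp
    ultimately show ?thesis by blast
  qed
  show ?thesis
  proof (cases "N dvd J")
    case False
    then have "?term b = 0" if "b \<in> str_basis G n x u J" for b
      using const[OF that] by blast
    then show ?thesis
      using False unfolding P_str_trace[OF v] by simp
  next
    case True
    then have JN: "N * (J div N) = J"
      by simp
    have slotsD: "fst (b i) = J div N" "fst (snd (b i)) = p" "snd (snd (b i)) < rdim (J div N) p" if "b \<in> ?Bc p" "i \<in> C" for b i p
      using PiE_mem[OF that] by (auto simp: slots_def)
    have sub: "?Bc p \<subseteq> str_basis G n x u J" for p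
    proof
      fix b assume b: "b \<in> ?Bc p"
      have "b i \<in> {(j, p, a). a < rdim j p}" if "i \<in> C" for i
        using slotsD[OF b that] by (simp add: case_prod_beta)
      then have "b \<in> (\<Pi>\<^sub>E i\<in>C. {(j, p, a). a < rdim j p})"
        using b by (auto simp: PiE_iff)
      moreover have "(\<Sum>i\<in>C. fst (b i)) = J"
        using slotsD(1)[OF b] JN by (simp add: cardC)
      ultimately show "b \<in> str_basis G n x u J"
        by (simp add: str_basis_u)
    qed
    have disj: "?Bc False \<inter> ?Bc True = {}"
      using slotsD(2)[OF _ eC[OF N]] by blast
    have fin: "finite (?Bc p)" for p
      using finite_subset[OF sub finite_str_basis] .
    have even: "?term b = (\<Prod>i\<in>C. ent v i (b (move (snd v) i)) (b i))" if b: "b \<in> ?Bc False" for b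
    proof -
      have "odds b = {}"
        using slotsD(2)[OF b] by (auto simp: odd_cycles_def)
      then show ?thesis
        by (simp add: str_entry_u order_sign_def)
    qed
    have odd: "?term b = - (\<Prod>i\<in>C. ent v i (b (move (snd v) i)) (b i))" if b: "b \<in> ?Bc True" for b
    proof -
      have C: "odds b = C"
        using slotsD(2)[OF b] by (auto simp: odd_cycles_def)
      have "order_sign (move (snd v)) C = (- 1) ^ (N - 1)"
        using order_sign_cyclic[OF N bij e] .
      moreover have "(- 1) ^ N * (- 1) ^ (N - 1) = (- 1 :: complex)"
      proof -
        obtain M where "N = Suc M"
          using N gr0_conv_Suc by blast
        moreover have "(- 1) ^ M * (- 1) ^ M = (1 :: complex)"
          unfolding power_mult_distrib[symmetric] by simp
        ultimately show ?thesis by simp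
      qed
      ultimately show ?thesis
        by (simp add: str_entry_u C cardC mult.assoc[symmetric])
    qed
    have "vrep_trace v (P_str G n x u J) = (\<Sum>b\<in>?Bc False \<union> ?Bc True. ?term b)"
      unfolding P_str_trace[OF v]
    proof (rule sum.mono_neutral_right[OF finite_str_basis])
      show "?Bc False \<union> ?Bc True \<subseteq> str_basis G n x u J"
        using sub by blast
      show "\<forall>b\<in>str_basis G n x u J - (?Bc False \<union> ?Bc True). ?term b = 0"
      proof
        fix b assume b: "b \<in> str_basis G n x u J - (?Bc False \<union> ?Bc True)"
        show "?term b = 0"
        proof (rule ccontr)
          assume "?term b \<noteq> 0"
          then obtain p where "b \<in> ?Bc p" using const[of b] b by blast
          then show False using b by (cases p) auto
        qed
      qed
    qed
    also have "\<dots> = (\<Sum>b\<in>?Bc False. ?term b) + (\<Sum>b\<in>?Bc True. ?term b)"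
      by (rule sum.union_disjoint[OF fin fin disj])
    also have "\<dots> = mat_trace (rho (J div N) False ?D) - mat_trace (rho (J div N) True ?D)"
      using even odd loop_trace[OF v N bij e] by (simp add: sum_negf)
    finally show ?thesis
      using True by simp
  qed
qed

end

section \<open>Classification of the transitive commuting pairs\<close>

definition rot :: "nat \<Rightarrow> nat \<times> nat \<Rightarrow> nat \<times> nat" where
  "rot k = (\<lambda>(a, b). (a, (b + 1) mod k))"

definition advance :: "nat \<Rightarrow> nat \<Rightarrow> nat \<Rightarrow> nat \<times> nat \<Rightarrow> nat \<times> nat" where
  "advance N k m = (\<lambda>(a, b). if Suc a = N then (0, (b + m) mod k) else (Suc a, b))"

text \<open>
  A transitive commuting pair is a transitive action of \<open>\<int>\<^sup>2\<close>, hence determined up to conjugacy by its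
  stabilizer, a sublattice of index \<open>n\<close>.  Its Hermite normal form has the basis \<open>(0, k)\<close>, \<open>(N, -m)\<close>.
  The chart identifies \<open>{1, \<dots>, n}\<close> with a fundamental domain for this lattice, on which the
  translations by \<open>(0, 1)\<close> and \<open>(1, 0)\<close> become \<open>rot\<close> and \<open>advance\<close>.
\<close>

definition chart :: "nat \<Rightarrow> nat \<times> nat \<times> nat \<Rightarrow> (nat \<Rightarrow> nat) \<times> (nat \<Rightarrow> nat) \<Rightarrow> (nat \<times> nat \<Rightarrow> nat) \<Rightarrow> bool" where
  "chart n = (\<lambda>(N, k, m) (\<sigma>, \<tau>) \<phi>. \<sigma> permutes {1..n} \<and> \<tau> permutes {1..n} \<and>
     bij_betw \<phi> ({..<N} \<times> {..<k}) {1..n} \<and>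
     (\<forall>d\<in>{..<N} \<times> {..<k}. \<sigma> (\<phi> d) = \<phi> (rot k d) \<and> \<tau> (\<phi> d) = \<phi> (advance N k m d)))"

definition types :: "nat \<Rightarrow> (nat \<times> nat \<times> nat) set" where
  "types n = {(N, k, m). N * k = n \<and> m < k}"

lemma rot_in: "d \<in> {..<N} \<times> {..<k} \<Longrightarrow> rot k d \<in> {..<N} \<times> {..<k}"
  by (auto simp: rot_def)

lemma advance_in: "d \<in> {..<N} \<times> {..<k} \<Longrightarrow> advance N k m d \<in> {..<N} \<times> {..<k}"
  by (auto simp: advance_def)

lemma add_mod_inj: "b < k \<Longrightarrow> b' < k \<Longrightarrow> (b + c) mod k = (b' + c) mod k \<Longrightarrow> b = (b'::nat)"
proof -
  assume b: "b < k" "b' < k" and eq: "(b + c) mod k = (b' + c) mod k"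
  have "c \<le> k * c"
    using b by simp
  then have c: "y + c + (k * c - c) = y + k * c" for y
    by simp
  have "(b + c + (k * c - c)) mod k = (b' + c + (k * c - c)) mod k"
    using eq by (metis mod_add_left_eq)
  then show "b = b'"
    unfolding c using b by simp
qed

lemma rot_inj: "inj_on (rot k) ({..<N} \<times> {..<k})"
proof (rule inj_onI, clarify)
  fix a b a' b' assume b: "b < k" "b' < k" and eq: "rot k (a, b) = rot k (a', b')"
  have "a = a'" "(b + 1) mod k = (b' + 1) mod k"
    using eq unfolding rot_def prod.case prod.inject by blast+
  then show "a = a' \<and> b = b'"
    using add_mod_inj[OF b] by blast
qed

lemma advance_inj: "inj_on (advance N k m) ({..<N} \<times> {..<k})"
proof (rule inj_onI, clarify)
  fix a b a' b' assume b: "b < k" "b' < k" and eq: "advance N k m (a, b) = advance N k m (a', b')"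
  show "a = a' \<and> b = b'"
  proof (cases "Suc a = N \<and> Suc a' = N")
    case True
    then have "(b + m) mod k = (b' + m) mod k"
      using eq unfolding advance_def by simp
    then show ?thesis
      using add_mod_inj[OF b] True by blast
  next
    case False
    then show ?thesis
      using eq by (simp add: advance_def split: if_splits)
  qed
qed

lemma funpow_commute:
  assumes "f \<circ> g = g \<circ> f"
  shows "(f ^^ a) ((g ^^ b) x) = (g ^^ b) ((f ^^ a) x)"
proof -
  have 1: "f ((g ^^ b) x) = (g ^^ b) (f x)" for x
    using assms by (induction b) (simp_all, metis comp_apply)
  show ?thesis
    by (induction a) (simp_all add: 1)
qed

context
  fixes n N k m :: nat and \<sigma> \<tau> \<phi>
  assumes chart: "chart n (N, k, m) (\<sigma>, \<tau>) \<phi>" and type: "(N, k, m) \<in> types n" and n: "n \<ge> 1"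
begin

lemma chart_facts:
  shows "\<sigma> permutes {1..n}" "\<tau> permutes {1..n}" "bij_betw \<phi> ({..<N} \<times> {..<k}) {1..n}"
    and "a < N \<Longrightarrow> b < k \<Longrightarrow> \<sigma> (\<phi> (a, b)) = \<phi> (a, (b + 1) mod k)"
    and "Suc a < N \<Longrightarrow> b < k \<Longrightarrow> \<tau> (\<phi> (a, b)) = \<phi> (Suc a, b)"
    and "Suc a = N \<Longrightarrow> b < k \<Longrightarrow> \<tau> (\<phi> (a, b)) = \<phi> (0, (b + m) mod k)"
    and "m < k" "k > 0" "N > 0" "N * k = n"
  using chart type n by (auto simp: chart_def types_def rot_def advance_def)

lemma chart_in: "a < N \<Longrightarrow> b < k \<Longrightarrow> \<phi> (a, b) \<in> {1..n}"
  using bij_betwE[OF chart_facts(3)] by blast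

lemma chart_eq: "a < N \<Longrightarrow> b < k \<Longrightarrow> a' < N \<Longrightarrow> b' < k \<Longrightarrow> \<phi> (a, b) = \<phi> (a', b') \<longleftrightarrow> a = a' \<and> b = b'"
  using inj_on_eq_iff[OF bij_betw_imp_inj_on[OF chart_facts(3)], of "(a, b)" "(a', b')"] by simp

lemma chart_obtain:
  assumes "i \<in> {1..n}"
  obtains a b where "a < N" "b < k" "i = \<phi> (a, b)"
  using assms bij_betw_imp_surj_on[OF chart_facts(3)] by blast

lemma chart_sigma_pow:
  assumes "a < N" "b < k"
  shows "(\<sigma> ^^ c) (\<phi> (a, b)) = \<phi> (a, (b + c) mod k)"
proof (induction c)
  case (Suc c)
  have "(b + c) mod k < k"
    using assms by simp
  then show ?case
    using chart_facts(4)[OF assms(1), of "(b + c) mod k"] Suc by (simp add: mod_Suc_eq)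
qed (use assms in simp)

lemma chart_tau_pow: "a + l < N \<Longrightarrow> b < k \<Longrightarrow> (\<tau> ^^ l) (\<phi> (a, b)) = \<phi> (a + l, b)"
  by (induction l) (simp_all add: chart_facts(5))

lemma chart_tau_N:
  assumes "i \<in> {1..n}"
  shows "(\<tau> ^^ N) i = (\<sigma> ^^ m) i"
proof -
  obtain a b where ab: "a < N" "b < k" "i = \<phi> (a, b)"
    using chart_obtain[OF assms] .
  obtain N' where N': "N = Suc N'"
    using chart_facts(9) gr0_conv_Suc by blast
  have base: "(\<tau> ^^ N) (\<phi> (0, b)) = \<phi> (0, (b + m) mod k)"
    using chart_tau_pow[of 0 N' b] chart_facts(6)[of N' b] ab by (simp add: N')
  have "i = (\<tau> ^^ a) (\<phi> (0, b))"
    using chart_tau_pow[of 0 a b] ab by simp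
  then have "(\<tau> ^^ N) i = (\<tau> ^^ a) ((\<tau> ^^ N) (\<phi> (0, b)))"
    by (metis add.commute comp_apply funpow_add)
  also have "\<dots> = \<phi> (a, (b + m) mod k)"
    unfolding base using chart_tau_pow[of 0 a "(b + m) mod k"] ab by simp
  also have "\<dots> = (\<sigma> ^^ m) i"
    using chart_sigma_pow[OF ab(1,2)] ab(3) by simp
  finally show ?thesis .
qed

lemma chart_commute: "\<sigma> \<circ> \<tau> = \<tau> \<circ> \<sigma>"
proof
  fix i
  show "(\<sigma> \<circ> \<tau>) i = (\<tau> \<circ> \<sigma>) i"
  proof (cases "i \<in> {1..n}")
    case True
    obtain a b where ab: "a < N" "b < k" "i = \<phi> (a, b)"
      using chart_obtain[OF True] .
    have k': "(b + 1) mod k < k" "(b + m) mod k < k"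
      using ab by simp_all
    show ?thesis
    proof (cases "Suc a = N")
      case True
      have "((b + m) mod k + 1) mod k = ((b + 1) mod k + m) mod k"
        by (simp add: mod_Suc_eq mod_add_left_eq)
      then show ?thesis
        using chart_facts(4)[of 0, OF chart_facts(9) k'(2)] chart_facts(6)[OF True ab(2)]
          chart_facts(4)[OF ab(1,2)] chart_facts(6)[OF True k'(1)] by (simp add: ab(3))
    next
      case False
      then have "Suc a < N" using ab(1) by simp
      then show ?thesis
        using chart_facts(4)[OF _ ab(2), of "Suc a"] chart_facts(5)[OF _ ab(2), of a]
          chart_facts(4)[OF ab(1,2)] chart_facts(5)[OF _ k'(1), of a] by (simp add: ab(3))
    qed
  next
    case False
    then show ?thesis
      using permutes_not_in[OF chart_facts(1)] permutes_not_in[OF chart_facts(2)] by simp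
  qed
qed

lemma chart_uniform: "uniform_cycles n k \<sigma>"
proof
  show "\<sigma> permutes {1..n}" "k > 0"
    using chart_facts by auto
  fix i assume "i \<in> {1..n}"
  then obtain a b where ab: "a < N" "b < k" "i = \<phi> (a, b)"
    using chart_obtain by blast
  have "permutation \<sigma>"
    using chart_facts(1) permutation_permutes by auto
  then have "orbit \<sigma> i = {(\<sigma> ^^ c) i |c. True}"
    by (rule orbit_altdef_permutation)
  also have "\<dots> = (\<lambda>c. \<phi> (a, c)) ` {..<k}"
  proof (intro equalityI subsetI)
    fix y assume "y \<in> {(\<sigma> ^^ c) i |c. True}"
    then show "y \<in> (\<lambda>c. \<phi> (a, c)) ` {..<k}"
      using chart_sigma_pow[OF ab(1,2)] ab by auto
  next
    fix y assume "y \<in> (\<lambda>c. \<phi> (a, c)) ` {..<k}"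
    then obtain c where c: "c < k" "y = \<phi> (a, c)" by auto
    have "(b + (k - b + c)) mod k = c"
      using ab c by simp
    then have "(\<sigma> ^^ (k - b + c)) i = y"
      using chart_sigma_pow[OF ab(1,2), of "k - b + c"] ab c by simp
    then show "y \<in> {(\<sigma> ^^ c) i |c. True}" by blast
  qed
  finally have "orbit \<sigma> i = (\<lambda>c. \<phi> (a, c)) ` {..<k}" .
  moreover have "inj_on (\<lambda>c. \<phi> (a, c)) {..<k}"
    using chart_eq[OF ab(1) _ ab(1)] by (auto simp: inj_on_def)
  ultimately show "card (orbit \<sigma> i) = k"
    by (simp add: card_image)
qed

text \<open>\<open>e a\<close> represents the cycle of \<open>\<sigma>\<close> with first coordinate \<open>a\<close>; \<open>\<tau>\<close> runs through these cycles in order.\<close>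

lemma chart_loop:
  defines "e \<equiv> \<lambda>a. cycle_start \<sigma> (\<phi> (a, 0))"
  shows "bij_betw e {..<N} (cycles n \<sigma>)"
    and "\<And>a. a < N \<Longrightarrow> cycle_start \<sigma> (\<tau> (e a)) = e (cyc N a)"
proof -
  interpret uniform_cycles n k \<sigma>
    by (rule chart_uniform)
  have k0: "0 < k"
    by (rule chart_facts(8))
  have start: "e a = start (\<phi> (a, b))" if "a < N" "b < k" for a b
    using chart_sigma_pow[OF that(1) k0, of b] start_pow[of b "\<phi> (a, 0)"] that by (simp add: e_def)
  have "inj_on e {..<N}"
  proof (rule inj_onI)
    fix a a' assume a: "a \<in> {..<N}" "a' \<in> {..<N}" and eq: "e a = e a'"
    obtain c where "\<phi> (a, 0) = (\<sigma> ^^ c) (e a)"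
      using start_exists[OF chart_in[of a 0]] a k0 by (auto simp: e_def)
    moreover obtain c' where "\<phi> (a', 0) = (\<sigma> ^^ c') (e a')"
      using start_exists[OF chart_in[of a' 0]] a k0 by (auto simp: e_def)
    ultimately have "(\<sigma> ^^ c') (\<phi> (a, 0)) = (\<sigma> ^^ c) (\<phi> (a', 0))"
      using eq funpow_commute[of \<sigma> \<sigma> c' c "e a"] by simp
    then have "\<phi> (a, c' mod k) = \<phi> (a', c mod k)"
      using chart_sigma_pow[of a 0] chart_sigma_pow[of a' 0] a k0 by simp
    then show "a = a'"
      using chart_eq a k0 by simp
  qed
  moreover have "e ` {..<N} = C"
  proof
    show "e ` {..<N} \<subseteq> C"
      using start_in_C chart_in k0 by (auto simp: e_def)
    show "C \<subseteq> e ` {..<N}"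
    proof
      fix i assume i: "i \<in> C"
      obtain a b where ab: "a < N" "b < k" "i = \<phi> (a, b)"
        using chart_obtain[OF C_sub[OF i]] .
      then have "i = e a"
        using start[of a b] start_C[OF i] by simp
      then show "i \<in> e ` {..<N}"
        using ab(1) by blast
    qed
  qed
  ultimately show "bij_betw e {..<N} C"
    by (simp add: bij_betw_def)
  fix a assume a: "a < N"
  have "centralizes \<tau>"
    using chart_facts(2) chart_commute by (simp add: centralizes_def)
  then have "start (\<tau> (e a)) = start (\<tau> (\<phi> (a, 0)))"
    unfolding e_def using move_start chart_in[OF a k0] by blast
  also have "\<dots> = e (cyc N a)"
  proof (cases "Suc a = N")
    case True
    then show ?thesis
      using chart_facts(6)[OF True k0] start[of 0 "m mod k"] k0 a by (simp add: cyc_def)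
  next
    case False
    then show ?thesis
      using chart_facts(5)[of a 0] k0 a by (simp add: cyc_def e_def)
  qed
  finally show "start (\<tau> (e a)) = e (cyc N a)" .
qed

lemma chart_trans: "(\<sigma>, \<tau>) \<in> trans_pairs n"
proof -
  let ?S = "sym_group n" and ?H = "generate (sym_group n) {\<sigma>, \<tau>}"
  interpret S: group ?S by (rule sym_group_is_group)
  have st: "{\<sigma>, \<tau>} \<subseteq> carrier ?S"
    using chart_facts(1,2) by (simp add: sym_group_carrier)
  have sub: "subgroup ?H ?S"
    using st by (rule S.generate_is_subgroup)
  have pow: "f ^^ c \<in> ?H" if "f \<in> {\<sigma>, \<tau>}" for f c
  proof (induction c)
    case 0
    then show ?case using generate.one[of ?S] by (simp add: sym_group_one id_def)
  next
    case (Suc c)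
    then show ?case
      using generate.eng[OF generate.incl[OF that] Suc] unfolding sym_group_mult funpow.simps by blast
  qed
  have reach: "\<exists>\<rho>\<in>?H. \<rho> (\<phi> (0, 0)) = i" if i: "i \<in> {1..n}" for i
  proof -
    obtain a b where ab: "a < N" "b < k" "i = \<phi> (a, b)"
      using chart_obtain[OF i] .
    have "(\<tau> ^^ a) ((\<sigma> ^^ b) (\<phi> (0, 0))) = i"
      using chart_sigma_pow[OF chart_facts(9,8), of b] chart_tau_pow[of 0 a b] ab by simp
    moreover have "\<tau> ^^ a \<circ> \<sigma> ^^ b \<in> ?H"
      using generate.eng[OF pow[of \<tau> a] pow[of \<sigma> b]] by (simp add: sym_group_mult)
    ultimately show ?thesis
      by (intro bexI[of _ "\<tau> ^^ a \<circ> \<sigma> ^^ b"]) simp_all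
  qed
  have "\<exists>\<rho>\<in>?H. \<rho> i = j" if ij: "i \<in> {1..n}" "j \<in> {1..n}" for i j
  proof -
    obtain \<rho> \<rho>' where \<rho>: "\<rho> \<in> ?H" "\<rho> (\<phi> (0, 0)) = i" and \<rho>': "\<rho>' \<in> ?H" "\<rho>' (\<phi> (0, 0)) = j"
      using reach ij by metis
    have c: "\<rho> \<in> carrier ?S"
      using subgroup.mem_carrier[OF sub \<rho>(1)] .
    have "inv' \<rho> \<in> ?H"
      using subgroup.m_inv_closed[OF sub \<rho>(1)] c by simp
    then have "\<rho>' \<circ> inv' \<rho> \<in> ?H"
      using subgroup.m_closed[OF sub \<rho>'(1)] by (simp add: sym_group_mult)
    moreover have "inv' \<rho> i = \<phi> (0, 0)"
      using c permutes_inverses(2)[of \<rho> "{1..n}"] \<rho>(2) by (auto simp: sym_group_carrier)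
    ultimately show ?thesis
      using \<rho>'(2) by (intro bexI[of _ "\<rho>' \<circ> inv' \<rho>"]) simp_all
  qed
  then show ?thesis
    using st chart_commute by (simp add: trans_pairs_def)
qed

end

lemma chart_type_unique:
  assumes "chart n (N, k, m) \<alpha> \<phi>" "chart n (N', k', m') \<alpha> \<phi>'" "(N, k, m) \<in> types n" "(N', k', m') \<in> types n" "n \<ge> 1"
  shows "(N, k, m) = (N', k', m')"
proof -
  obtain \<sigma> \<tau> where \<alpha>: "\<alpha> = (\<sigma>, \<tau>)" by fastforce
  note A = assms(1)[unfolded \<alpha>] and A' = assms(2)[unfolded \<alpha>]
  interpret uniform_cycles n k \<sigma>
    by (rule chart_uniform[OF A assms(3,5)])
  have one: "1 \<in> {1..n}"
    using assms(5) by simp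
  have kk: "k' = k"
    using uniform_cycles.card_orbit[OF chart_uniform[OF A' assms(4,5)] one] card_orbit[OF one] by simp
  have "N' * k' = n" "N * k = n"
    using assms(3,4) by (auto simp: types_def)
  then have "N' * k = N * k"
    unfolding kk by simp
  then have NN: "N' = N"
    using k by simp
  have "(\<sigma> ^^ m) 1 = (\<sigma> ^^ m') 1"
    using chart_tau_N[OF A assms(3,5) one] chart_tau_N[OF A' assms(4,5) one] NN by simp
  then have "m = m'"
    using pow_eq_iff[OF one] assms(3,4) kk by (simp add: types_def)
  with kk NN show ?thesis by simp
qed

lemma transport_permutes:
  assumes "bij_betw \<phi> D S" "bij_betw \<phi>' D S"
  shows "(\<lambda>i. if i \<in> S then \<phi>' (the_inv_into D \<phi> i) else i) permutes S"
proof (rule bij_imp_permutes)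
  have "bij_betw (\<phi>' \<circ> the_inv_into D \<phi>) S S"
    using bij_betw_trans[OF bij_betw_the_inv_into[OF assms(1)] assms(2)] .
  then show "bij_betw (\<lambda>i. if i \<in> S then \<phi>' (the_inv_into D \<phi> i) else i) S S"
    by (subst bij_betw_cong[where g = "\<phi>' \<circ> the_inv_into D \<phi>"]) simp_all
qed simp

lemma chart_conj:
  assumes "chart n T \<alpha> \<phi>" "chart n T \<beta> \<phi>'"
  shows "pair_conj n \<alpha> \<beta>"
proof -
  obtain N k m where T: "T = (N, k, m)" by (cases T) auto
  obtain \<sigma> \<tau> \<sigma>' \<tau>' where \<alpha>\<beta>: "\<alpha> = (\<sigma>, \<tau>)" "\<beta> = (\<sigma>', \<tau>')" by fastforce
  let ?D = "{..<N} \<times> {..<k}"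
  have A: "\<sigma> permutes {1..n}" "\<tau> permutes {1..n}" "bij_betw \<phi> ?D {1..n}"
    "\<And>d. d \<in> ?D \<Longrightarrow> \<sigma> (\<phi> d) = \<phi> (rot k d)" "\<And>d. d \<in> ?D \<Longrightarrow> \<tau> (\<phi> d) = \<phi> (advance N k m d)"
    using assms(1) by (auto simp: T \<alpha>\<beta> chart_def)
  have B: "\<sigma>' permutes {1..n}" "\<tau>' permutes {1..n}" "bij_betw \<phi>' ?D {1..n}"
    "\<And>d. d \<in> ?D \<Longrightarrow> \<sigma>' (\<phi>' d) = \<phi>' (rot k d)" "\<And>d. d \<in> ?D \<Longrightarrow> \<tau>' (\<phi>' d) = \<phi>' (advance N k m d)"
    using assms(2) by (auto simp: T \<alpha>\<beta> chart_def)
  define \<rho> where "\<rho> = (\<lambda>i. if i \<in> {1..n} then \<phi>' (the_inv_into ?D \<phi> i) else i)"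
  have \<rho>: "\<rho> permutes {1..n}"
    unfolding \<rho>_def by (rule transport_permutes[OF A(3) B(3)])
  have \<rho>\<phi>: "\<rho> (\<phi> d) = \<phi>' d" if "d \<in> ?D" for d
  proof -
    have "\<phi> d \<in> {1..n}"
      using bij_betwE[OF A(3)] that by blast
    then show ?thesis
      using the_inv_into_f_f[OF bij_betw_imp_inj_on[OF A(3)] that] by (simp add: \<rho>_def)
  qed
  have conj: "s' = \<rho> \<circ> s \<circ> inv' \<rho>"
    if s: "s permutes {1..n}" "s' permutes {1..n}" and f: "\<And>d. d \<in> ?D \<Longrightarrow> f d \<in> ?D"
      "\<And>d. d \<in> ?D \<Longrightarrow> s (\<phi> d) = \<phi> (f d)" "\<And>d. d \<in> ?D \<Longrightarrow> s' (\<phi>' d) = \<phi>' (f d)" for s s' f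
  proof
    fix i
    show "s' i = (\<rho> \<circ> s \<circ> inv' \<rho>) i"
    proof (cases "i \<in> {1..n}")
      case True
      then obtain d where d: "d \<in> ?D" "i = \<phi>' d"
        using bij_betw_imp_surj_on[OF B(3)] by blast
      have "inv' \<rho> i = \<phi> d"
        using permutes_inverses(2)[OF \<rho>] \<rho>\<phi>[OF d(1)] d(2) by metis
      then show ?thesis
        using f[OF d(1)] \<rho>\<phi>[OF f(1)[OF d(1)]] d(2) by simp
    next
      case False
      then show ?thesis
        using permutes_not_in[OF s(1)] permutes_not_in[OF s(2)] permutes_not_in[OF \<rho>]
          permutes_not_in[OF permutes_inv[OF \<rho>]] by simp
    qed
  qed
  have "\<sigma>' = \<rho> \<circ> \<sigma> \<circ> inv' \<rho>"
    using A(1,4) B(1,4) rot_in by (intro conj) auto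
  moreover have "\<tau>' = \<rho> \<circ> \<tau> \<circ> inv' \<rho>"
    using A(2,5) B(2,5) advance_in by (intro conj) auto
  ultimately show ?thesis
    using \<rho> by (auto simp: \<alpha>\<beta> pair_conj_def sym_group_carrier)
qed

lemma conj_chart:
  assumes "pair_conj n \<alpha> \<beta>" "chart n T \<alpha> \<phi>"
  shows "\<exists>\<phi>'. chart n T \<beta> \<phi>'"
proof -
  obtain N k m where T: "T = (N, k, m)" by (cases T) auto
  obtain \<sigma> \<tau> \<sigma>' \<tau>' where \<alpha>\<beta>: "\<alpha> = (\<sigma>, \<tau>)" "\<beta> = (\<sigma>', \<tau>')" by fastforce
  obtain \<rho> where \<rho>: "\<rho> permutes {1..n}" "\<sigma>' = \<rho> \<circ> \<sigma> \<circ> inv' \<rho>" "\<tau>' = \<rho> \<circ> \<tau> \<circ> inv' \<rho>"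
    using assms(1) by (auto simp: \<alpha>\<beta> pair_conj_def sym_group_carrier)
  have A: "\<sigma> permutes {1..n}" "\<tau> permutes {1..n}" "bij_betw \<phi> ({..<N} \<times> {..<k}) {1..n}"
    using assms(2) by (auto simp: T \<alpha>\<beta> chart_def)
  have "\<sigma>' permutes {1..n}" "\<tau>' permutes {1..n}"
    using \<rho> A by (auto intro!: permutes_compose permutes_inv)
  moreover have "bij_betw (\<rho> \<circ> \<phi>) ({..<N} \<times> {..<k}) {1..n}"
    by (rule bij_betw_trans[OF A(3) permutes_imp_bij[OF \<rho>(1)]])
  ultimately have "chart n T \<beta> (\<rho> \<circ> \<phi>)"
    using assms(2) permutes_inverses(2)[OF \<rho>(1)] \<rho>(2,3) by (auto simp: T \<alpha>\<beta> chart_def)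
  then show ?thesis by blast
qed

lemma chart_canonical:
  assumes "T \<in> types n"
  shows "\<exists>\<alpha> \<phi>. chart n T \<alpha> \<phi>"
proof -
  obtain N k m where T: "T = (N, k, m)" and Nk: "N * k = n" and m: "m < k"
    using assms by (auto simp: types_def)
  let ?D = "{..<N} \<times> {..<k}"
  define \<phi> where "\<phi> = (\<lambda>(a, b). a * k + b + 1)"
  have inj: "inj_on \<phi> ?D"
  proof (rule inj_onI, clarify)
    fix a b a' b' assume "b < k" "b' < k" "\<phi> (a, b) = \<phi> (a', b')"
    then have eq: "a * k + b = a' * k + b'" by (simp add: \<phi>_def)
    then have "(a * k + b) div k = (a' * k + b') div k" "(a * k + b) mod k = (a' * k + b') mod k"
      by simp_all
    then show "a = a' \<and> b = b'"
      using \<open>b < k\<close> \<open>b' < k\<close> by simp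
  qed
  have "\<phi> ` ?D \<subseteq> {1..n}"
  proof (clarify)
    fix a b assume ab: "a < N" "b < k"
    then have "Suc a * k \<le> N * k"
      by (intro mult_le_mono1) simp
    then show "\<phi> (a, b) \<in> {1..n}"
      using ab Nk by (simp add: \<phi>_def)
  qed
  moreover have "card (\<phi> ` ?D) = card {1..n}"
    using inj Nk by (simp add: card_image card_cartesian_product)
  ultimately have bij: "bij_betw \<phi> ?D {1..n}"
    using inj card_subset_eq[of "{1..n}" "\<phi> ` ?D"] by (simp add: bij_betw_def)
  let ?s = "\<lambda>f i. if i \<in> {1..n} then \<phi> (f (the_inv_into ?D \<phi> i)) else i"
  have perm: "?s f permutes {1..n}" if "\<And>d. d \<in> ?D \<Longrightarrow> f d \<in> ?D" "inj_on f ?D" for f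
  proof -
    have "f ` ?D = ?D"
      using that by (intro endo_inj_surj image_subsetI) simp_all
    then have "bij_betw (\<phi> \<circ> f) ?D {1..n}"
      using bij_betw_trans[of f ?D ?D \<phi>] that bij by (simp add: bij_betw_def)
    from transport_permutes[OF bij this] show ?thesis
      unfolding o_apply .
  qed
  have val: "?s f (\<phi> d) = \<phi> (f d)" if "d \<in> ?D" for f d
  proof -
    have "\<phi> d \<in> {1..n}"
      using bij_betwE[OF bij] that by blast
    then show ?thesis
      using the_inv_into_f_f[OF inj that] by simp
  qed
  have "chart n T (?s (rot k), ?s (advance N k m)) \<phi>"
    unfolding T chart_def prod.case
    using perm[OF rot_in rot_inj] perm[OF advance_in advance_inj] bij val by blast
  then show ?thesis by blast
qed

text \<open>
  The numbers of a transitive pair: \<open>k\<close> is the length of the cycles of \<open>\<sigma>\<close>, \<open>N\<close> the first time that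
  \<open>\<tau>\<close> returns to the cycle of \<open>1\<close>, and \<open>m\<close> the rotation of this cycle by \<open>\<tau>\<^sup>N\<close>.
\<close>

lemma chart_exists:
  assumes "\<alpha> \<in> trans_pairs n" "n \<ge> 1"
  shows "\<exists>T\<in>types n. \<exists>\<phi>. chart n T \<alpha> \<phi>"
proof -
  obtain \<sigma> \<tau> where \<alpha>: "\<alpha> = (\<sigma>, \<tau>)" by fastforce
  have p: "\<sigma> permutes {1..n}" "\<tau> permutes {1..n}" and comm: "\<sigma> \<circ> \<tau> = \<tau> \<circ> \<sigma>"
    and trans: "\<And>j. j \<in> {1..n} \<Longrightarrow> \<exists>\<rho>\<in>generate (sym_group n) {\<sigma>, \<tau>}. \<rho> 1 = j"
    using assms by (auto simp: \<alpha> trans_pairs_def sym_group_carrier)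
  have perm: "permutation \<sigma>" "permutation \<tau>"
    using p permutation_permutes by auto
  define k where "k = funpow_dist1 \<sigma> 1 1"
  have self: "1 \<in> orbit \<sigma> 1"
    using perm(1) by (rule permutation_self_in_orbit)
  have k: "k > 0" and \<sigma>k: "(\<sigma> ^^ k) 1 = 1" and inj\<sigma>: "inj_on (\<lambda>b. (\<sigma> ^^ b) 1) {0..<k}"
    unfolding k_def using funpow_dist1_prop[OF self] inj_on_funpow_dist1[OF self] by simp_all
  have orb: "orbit \<sigma> 1 = {(\<sigma> ^^ b) 1 |b. b < k}"
    by (rule orbit_altdef_bounded[OF \<sigma>k k])
  have \<sigma>mod: "(\<sigma> ^^ (b mod k)) 1 = (\<sigma> ^^ b) 1" for b
    by (rule funpow_mod_eq[OF \<sigma>k])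
  have orbit_pow: "orbit \<sigma> ((\<sigma> ^^ b) y) = orbit \<sigma> y" for b y
    by (induction b) (simp_all add: permutation_orbit_step[OF perm(1)])
  have \<sigma>\<tau>: "(\<sigma> ^^ b) ((\<tau> ^^ a) y) = (\<tau> ^^ a) ((\<sigma> ^^ b) y)" for a b y
    by (rule funpow_commute[OF comm])
  define N where "N = (LEAST l. l > 0 \<and> (\<tau> ^^ l) 1 \<in> orbit \<sigma> 1)"
  have "\<exists>l. l > 0 \<and> (\<tau> ^^ l) 1 \<in> orbit \<sigma> 1"
    using permutation_self[OF perm(2), of 1] self by metis
  then have N: "N > 0" "(\<tau> ^^ N) 1 \<in> orbit \<sigma> 1"
    unfolding N_def by (metis (mono_tags, lifting) LeastI_ex)+
  have Nleast: "l \<ge> N" if "l > 0" "(\<tau> ^^ l) 1 \<in> orbit \<sigma> 1" for l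
    unfolding N_def using that by (intro Least_le) simp
  obtain m where m: "m < k" "(\<tau> ^^ N) 1 = (\<sigma> ^^ m) 1"
    using N(2) orb by auto
  let ?D = "{..<N} \<times> {..<k}"
  define \<phi> where "\<phi> = (\<lambda>(a, b). (\<tau> ^^ a) ((\<sigma> ^^ b) 1))"
  have s: "\<sigma> (\<phi> d) = \<phi> (rot k d)" for d
  proof -
    obtain a b where d: "d = (a, b)" by fastforce
    have "\<sigma> (\<phi> d) = (\<tau> ^^ a) ((\<sigma> ^^ (b + 1)) 1)"
      using \<sigma>\<tau>[of 1 a "(\<sigma> ^^ b) 1"] by (simp add: d \<phi>_def)
    then show ?thesis
      unfolding \<sigma>mod[of "b + 1", symmetric] by (simp only: d \<phi>_def rot_def prod.case)
  qed
  have t: "\<tau> (\<phi> d) = \<phi> (advance N k m d)" for d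
  proof -
    obtain a b where d: "d = (a, b)" by fastforce
    have 1: "\<tau> (\<phi> d) = (\<tau> ^^ Suc a) ((\<sigma> ^^ b) 1)"
      by (simp add: d \<phi>_def)
    show ?thesis
    proof (cases "Suc a = N")
      case True
      have "\<tau> (\<phi> d) = (\<sigma> ^^ b) ((\<tau> ^^ N) 1)"
        unfolding 1 True \<sigma>\<tau> ..
      also have "\<dots> = (\<sigma> ^^ (b + m)) 1"
        unfolding m(2) by (simp add: funpow_add)
      finally show ?thesis
        unfolding \<sigma>mod[of "b + m", symmetric] using True by (simp add: d \<phi>_def advance_def)
    next
      case False
      then show ?thesis
        unfolding 1 by (simp add: d \<phi>_def advance_def)
    qed
  qed
  have le: "a = a' \<and> b = b'"
    if "a \<le> a'" "a' < N" "b < k" "b' < k" "\<phi> (a, b) = \<phi> (a', b')" for a a' b b'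
  proof -
    have "(\<tau> ^^ a) ((\<sigma> ^^ b) 1) = (\<tau> ^^ a) ((\<tau> ^^ (a' - a)) ((\<sigma> ^^ b') 1))"
      using that(1,5) funpow_add[of a "a' - a" \<tau>] by (simp add: \<phi>_def)
    moreover have "inj (\<tau> ^^ a)"
      using permutes_inj[OF p(2)] by (rule inj_fn)
    \<comment> \<open>So \<open>\<tau>\<close> returns to the cycle of 1 after \<open>a' - a < N\<close> steps.\<close>
    ultimately have eq: "(\<sigma> ^^ b) 1 = (\<sigma> ^^ b') ((\<tau> ^^ (a' - a)) 1)"
      unfolding \<sigma>\<tau> by (simp add: inj_eq)
    then have "orbit \<sigma> ((\<tau> ^^ (a' - a)) 1) = orbit \<sigma> 1"
      using orbit_pow by metis
    then have "(\<tau> ^^ (a' - a)) 1 \<in> orbit \<sigma> 1"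
      using permutation_self_in_orbit[OF perm(1)] by metis
    then have "a' - a = 0"
      using Nleast[of "a' - a"] that(2) by fastforce
    moreover from this have "b = b'"
      using eq inj_on_eq_iff[OF inj\<sigma>, of b b'] that(3,4) by simp
    ultimately show ?thesis
      using that(1) by simp
  qed
  have inj: "inj_on \<phi> ?D"
  proof (rule inj_onI, clarify)
    fix a b a' b' assume "a < N" "a' < N" "b < k" "b' < k" "\<phi> (a, b) = \<phi> (a', b')"
    then show "a = a' \<and> b = b'"
      using le[of a a' b b'] le[of a' a b' b] by (cases "a \<le> a'") auto
  qed
  have fin: "finite (\<phi> ` ?D)" by simp
  \<comment> \<open>A finite set mapped to itself by a permutation is also mapped to itself by the inverse, so the
    image of \<open>\<phi>\<close> is closed under the subgroup generated by \<open>\<sigma>\<close> and \<open>\<tau>\<close>.\<close>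
  have inv_img: "inv' f y \<in> \<phi> ` ?D"
    if f: "f permutes {1..n}" "\<And>y. y \<in> \<phi> ` ?D \<Longrightarrow> f y \<in> \<phi> ` ?D" and y: "y \<in> \<phi> ` ?D" for f y
  proof -
    have "f ` (\<phi> ` ?D) = \<phi> ` ?D"
      using f permutes_inj_on[OF f(1)] by (intro endo_inj_surj[OF fin]) auto
    then obtain y' where "y' \<in> \<phi> ` ?D" "y = f y'"
      using y by blast
    then show ?thesis
      using permutes_inverses(2)[OF f(1)] by simp
  qed
  have s_img: "\<sigma> y \<in> \<phi> ` ?D" and t_img: "\<tau> y \<in> \<phi> ` ?D" if "y \<in> \<phi> ` ?D" for y
    using that s t rot_in advance_in by fastforce+
  have closed: "\<rho> y \<in> \<phi> ` ?D" if "\<rho> \<in> generate (sym_group n) {\<sigma>, \<tau>}" "y \<in> \<phi> ` ?D" for \<rho> y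
    using that
  proof (induction arbitrary: y)
    case one
    then show ?case by (simp add: sym_group_one)
  next
    case (incl f)
    then show ?case using s_img t_img by blast
  next
    case (inv f)
    then have "f permutes {1..n}" "inv\<^bsub>sym_group n\<^esub> f = inv' f"
      using p by (auto simp: sym_group_carrier)
    then show ?case
      using inv_img[of f] inv s_img t_img by auto
  next
    case (eng f f')
    then show ?case by (simp add: sym_group_mult)
  qed
  have "(0, 0) \<in> ?D" "\<phi> (0, 0) = 1"
    using N(1) k by (simp_all add: \<phi>_def)
  then have "1 \<in> \<phi> ` ?D"
    by (metis imageI)
  then have "{1..n} \<subseteq> \<phi> ` ?D"
    using trans closed by blast
  moreover have "\<phi> ` ?D \<subseteq> {1..n}"
  proof -
    have "(f ^^ a) y \<in> {1..n}" if "f permutes {1..n}" "y \<in> {1..n}" for f a y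
    proof (induction a)
      case (Suc a)
      then show ?case
        using permutes_in_image[OF that(1), of "(f ^^ a) y"] by simp
    qed (use that in simp)
    moreover have "1 \<in> {1..n}"
      using assms(2) by simp
    ultimately have "\<phi> (a, b) \<in> {1..n}" for a b
      unfolding \<phi>_def prod.case using p by blast
    then show ?thesis by blast
  qed
  ultimately have bij: "bij_betw \<phi> ?D {1..n}"
    using inj by (auto simp: bij_betw_def)
  then have "N * k = n"
    using bij_betw_same_card[OF bij] by (simp add: card_cartesian_product)
  then have "(N, k, m) \<in> types n"
    using m(1) by (simp add: types_def)
  moreover have "chart n (N, k, m) \<alpha> \<phi>"
    using p bij s t by (simp add: \<alpha> chart_def)
  ultimately show ?thesis by blast
qed

text \<open>
  Two members of the system with charts of the same type are conjugate and therefore equal, and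
  every type occurs because the standard chart of that type defines a transitive commuting pair.
\<close>

lemma types_bij:
  assumes "rep_system n A" "n \<ge> 1"
  obtains f where "bij_betw f (types n) A" "\<forall>T\<in>types n. \<exists>\<phi>. chart n T (f T) \<phi>"
proof -
  have A: "A \<subseteq> trans_pairs n" and uniq: "\<And>\<alpha>. \<alpha> \<in> trans_pairs n \<Longrightarrow> \<exists>!\<beta>. \<beta> \<in> A \<and> pair_conj n \<alpha> \<beta>"
    using assms(1) by (auto simp: rep_system_def)
  have ex: "\<exists>\<beta>. \<beta> \<in> A \<and> (\<exists>\<phi>. chart n T \<beta> \<phi>)" if T: "T \<in> types n" for T
  proof -
    obtain \<alpha> \<phi> where c: "chart n T \<alpha> \<phi>"
      using chart_canonical[OF T] by blast
    obtain N k m \<sigma> \<tau> where e: "T = (N, k, m)" "\<alpha> = (\<sigma>, \<tau>)"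
      by (metis surj_pair)
    have "\<alpha> \<in> trans_pairs n"
      using chart_trans[OF c[unfolded e] T[unfolded e(1)] assms(2)] e by simp
    then obtain \<beta> where "\<beta> \<in> A" "pair_conj n \<alpha> \<beta>"
      using uniq by blast
    then show ?thesis
      using conj_chart[OF _ c] by blast
  qed
  define f where "f T = (SOME \<beta>. \<beta> \<in> A \<and> (\<exists>\<phi>. chart n T \<beta> \<phi>))" for T
  have f: "f T \<in> A" "\<exists>\<phi>. chart n T (f T) \<phi>" if "T \<in> types n" for T
    using someI_ex[OF ex[OF that]] by (simp_all add: f_def)
  have "inj_on f (types n)"
  proof (rule inj_onI)
    fix T T' assume T: "T \<in> types n" "T' \<in> types n" and eq: "f T = f T'"
    obtain N k m N' k' m' where e: "T = (N, k, m)" "T' = (N', k', m')"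
      by (metis surj_pair)
    obtain \<phi> \<phi>' where "chart n T (f T) \<phi>" "chart n T' (f T) \<phi>'"
      using f(2)[OF T(1)] f(2)[OF T(2)] eq by auto
    then show "T = T'"
      using chart_type_unique[of n N k m "f T" \<phi> N' k' m' \<phi>'] T assms(2) e by simp
  qed
  moreover have "f ` types n = A"
  proof
    show "f ` types n \<subseteq> A"
      using f(1) by blast
    show "A \<subseteq> f ` types n"
    proof
      fix \<beta> assume \<beta>: "\<beta> \<in> A"
      then obtain T \<phi> where T: "T \<in> types n" "chart n T \<beta> \<phi>"
        using chart_exists[of \<beta> n] A assms(2) by blast
      obtain \<phi>' where "chart n T (f T) \<phi>'"
        using f(2)[OF T(1)] by blast
      then have "pair_conj n \<beta> (f T)" "pair_conj n \<beta> \<beta>"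
        using chart_conj[OF T(2)] T(2) by blast+
      then have "f T = \<beta>"
        using uniq[of \<beta>] A \<beta> f(1)[OF T(1)] by blast
      then show "\<beta> \<in> f ` types n"
        using T(1) by blast
    qed
  qed
  ultimately show thesis
    using that[of f] f(2) by (simp add: bij_betw_def)
qed

section \<open>The contribution of one pair\<close>

lemma zeta_power: "l > 0 \<Longrightarrow> zeta l ^ j = cis (2 * pi * of_rat (of_nat j / of_nat l))"
  by (simp add: zeta_def DeMoivre of_rat_divide mult_ac)

text \<open>
  Substituting \<open>(Nz + m)/k\<close> for \<open>z\<close> moves the coefficient at the exponent \<open>j/l\<close> to the exponent \<open>Nj/(kl)\<close>
  and multiplies it by \<open>\<zeta>\<^bsup>jm\<^esup>\<close>, with \<open>\<zeta>\<close> the standard root of unity of order \<open>kl\<close>.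
\<close>

lemma rescale_series:
  fixes X Y :: "nat \<Rightarrow> complex" and N k m l :: nat
  assumes pos: "N > 0" "k > 0" "l > 0"
    and Y: "\<And>J. Y J = (if N dvd J then zeta (k * l) ^ (J div N * m) * X (J div N) else 0)"
  shows "(\<Sum>J | of_nat J / of_nat (k * l) = s. Y J) =
    z_subst (of_nat N / of_nat k) (of_nat m / of_nat k) (\<lambda>s. \<Sum>j | of_nat j / of_nat l = s. X j) s"
proof -
  have kl: "k * l > 0" using pos by simp
  have R: "of_nat j / of_nat l = s / (of_nat N / of_nat k) \<longleftrightarrow> of_nat (N * j) / of_nat (k * l) = s" for j
    using pos by (auto simp: field_simps)
  have inj: "of_nat J / (of_nat (k * l) :: rat) = of_nat J' / of_nat (k * l) \<longleftrightarrow> J = J'" for J J'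
    using kl by (simp del: of_nat_mult)
  show ?thesis
  proof (cases "\<exists>j. of_nat (N * j) / of_nat (k * l) = s")
    case True
    then obtain j where j: "of_nat (N * j) / of_nat (k * l) = s" by blast
    have "{J. of_nat J / of_nat (k * l) = s} = {N * j}"
      unfolding j[symmetric] inj by auto
    moreover have "{i. of_nat i / of_nat l = s / (of_nat N / of_nat k)} = {j}"
      unfolding R unfolding j[symmetric] inj using pos by auto
    moreover have "s / (of_nat N / of_nat k) * (of_nat m / of_nat k) = of_nat (j * m) / of_nat (k * l)"
      unfolding j[symmetric] using pos by (simp add: field_simps)
    ultimately show ?thesis
      unfolding z_subst_def using pos by (simp add: Y zeta_power[OF kl] mult.commute del: of_nat_mult)
  next
    case False
    have "Y J = 0" if J: "of_nat J / of_nat (k * l) = s" for J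
    proof -
      have "\<not> N dvd J"
        using False J by (auto simp del: of_nat_mult)
      then show ?thesis by (simp add: Y)
    qed
    moreover have "{i. of_nat i / of_nat l = s / (of_nat N / of_nat k)} = {}"
      unfolding R using False by blast
    ultimately show ?thesis
      unfolding z_subst_def by simp
  qed
qed

text \<open>
  With \<open>P = g\<^bsup>k\<^esup>\<close>, the element attached to the \<open>N\<close>-th power of \<open>((h, \<dots>, h), \<tau>)\<close> at a cycle of \<open>\<sigma>\<close> is
  \<open>(h\<^bsup>N\<^esup>g\<^bsup>-m\<^esup>, m)\<close>, and \<open>m\<close> acts on the coefficient with index \<open>j\<close> by \<open>\<zeta>\<^bsup>jm\<^esup>\<close>.
\<close>

lemma psi_chart:
  fixes G :: "('g, 'm) monoid_scheme" (structure)
  assumes G: "group G" "finite (carrier G)" and x: "x \<in> KDev G" and n: "n \<ge> 1"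
    and gh: "g \<in> carrier G" "h \<in> carrier G" "g \<otimes> h = h \<otimes> g"
    and chart: "chart n (N, k, m) \<alpha> \<phi>" and type: "(N, k, m) \<in> types n"
  shows "psi G n \<alpha> x g h s = z_subst (of_nat N / of_nat k) (of_nat m / of_nat k)
         (dev_char G x (g [^] k) (g [^] (- int m) \<otimes> h [^] N)) s"
proof -
  obtain \<sigma> \<tau> where \<alpha>: "\<alpha> = (\<sigma>, \<tau>)" by fastforce
  note c = chart[unfolded \<alpha>] type n
  note facts = chart_facts[OF c]
  interpret uniform_cycles n k \<sigma>
    by (rule chart_uniform[OF c])
  interpret group G
    by (rule G(1))
  interpret devoto_power G n k \<sigma> g x
    by unfold_locales (use G x n gh in auto)
  define v where "v = diag n h \<tau>"
  define e where "e a = start (\<phi> (a, 0))" for a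
  have cent: "centralizes \<tau>"
    using facts(2) chart_commute[OF c] by (simp add: centralizes_def)
  have \<sigma>in: "\<sigma> i \<in> {1..n}" if "i \<in> {1..n}" for i
    using pow_in[OF that, of 1] by simp
  have diag_Cu: "diag n a \<rho> \<in> carrier Cu" if "centralizes \<rho>" "a \<in> carrier G" "g \<otimes> a = a \<otimes> g" for a \<rho>
  proof -
    have "diag n a \<rho> = (\<lambda>i\<in>{1..n}. a, \<rho>)"
      by (simp add: diag_def)
    then show ?thesis
      using that \<sigma>in by (auto simp: Cu_iff simp del: centr_simps)
  qed
  have v: "v \<in> carrier Cu"
    unfolding v_def using cent gh by (intro diag_Cu) simp_all
  have sndv: "snd v = \<tau>"
    by (simp add: v_def diag_def)
  have bij: "bij_betw e {..<N} C" and loop: "\<And>a. a < N \<Longrightarrow> move (snd v) (e a) = e (cyc N a)"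
    using chart_loop[OF c] unfolding e_def sndv by auto
  have e0: "e 0 \<in> C" and e0n: "e 0 \<in> {1..n}"
    using bij_betwE[OF bij] facts(9) C_sub by auto
  let ?vN = "v [^]\<^bsub>W\<^esub> N"
  have vN: "?vN = diag n (h [^] N) (\<tau> ^^ N)"
    unfolding v_def using facts(2) gh(2) by (rule diag_pow)
  have vNCu: "?vN \<in> carrier Cu"
    by (rule pow_Cu[OF v])
  have centN: "centralizes (\<tau> ^^ N)"
    using Cu_centralizes[OF vNCu] by (simp add: vN diag_def)
  have \<tau>N: "(\<tau> ^^ N) (e 0) = (\<sigma> ^^ m) (e 0)"
    by (rule chart_tau_N[OF c e0n])
  have moveN: "move (\<tau> ^^ N) (e 0) = e 0"
    unfolding \<tau>N start_pow using start_C[OF e0] .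
  have shiftN: "cycle_shift \<sigma> (\<tau> ^^ N) (e 0) = m"
    using shift_unique[OF centN e0n facts(7)] unfolding moveN using \<tau>N by blast
  define c where "c = h [^] N \<otimes> inv g [^] m"
  have cmapN: "cmap ?vN (e 0) = c"
    using pow_in[OF e0n, of "k - 1"] by (simp add: cmap_def vN diag_def moveN shiftN c_def del: atLeastAtMost_iff)
  have cP: "c \<in> carrier (centr G P)"
    using cmap_centr[OF vNCu e0n] unfolding cmapN .
  have D: "str_elt G u ?vN (e 0) = coset (inv t \<otimes> c \<otimes> t, int m)"
    unfolding str_elt_u[OF vNCu e0n] cmapN by (simp add: vN diag_def shiftN)
  have tr: "vrep_trace v (P_str G n x u J) =
      (if N dvd J then zeta (k * ord P) ^ (J div N * m) * vrep_trace c (x P (J div N)) else 0)" for J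
    using cyclic_trace[OF v facts(9) bij loop, of J] unfolding D
    using factor_trace[OF conj_centr[OF cP] facts(7), of "J div N"] conj_trace[OF cP, of "J div N"]
    by (simp add: rho_def parity_part_def ord_r)
  have "psi G n \<alpha> x g h s = (\<Sum>J | of_nat J / of_nat (k * ord P) = s. vrep_trace v (P_str G n x u J))"
    by (simp only: psi_def \<alpha> prod.case dev_char_def v_def ord_u)
  also have "\<dots> = z_subst (of_nat N / of_nat k) (of_nat m / of_nat k)
      (\<lambda>s. \<Sum>j | of_nat j / of_nat (ord P) = s. vrep_trace c (x P j)) s"
    using rescale_series[OF facts(9,8) _ tr] tw.M_pos by (simp add: ord_r)
  also have "(\<lambda>s. \<Sum>j | of_nat j / of_nat (ord P) = s. vrep_trace c (x P j)) = dev_char G x P c"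
    unfolding dev_char_def ..
  also have "c = g [^] (- int m) \<otimes> h [^] N"
  proof -
    have "inv g \<otimes> h = h \<otimes> inv g"
      using commute_inv[OF gh] .
    then have "inv g [^] m \<otimes> h [^] N = h [^] N \<otimes> inv g [^] m"
      using gh by (metis group_commutes_pow inv_closed nat_pow_closed)
    then show ?thesis
      using gh by (simp add: c_def int_pow_neg int_pow_int nat_pow_inv)
  qed
  finally show ?thesis .
qed


section \<open>The formula for the Hecke operators\<close>

theorem mainTheorem13:
  fixes G :: "('g, 'm) monoid_scheme" (structure)
    and x :: "'g \<Rightarrow> nat \<Rightarrow> 'g vrep"
    and n :: nat
    and A :: "((nat \<Rightarrow> nat) \<times> (nat \<Rightarrow> nat)) set"
    and g h :: 'g
  assumes "group G" and "finite (carrier G)"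
    and "x \<in> KDev G"
    and "n \<ge> 1"
    and "rep_system n A"
    and "g \<in> carrier G" and "h \<in> carrier G" and "g \<otimes> h = h \<otimes> g"
  shows "hecke G n A x g h =
    (\<lambda>s. 1 / of_nat n * (\<Sum>(N, k, m)\<in>{(N, k, m). N * k = n \<and> m < k}.
       z_subst (of_nat N / of_nat k) (of_nat m / of_nat k)
         (dev_char G x (g [^] k) (g [^] (- int m) \<otimes> h [^] N)) s))"
proof -
  obtain f where f: "bij_betw f (types n) A"
    and chart: "\<forall>T\<in>types n. \<exists>\<phi>. chart n T (f T) \<phi>"
    by (rule types_bij[OF assms(5,4)])
  have "(\<Sum>\<alpha>\<in>A. psi G n \<alpha> x g h s) =
      (\<Sum>(N, k, m)\<in>{(N, k, m). N * k = n \<and> m < k}.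
       z_subst (of_nat N / of_nat k) (of_nat m / of_nat k)
         (dev_char G x (g [^] k) (g [^] (- int m) \<otimes> h [^] N)) s)" for s
  proof -
    have "(\<Sum>\<alpha>\<in>A. psi G n \<alpha> x g h s) = (\<Sum>T\<in>types n. psi G n (f T) x g h s)"
      by (rule sum.reindex_bij_betw[OF f, symmetric])
    also have "\<dots> = (\<Sum>(N, k, m)\<in>types n.
       z_subst (of_nat N / of_nat k) (of_nat m / of_nat k)
         (dev_char G x (g [^] k) (g [^] (- int m) \<otimes> h [^] N)) s)"
    proof (rule sum.cong[OF refl], clarify)
      fix N k m assume T: "(N, k, m) \<in> types n"
      then obtain \<phi> where "chart n (N, k, m) (f (N, k, m)) \<phi>"
        using chart by blast
      then show "psi G n (f (N, k, m)) x g h s =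
          z_subst (of_nat N / of_nat k) (of_nat m / of_nat k)
            (dev_char G x (g [^] k) (g [^] (- int m) \<otimes> h [^] N)) s"
        using T by (rule psi_chart[OF assms(1-4,6-8)])
    qed
    finally show ?thesis
      unfolding types_def .
  qed
  then show ?thesis
    unfolding hecke_def by simp
qed

end
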